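(* Let the rectangularity index $L\ge 0$ be fixed, and for each $N$ let $G$ be an $N\times N$ matrix from the complex induced Ginibre ensemble with rectangularity index $L$. Let $\mathcal B_{L}$ be a Borel set in $\mathbb R$ that is a neighbourhood of $\sqrt{L}$ and, for each $N$, let $\mathcal B_{L+N}$ be a Borel set in $\mathbb R$ that is a neighbourhood of $\sqrt{L+N}$. Let $r\in\mathcal B_L$ and, for each $N$, $R=R(N)\in\mathcal B_{L+N}$. Then the events $\{r_{max}^{(N)}(G)\le R\}$ and $\{r_{min}^{(N)}(G)\ge r\}$ are independent in the limit as $N\to\infty$, i.e. $$\lim_{N\to+\infty}\left[P\left(r_{min}^{(N)}(G)\ge r\ \text{and}\ r_{max}^{(N)}(G)\le R\right)-P\left(r_{min}^{(N)}(G)\ge r\right)P\left(r_{max}^{(N)}(G)\le R\right)\right]=0.$$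
   Context: The complex induced Ginibre ensemble with rectangularity index $L\ge0$ is the set of $N\times N$ complex matrices $G$ with density (with respect to Lebesgue measure on the entries) proportional to $\left(\det G^\dagger G\right)^{L}\exp\left(-\mathrm{Tr}\,G^\dagger G\right)$. The joint density of its eigenvalues $\lambda_1,\dots,\lambda_N\in\mathbb C$ is $\frac{1}{Z_N}\prod_{j<k}|\lambda_k-\lambda_j|^2\prod_{j=1}^N|\lambda_j|^{2L}\exp\left(-\sum_{j=1}^N|\lambda_j|^2\right)$ with $Z_N=N!\,\pi^N\prod_{k=1}^N\Gamma(k+L)$. Here $r_{min}^{(N)}(G)=\min_j|\lambda_j|$ and $r_{max}^{(N)}(G)=\max_j|\lambda_j|$. *)

theory Defs
  imports
    "HOL-Probability.Probability"
    "Jordan_Normal_Form.Schur_Decomposition"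
    "Jordan_Normal_Form.Spectral_Radius"
begin

text \<open>
  Matrices are those of \<^theory>\<open>Jordan_Normal_Form.Matrix\<close>, whose dimension is a value and not a
  type, so that it can tend to infinity.  Several names (determinant, \<open>mat\<close>) also exist in
  HOL-Analysis, hence the qualified names below.
\<close>

definition mat_trace :: "complex mat \<Rightarrow> complex" where
  "mat_trace A = (\<Sum>i<dim_row A. A $$ (i, i))"

text \<open>
  The determinant and the trace of \<open>G\<^sup>\<dagger>G\<close> are nonnegative reals, so taking real parts loses nothing.
  Since \<open>0 powr 0 = 0\<close>, for \<open>L = 0\<close> the value on singular matrices is \<open>0\<close> instead of
  \<open>exp (- Tr G\<^sup>\<dagger>G)\<close>; singular matrices form a Lebesgue null set, so the distribution is not affected.
\<close>

definition ginibre_weight :: "real \<Rightarrow> complex mat \<Rightarrow> real" where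
  "ginibre_weight L A =
     Re (Determinant.det (mat_adjoint A * A)) powr L * exp (- Re (mat_trace (mat_adjoint A * A)))"

definition lborel_entries :: "nat \<Rightarrow> (nat \<times> nat \<Rightarrow> complex) measure" where
  "lborel_entries N = (\<Pi>\<^sub>M ij\<in>{..<N} \<times> {..<N}. lborel)"

definition mat_entries :: "nat \<Rightarrow> complex mat \<Rightarrow> nat \<times> nat \<Rightarrow> complex" where
  "mat_entries N A = (\<lambda>ij\<in>{..<N} \<times> {..<N}. A $$ ij)"

text \<open>
  \<open>G\<close> is a random matrix on the probability space \<open>M\<close> whose distribution is that of the
  \<open>N \<times> N\<close> complex induced Ginibre ensemble with rectangularity index \<open>L\<close>.  The constant \<open>c\<close> is
  determined by the total mass being \<open>1\<close>.
\<close>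

definition induced_ginibre ::
  "real \<Rightarrow> nat \<Rightarrow> 'a measure \<Rightarrow> ('a \<Rightarrow> complex mat) \<Rightarrow> bool" where
  "induced_ginibre L N M G \<longleftrightarrow>
     prob_space M \<and>
     (\<forall>\<omega>\<in>space M. G \<omega> \<in> carrier_mat N N) \<and>
     (\<exists>c::real. c > 0 \<and>
        distributed M (lborel_entries N) (\<lambda>\<omega>. mat_entries N (G \<omega>))
          (\<lambda>x. ennreal (c * ginibre_weight L (Matrix.mat N N x))))"

text \<open>
  Smallest modulus of an eigenvalue; the largest one is \<^const>\<open>spectral_radius\<close>.  Multiplicities
  are irrelevant for both.
\<close>

definition min_eigenvalue_modulus :: "complex mat \<Rightarrow> real" where
  "min_eigenvalue_modulus A = Min (norm ` spectrum A)"

end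

theory Submission
  imports Defs "HOL-Complex_Analysis.Complex_Analysis"
begin

text \<open>
  The moduli of the eigenvalues behave like independent variables: the probability that all of them lie
  in a closed set \<open>S\<close> is the product over \<open>k < N\<close> of \<open>\<rho>\<^sub>k S\<close>, where \<open>\<rho>\<^sub>k\<close> is the law of \<open>|z|\<close> under the
  density proportional to \<open>|z| powr (2 k + 2 L) * exp (- |z|\<^sup>2)\<close>.  With \<open>S\<close> equal to \<open>{r..R}\<close>, \<open>{r..}\<close>
  and \<open>{..R}\<close>, the difference of interest is at most \<open>\<Sum>k<N. \<rho>\<^sub>k {..r} * \<rho>\<^sub>k {R<..}\<close>, which is small for
  large \<open>R\<close> since \<open>\<rho>\<^sub>k {..r}\<close> decays geometrically in \<open>k\<close>; for bounded \<open>R\<close> it is at most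
  \<open>\<Prod>k<N. \<rho>\<^sub>k {..R}\<close>, which tends to \<open>0\<close>.

  For the product formula one needs the density of the eigenvalues.  Write the matrix as a
  block \<open>D\<close> bordered by a column \<open>v\<close>, a row \<open>w\<close> and a corner \<open>a\<close>.  Replace \<open>a\<close> by an eigenvalue \<open>l\<close>, a
  one-variable holomorphic substitution, then \<open>v\<close> by \<open>u\<close> with \<open>v = (l - D) u\<close>, so that \<open>(u, 1)\<close> is an
  eigenvector, and rotate it to the last coordinate vector, which is a linear substitution in \<open>D\<close>
  and \<open>w\<close>.  This expresses the Gaussian integral of a function of the characteristic polynomial by
  one of size smaller by one.  The substitution for \<open>a\<close> covers almost every matrix \<open>n + 1\<close> times, but
  only the easy upper bound on the multiplicity is used: it gives an inequality between two measures,
  and these are equal since they have the same finite total mass.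
\<close>

section \<open>The area formula in one complex variable\<close>

text \<open>Equality in the corner substitution would require that almost every matrix has
  \<open>n + 1\<close> distinct eigenvalues, none of them an eigenvalue of \<open>D\<close>. The
  inequality needs neither, and the total mass is computable on both sides: as a product of Gaussian
  integrals for matrices, by orthogonality of monomials for eigenvalues. The Jacobians explain the
  shape of the recursion. Let \<open>q\<close> and \<chi> be the characteristic polynomials of
  \<open>D\<close> and of the whole matrix, and \<chi> = (x - l) p with \<open>p\<close> that of the
  deflated block. Replacing \<open>a\<close> by \<open>l\<close> costs |\<chi>'(l)|^2 / |q(l)|^2 and
  replacing \<open>v\<close> by \<open>u\<close> costs |q(l)|^2, so |\<chi>'(l)|^2 = |p(l)|^2
  remains: the Vandermonde factors of the eigenvalue split off. The linear substitution costs (1 +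
  |u|^2)^-(n+1). This is all that is left of \<open>u\<close>, since the Frobenius norm is unitarily
  invariant, and it integrates to a constant. The weight |det G|^(2L) is the value |\<chi>(0)|^(2L),
  hence a function of the characteristic polynomial, so every \<open>L\<close> is covered by one
  identity for the plain Gaussian weight.\<close>

lemma lborel_complex_eq_distr:
  "distr lborel borel (\<lambda>x::real^2. Complex (vec_nth x 1) (vec_nth x 2)) = (lborel :: complex measure)"
proof (rule lborel_eqI[symmetric])
  fix l u :: complex
  assume le: "\<And>b. b \<in> Basis \<Longrightarrow> l \<bullet> b \<le> u \<bullet> b"
  have meas: "(\<lambda>x::real^2. Complex (vec_nth x 1) (vec_nth x 2)) \<in> borel_measurable borel"
    unfolding Complex_eq by measurable
  have B: "(Basis :: (real^2) set) = {axis 1 1, axis 2 1}"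
    unfolding Basis_vec_def by (auto simp: UNIV_2)
  have ne: "axis 1 1 \<noteq> (axis 2 1 :: real^2)"
    by (simp add: axis_eq_axis)
  have "(\<lambda>x::real^2. Complex (vec_nth x 1) (vec_nth x 2)) -` box l u
      = box (vector [Re l, Im l]) (vector [Re u, Im u])"
    by (auto simp: box_def B Basis_complex_def inner_axis inner_complex_def)
  moreover have "Re l \<le> Re u" "Im l \<le> Im u"
    using le[of 1] le[of \<i>] by (auto simp: Basis_complex_def inner_complex_def)
  ultimately show "emeasure (distr lborel borel (\<lambda>x::real^2. Complex (vec_nth x 1) (vec_nth x 2))) (box l u) =
      ennreal (\<Prod>b\<in>Basis. (u - l) \<bullet> b)"
    using ne by (simp add: emeasure_distr meas emeasure_lborel_box_eq B Basis_complex_def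
        inner_axis inner_complex_def ennreal_mult)
qed simp

lemma det_matrix_complex_mult:
  fixes c :: complex
  shows "Determinants.det (matrix (\<lambda>h::real^2. vector [Re (c * Complex (vec_nth h 1) (vec_nth h 2)), Im (c * Complex (vec_nth h 1) (vec_nth h 2))] :: real^2))
    = (norm c)\<^sup>2"
  unfolding det_2 matrix_def cmod_power2
  by (simp add: axis_def power2_eq_square)

text \<open>As a real linear map of the plane, multiplication by \<open>f' z\<close> has determinant
  \<open>(norm (f' z))\<^sup>2\<close>, so this is the real change of variables carried over by
  \<phi> and \<psi>. Boundedness of the image makes its measure finite, as the real theorem in terms
  of \<open>has_integral\<close> requires.\<close>

lemma nn_integral_norm_deriv_square_inj:
  fixes f f' :: "complex \<Rightarrow> complex"
  assumes S: "S \<in> sets borel"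
    and der: "\<And>z. z \<in> S \<Longrightarrow> (f has_field_derivative f' z) (at z within S)"
    and inj: "inj_on f S" and bd: "bounded (f ` S)" and im: "f ` S \<in> sets borel"
    and meas: "(\<lambda>z. indicator S z * (norm (f' z))\<^sup>2 :: real) \<in> borel_measurable borel"
  shows "(\<integral>\<^sup>+z. ennreal (indicator S z * (norm (f' z))\<^sup>2) \<partial>lborel) = emeasure lborel (f ` S)"
proof -
  define \<phi> where "\<phi> = (\<lambda>x::real^2. Complex (vec_nth x 1) (vec_nth x 2))"
  define \<psi> where "\<psi> = (\<lambda>z. vector [Re z, Im z] :: real^2)"
  have \<phi>\<psi>[simp]: "\<phi> (\<psi> z) = z" for z by (simp add: \<phi>_def \<psi>_def)
  have \<psi>\<phi>[simp]: "\<psi> (\<phi> x) = x" for x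
    by (simp add: \<phi>_def \<psi>_def Finite_Cartesian_Product.vec_eq_iff forall_2)
  have m\<phi>[measurable]: "\<phi> \<in> borel_measurable borel"
    unfolding Complex_eq \<phi>_def by measurable
  have lin\<phi>: "bounded_linear \<phi>" and lin\<psi>: "bounded_linear \<psi>"
    by (intro linear_conv_bounded_linear[THEN iffD1] linearI;
        simp add: \<phi>_def \<psi>_def complex_eq_iff Finite_Cartesian_Product.vec_eq_iff forall_2)+
  have im\<psi>: "\<psi> ` T = \<phi> -` T" for T
    by (auto simp: image_iff) (metis \<psi>\<phi>)
  define F where "F = \<psi> \<circ> f \<circ> \<phi>"
  define T where "T = \<phi> -` S"
  have FT: "F ` T = \<phi> -` (f ` S)"
    unfolding F_def T_def image_comp[symmetric] im\<psi>[symmetric] by (simp add: image_image)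
  have Tb: "T \<in> sets borel" "F ` T \<in> sets borel"
    using measurable_sets[OF m\<phi> S] measurable_sets[OF m\<phi> im] unfolding FT by (simp_all add: T_def)
  have "bounded (F ` T)"
    unfolding FT im\<psi>[symmetric] using bd lin\<psi> by (rule bounded_linear_image)
  hence lm: "F ` T \<in> lmeasurable"
    using Tb by (intro bounded_set_imp_lmeasurable) auto
  have der: "(F has_derivative (\<lambda>h. \<psi> (f' (\<phi> x) * \<phi> h))) (at x within T)" if "x \<in> T" for x
  proof -
    have "\<phi> ` T = S" by (auto simp: T_def image_iff) (metis \<phi>\<psi>)
    hence "(f has_derivative (*) (f' (\<phi> x))) (at (\<phi> x) within \<phi> ` T)"
      using der[of "\<phi> x"] that by (simp add: T_def has_field_derivative_def)
    hence "(f \<circ> \<phi> has_derivative (*) (f' (\<phi> x)) \<circ> \<phi>) (at x within T)"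
      using bounded_linear_imp_has_derivative[OF lin\<phi>] by (intro diff_chain_within) auto
    hence "(\<psi> \<circ> (f \<circ> \<phi>) has_derivative \<psi> \<circ> ((*) (f' (\<phi> x)) \<circ> \<phi>)) (at x within T)"
      by (rule diff_chain_within[OF _ bounded_linear_imp_has_derivative[OF lin\<psi>]])
    thus ?thesis by (simp add: F_def comp_def)
  qed
  have "inj_on F T"
  proof (rule inj_onI)
    fix x y assume xy: "x \<in> T" "y \<in> T" "F x = F y"
    have "f (\<phi> x) = f (\<phi> y)"
      using arg_cong[OF xy(3), of \<phi>] by (simp add: F_def)
    hence "\<phi> x = \<phi> y" using inj xy(1,2) by (simp add: T_def inj_on_def)
    hence "\<psi> (\<phi> x) = \<psi> (\<phi> y)" by (rule arg_cong)
    thus "x = y" by (simp only: \<psi>\<phi>)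
  qed
  hence "((\<lambda>x. \<bar>Determinants.det (matrix (\<lambda>h. \<psi> (f' (\<phi> x) * \<phi> h)))\<bar>) has_integral measure lebesgue (F ` T)) T"
    using has_measure_differentiable_image[of T F "\<lambda>x h. \<psi> (f' (\<phi> x) * \<phi> h)" "measure lebesgue (F ` T)"]
      Tb der lm by auto
  hence "((\<lambda>x. (norm (f' (\<phi> x)))\<^sup>2) has_integral measure lebesgue (F ` T)) T"
    using det_matrix_complex_mult by (simp add: \<psi>_def \<phi>_def)
  hence "(\<integral>\<^sup>+x. ennreal (indicator T x * (norm (f' (\<phi> x)))\<^sup>2) \<partial>lborel) = measure lebesgue (F ` T)"
    by (intro nn_integral_has_integral_lebesgue) auto
  also have "ennreal (measure lebesgue (F ` T)) = emeasure lborel (F ` T)"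
    unfolding emeasure_eq_measure2[OF lm, symmetric]
    by (subst emeasure_completion) (use Tb in \<open>simp_all add: main_part_sets\<close>)
  also have "\<dots> = emeasure (distr lborel borel \<phi>) (f ` S)"
    using im by (simp add: FT emeasure_distr)
  also have "distr lborel borel \<phi> = lborel"
    unfolding \<phi>_def by (rule lborel_complex_eq_distr)
  finally have *: "(\<integral>\<^sup>+x. ennreal (indicator T x * (norm (f' (\<phi> x)))\<^sup>2) \<partial>lborel) = emeasure lborel (f ` S)" .
  have "(\<integral>\<^sup>+z. ennreal (indicator S z * (norm (f' z))\<^sup>2) \<partial>lborel) =
      (\<integral>\<^sup>+z. ennreal (indicator S z * (norm (f' z))\<^sup>2) \<partial>distr lborel borel \<phi>)"
    using lborel_complex_eq_distr by (simp add: \<phi>_def)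
  also have "\<dots> = (\<integral>\<^sup>+x. ennreal (indicator S (\<phi> x) * (norm (f' (\<phi> x)))\<^sup>2) \<partial>lborel)"
    using meas by (intro nn_integral_distr) auto
  also have "\<dots> = emeasure lborel (f ` S)"
    unfolding *[symmetric] by (simp add: T_def indicator_def)
  finally show ?thesis .
qed


lemma inj_holomorphic_image_borel:
  assumes "f holomorphic_on B" "open B" "inj_on f B" "S \<subseteq> B" "S \<in> sets borel"
  shows "f ` S \<in> sets borel"
proof -
  obtain g where g: "g holomorphic_on f ` B" "\<And>z. z \<in> B \<Longrightarrow> g (f z) = z"
    using holomorphic_has_inverse[OF assms(1-3)] by metis
  have op: "open (f ` B)"
    using open_mapping_thm3[OF assms(1-3)] .
  have "g \<in> borel_measurable (restrict_space borel (f ` B))"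
    using g(1) by (intro borel_measurable_continuous_on_restrict holomorphic_on_imp_continuous_on)
  hence "g -` S \<inter> space (restrict_space borel (f ` B)) \<in> sets (restrict_space borel (f ` B))"
    using assms(5) by (rule measurable_sets)
  hence "g -` S \<inter> f ` B \<in> sets borel"
    using op by (subst (asm) sets_restrict_space_iff) auto
  moreover have "g -` S \<inter> f ` B = f ` S"
    using g(2) assms(4) by auto
  ultimately show ?thesis by simp
qed

text \<open>The area formula, applied to \<open>E \<inter> f -\<close>
  X\<open>for every Borel set\<close>X\<open>, says that\<close>f\<open>pushes the measure with density |f'|^2 on\<close>E\<open>forward to Lebesgue measure on\<close>f
  \<open>E\<close>. Integrating \<psi> against both gives the claim.\<close>

lemma nn_integral_holomorphic_subst_inj:
  fixes f f' :: "complex \<Rightarrow> complex" and \<psi> :: "complex \<Rightarrow> ennreal"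
  assumes der: "\<And>z. z \<in> B \<Longrightarrow> (f has_field_derivative f' z) (at z)" and op: "open B" and inj: "inj_on f B" and bd: "bounded (f ` B)"
    and E: "E \<subseteq> B" "E \<in> sets borel"
    and f[measurable]: "f \<in> borel_measurable borel"
    and f'[measurable]: "f' \<in> borel_measurable borel"
    and \<psi>[measurable]: "\<psi> \<in> borel_measurable borel"
  shows "(\<integral>\<^sup>+z. indicator E z * (norm (f' z))\<^sup>2 * \<psi> (f z) \<partial>lborel)
       = (\<integral>\<^sup>+a. indicator (f ` E) a * \<psi> a \<partial>lborel)"
proof -
  have hol: "f holomorphic_on B"
    using der op by (auto simp: holomorphic_on_open)
  note E(2)[measurable]
  have [measurable]: "f ` E \<in> sets borel"
    using inj_holomorphic_image_borel[OF hol op inj E] .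
  let ?\<mu> = "distr (density lborel (\<lambda>z. ennreal (indicator E z * (norm (f' z))\<^sup>2))) borel f"
  let ?\<nu> = "density lborel (indicator (f ` E))"
  have eq: "?\<mu> = ?\<nu>"
  proof (rule measure_eqI)
    fix X assume "X \<in> sets ?\<mu>"
    hence X[measurable]: "X \<in> sets borel" by simp
    define S where "S = E \<inter> f -` X"
    have S[measurable]: "S \<in> sets borel"
      unfolding S_def using measurable_sets[OF f X] E by auto
    have SB: "S \<subseteq> B" using E by (auto simp: S_def)
    have "emeasure ?\<mu> X = (\<integral>\<^sup>+z. ennreal (indicator E z * (norm (f' z))\<^sup>2) * indicator (f -` X) z \<partial>lborel)"
      using measurable_sets[OF f X]
      by (simp add: emeasure_distr emeasure_density)
    also have "\<dots> = (\<integral>\<^sup>+z. ennreal (indicator S z * (norm (f' z))\<^sup>2) \<partial>lborel)"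
      by (intro nn_integral_cong) (auto simp: S_def indicator_def)
    also have "\<dots> = emeasure lborel (f ` S)"
    proof (rule nn_integral_norm_deriv_square_inj)
      show "(f has_field_derivative f' z) (at z within S)" if "z \<in> S" for z
        using der[OF subsetD[OF SB that]] by (rule has_field_derivative_at_within)
      show "inj_on f S" using inj SB by (rule inj_on_subset)
      show "bounded (f ` S)" using bd image_mono[OF SB] by (rule bounded_subset)
      show "f ` S \<in> sets borel" using inj_holomorphic_image_borel[OF hol op inj SB S] .
    qed (use S in measurable)
    also have "f ` S = f ` E \<inter> X" by (auto simp: S_def)
    also have "emeasure lborel (f ` E \<inter> X) = emeasure ?\<nu> X"
      by (simp add: emeasure_density indicator_inter_arith[symmetric])
    finally show "emeasure ?\<mu> X = emeasure ?\<nu> X" .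
  qed simp
  have "(\<integral>\<^sup>+z. indicator E z * (norm (f' z))\<^sup>2 * \<psi> (f z) \<partial>lborel) = (\<integral>\<^sup>+a. \<psi> a \<partial>?\<mu>)"
    by (simp add: nn_integral_distr nn_integral_density ennreal_mult' ennreal_indicator)
  also have "\<dots> = (\<integral>\<^sup>+a. indicator (f ` E) a * \<psi> a \<partial>lborel)"
    unfolding eq by (simp add: nn_integral_density)
  finally show ?thesis .
qed

text \<open>Critical points carry weight 0. Off them \<open>f\<close> is locally injective, and by
  Lindelof countably many domains of injectivity suffice; made disjoint, they reduce the claim to
  the injective case. A point \<open>a\<close> lies in the images of at most \<open>N\<close>
  pieces, because each such piece contains its own preimage of \<open>a\<close>.\<close>

lemma nn_integral_holomorphic_subst_le:
  fixes f f' :: "complex \<Rightarrow> complex" and \<psi> :: "complex \<Rightarrow> ennreal"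
  assumes der: "\<And>z. z \<in> W \<Longrightarrow> (f has_field_derivative f' z) (at z)" and op: "open W"
    and fib: "\<And>a. finite {z \<in> W. f z = a} \<and> card {z \<in> W. f z = a} \<le> N"
    and f[measurable]: "f \<in> borel_measurable borel"
    and f'[measurable]: "f' \<in> borel_measurable borel"
    and \<psi>[measurable]: "\<psi> \<in> borel_measurable borel"
  shows "(\<integral>\<^sup>+z. indicator W z * (norm (f' z))\<^sup>2 * \<psi> (f z) \<partial>lborel) \<le> of_nat N * (\<integral>\<^sup>+a. \<psi> a \<partial>lborel)"
proof -
  have hol: "f holomorphic_on W"
    using der op by (auto simp: holomorphic_on_open)
  define \<F> where "\<F> = {B. open B \<and> B \<subseteq> W \<and> inj_on f B \<and> bounded (f ` B)}"
  have cov: "{z \<in> W. f' z \<noteq> 0} \<subseteq> \<Union>\<F>"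
  proof
    fix z assume "z \<in> {z \<in> W. f' z \<noteq> 0}"
    hence z: "z \<in> W" "f' z \<noteq> 0" by auto
    have "deriv f z \<noteq> 0" using z der[of z] by (simp add: DERIV_imp_deriv)
    then obtain r where r: "r > 0" "ball z r \<subseteq> W" "inj_on f (ball z r)"
      using has_complex_derivative_locally_injective[OF hol z(1) op] by blast
    \<comment> \<open>Halving the radius puts the ball inside a compact set on which
      \<open>f\<close> is continuous, which yields the bounded image required in
      \<open>\<F>\<close>.\<close>
    have "cball z (r/2) \<subseteq> ball z r" using r(1) by auto
    moreover have "continuous_on (cball z (r/2)) f"
      using calculation r hol by (meson continuous_on_subset holomorphic_on_imp_continuous_on subset_trans)
    hence "bounded (f ` cball z (r/2))"
      by (intro compact_imp_bounded compact_continuous_image) auto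
    hence "bounded (f ` ball z (r/2))"
      by (rule bounded_subset) auto
    ultimately have "ball z (r/2) \<in> \<F>"
      unfolding \<F>_def using r ball_subset_cball[of z "r/2"] by (auto intro: inj_on_subset)
    thus "z \<in> \<Union>\<F>" using r(1) by (intro UnionI[of "ball z (r/2)"]) auto
  qed
  obtain \<F>' where F': "\<F>' \<subseteq> \<F>" "countable \<F>'" "\<Union>\<F>' = \<Union>\<F>"
    using Lindelof[of \<F>] unfolding \<F>_def by blast
  \<comment> \<open>The empty set is added so that \<open>from_nat_into\<close> enumerates a
    nonempty family even when \<open>\<F>'\<close> is empty, for instance when \<open>f'\<close>
    vanishes on all of \<open>W\<close>.\<close>
  have "{} \<in> \<F>" by (simp add: \<F>_def)
  define B where "B = from_nat_into (insert {} \<F>')"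
  have B: "B i \<in> \<F>" for i
    using from_nat_into[OF insert_not_empty[of "{}" \<F>'], of i] F'(1) \<open>{} \<in> \<F>\<close>
    unfolding B_def by auto
  have BW: "z \<in> B i \<Longrightarrow> z \<in> W" for z i
    using B[of i] by (auto simp: \<F>_def)
  have UB: "(\<Union>i. B i) = \<Union>\<F>"
    using range_from_nat_into[OF insert_not_empty[of "{}" \<F>']] F'(2,3) unfolding B_def by simp
  define E where "E = disjointed B"
  have EB: "E i \<subseteq> B i" for i unfolding E_def by (rule disjointed_subset)
  have E[measurable]: "E i \<in> sets borel" for i
  proof -
    have "range B \<subseteq> sets borel" using B by (auto simp: \<F>_def)
    from sets.range_disjointed_sets[OF this] show ?thesis
      unfolding E_def by (rule subsetD) simp
  qed
  have dis: "disjoint_family E" unfolding E_def by (rule disjoint_family_disjointed)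
  have UE: "(\<Union>i. E i) = \<Union>\<F>" unfolding E_def UN_disjointed_eq UB ..
  have fE[measurable]: "f ` E i \<in> sets borel" for i
    using B[of i] EB[of i] hol holomorphic_on_subset
    by (intro inj_holomorphic_image_borel[where B = "B i"]) (auto simp: \<F>_def)
  have *: "ennreal (indicator W z * (norm (f' z))\<^sup>2) * \<psi> (f z)
      = (\<Sum>i. ennreal (indicator (E i) z * (norm (f' z))\<^sup>2) * \<psi> (f z))" for z
  proof -
    have "indicator W z * ennreal ((norm (f' z))\<^sup>2) = indicator (\<Union>i. E i) z * ennreal ((norm (f' z))\<^sup>2)"
    proof (cases "f' z = 0")
      case False
      have "\<Union>\<F> \<subseteq> W" by (auto simp: \<F>_def)
      with cov False show ?thesis unfolding UE by (auto simp: indicator_def)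
    qed auto
    also have "indicator (\<Union>i. E i) z = (\<Sum>i. indicator (E i) z :: ennreal)"
      using suminf_indicator[OF dis, of z] by simp
    finally show ?thesis by (simp add: mult.assoc ennreal_mult' ennreal_indicator)
  qed
  \<comment> \<open>Choosing a preimage of \<open>a\<close> in every piece that has one is injective
    in the index, since the pieces are disjoint; the fibre bound then limits the number of
    pieces.\<close>
  have cnt: "(\<Sum>i. indicator (f ` E i) a) \<le> (of_nat N :: ennreal)" for a
  proof (rule suminf_le_const)
    fix n
    define J where "J = {i \<in> {..<n}. a \<in> f ` E i}"
    have "\<forall>i\<in>J. \<exists>z. z \<in> E i \<and> f z = a" by (auto simp: J_def)
    then obtain c where c: "\<And>i. i \<in> J \<Longrightarrow> c i \<in> E i \<and> f (c i) = a" by metis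
    have "inj_on c J"
      using c dis unfolding inj_on_def disjoint_family_on_def by (metis IntI UNIV_I empty_iff)
    moreover have "c ` J \<subseteq> {z \<in> W. f z = a}"
      using c EB B by (auto simp: \<F>_def) blast
    ultimately have "card J \<le> card {z \<in> W. f z = a}"
      using fib[of a] by (metis card_image card_mono)
    with fib[of a] have "card J \<le> N" by linarith
    moreover have "(\<Sum>i<n. indicator (f ` E i) a) = (of_nat (card J) :: ennreal)"
      by (simp add: J_def indicator_def sum.If_cases Int_def)
    ultimately show "(\<Sum>i<n. indicator (f ` E i) a) \<le> (of_nat N :: ennreal)"
      by simp
  qed auto
  have "(\<integral>\<^sup>+z. indicator W z * (norm (f' z))\<^sup>2 * \<psi> (f z) \<partial>lborel)
      = (\<Sum>i. \<integral>\<^sup>+z. indicator (E i) z * (norm (f' z))\<^sup>2 * \<psi> (f z) \<partial>lborel)"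
    unfolding * by (intro nn_integral_suminf) measurable
  also have "\<dots> = (\<Sum>i. \<integral>\<^sup>+a. indicator (f ` E i) a * \<psi> a \<partial>lborel)"
    using B EB der[OF BW]
    by (intro suminf_cong nn_integral_holomorphic_subst_inj[where B = "B _"]) (auto simp: \<F>_def)
  also have "\<dots> = (\<integral>\<^sup>+a. (\<Sum>i. indicator (f ` E i) a * \<psi> a) \<partial>lborel)"
    by (intro nn_integral_suminf[symmetric]) measurable
  also have "\<dots> \<le> (\<integral>\<^sup>+a. of_nat N * \<psi> a \<partial>lborel)"
    using cnt by (intro nn_integral_mono) (auto intro: mult_right_mono)
  also have "\<dots> = of_nat N * (\<integral>\<^sup>+a. \<psi> a \<partial>lborel)"
    by (intro nn_integral_cmult) auto
  finally show ?thesis .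
qed

section \<open>Linear changes of variables on product Lebesgue measure\<close>

text \<open>If column \<open>k\<close> vanished from row \<open>k\<close> on, it would be a
  combination of the first \<open>k\<close> columns, which are unit vectors. The vector
  \<open>v\<close> records this combination and would lie in the kernel.\<close>

lemma nonsingular_column_pivot:
  fixes A :: "'a::field mat"
  assumes A: "A \<in> carrier_mat n n" and det: "Determinant.det A \<noteq> 0" and k: "k < n"
    and unit: "\<And>i j. i < n \<Longrightarrow> j < k \<Longrightarrow> A $$ (i, j) = (if i = j then 1 else 0)"
  obtains l where "k \<le> l" "l < n" "A $$ (l, k) \<noteq> 0"
proof (rule ccontr)
  assume "\<not> thesis"
  with that have z: "A $$ (l, k) = 0" if "k \<le> l" "l < n" for l using that by blast
  define v where "v = Matrix.vec n (\<lambda>j. if j < k then - A $$ (j, k) else if j = k then 1 else 0)"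
  have "A *\<^sub>v v = 0\<^sub>v n"
  proof (rule eq_vecI)
    fix i assume "i < dim_vec (0\<^sub>v n :: 'a Matrix.vec)"
    hence i: "i < n" by simp
    have "(A *\<^sub>v v) $ i = (\<Sum>j<n. A $$ (i, j) * (if j < k then - A $$ (j, k) else if j = k then 1 else 0))"
      using A i by (simp add: mult_mat_vec_def scalar_prod_def v_def atLeast0LessThan)
    also have "{..<n} = {..<k} \<union> ({k} \<union> {k<..<n})" using k by auto
    also have "(\<Sum>j\<in>{..<k} \<union> ({k} \<union> {k<..<n}). A $$ (i, j) * (if j < k then - A $$ (j, k) else if j = k then 1 else 0))
      = (\<Sum>j<k. A $$ (i, j) * - A $$ (j, k)) + A $$ (i, k)"
      by (subst sum.union_disjoint; (subst sum.union_disjoint)?) auto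
    also have "(\<Sum>j<k. A $$ (i, j) * - A $$ (j, k)) = (\<Sum>j<k. if i = j then - A $$ (j, k) else 0)"
      using i unit by (intro sum.cong) auto
    also have "\<dots> + A $$ (i, k) = 0"
      using z[of i] i by auto
    finally show "(A *\<^sub>v v) $ i = 0\<^sub>v n $ i" using i by simp
  qed (use A in auto)
  moreover have "v $ k \<noteq> 0\<^sub>v n $ k" using k by (simp add: v_def)
  hence "v \<noteq> 0\<^sub>v n" by auto
  moreover have "v \<in> carrier_vec n" by (simp add: v_def)
  ultimately show False
    using det_0_iff_vec_prod_zero_field[OF A] det by blast
qed

text \<open>Gauss-Jordan elimination with the invariant \<open>P = F * A\<close>: each row operation
  on \<open>A\<close> is undone by an elementary factor absorbed into \<open>F\<close>, so
  \<open>Q F\<close> persists until \<open>A\<close> is the identity. Row swaps are avoided, because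
  a zero pivot is repaired by adding a lower row.\<close>

lemma elementary_mat_induct [consumes 2, case_names one add mult times]:
  fixes P :: "'a::field mat"
  assumes P: "P \<in> carrier_mat n n" and det: "Determinant.det P \<noteq> 0"
    and one: "Q (1\<^sub>m n)"
    and add: "\<And>a k l. k < n \<Longrightarrow> l < n \<Longrightarrow> k \<noteq> l \<Longrightarrow> Q (addrow_mat n a k l)"
    and mult: "\<And>a k. k < n \<Longrightarrow> a \<noteq> 0 \<Longrightarrow> Q (multrow_mat n k a)"
    and times: "\<And>A B. A \<in> carrier_mat n n \<Longrightarrow> B \<in> carrier_mat n n \<Longrightarrow>
      Determinant.det A \<noteq> 0 \<Longrightarrow> Determinant.det B \<noteq> 0 \<Longrightarrow> Q A \<Longrightarrow> Q B \<Longrightarrow> Q (A * B)"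
  shows "Q P"
proof -
  define red where "red = (\<lambda>A. A \<in> carrier_mat n n \<and> Determinant.det A \<noteq> 0 \<and>
     (\<exists>F \<in> carrier_mat n n. Determinant.det F \<noteq> 0 \<and> Q F \<and> P = F * A))"
  have red_step: "red (E' * A)"
    if "red A" "E \<in> carrier_mat n n" "E' \<in> carrier_mat n n" "E * E' = 1\<^sub>m n" "Q E" for A E E'
  proof -
    from that(1) obtain F where F: "A \<in> carrier_mat n n" "Determinant.det A \<noteq> 0" "F \<in> carrier_mat n n"
       "Determinant.det F \<noteq> 0" "Q F" "P = F * A" unfolding red_def by blast
    have "Determinant.det E * Determinant.det E' = 1"
      using det_mult[OF that(2,3)] that(4) by simp
    hence dets: "Determinant.det E \<noteq> 0" "Determinant.det E' \<noteq> 0" by auto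
    have "P = (F * E) * (E' * A)"
    proof -
      have "(F * E) * (E' * A) = F * (E * (E' * A))"
        using F that by (simp add: assoc_mult_mat[of _ n n _ n _ n])
      also have "E * (E' * A) = A"
        using F that by (simp add: assoc_mult_mat[of _ n n _ n _ n, symmetric])
      finally show ?thesis using F by simp
    qed
    moreover have "Q (F * E)" using F that dets by (intro times) auto
    ultimately show ?thesis unfolding red_def using F that dets
      by (intro conjI bexI[of _ "F * E"]) (auto simp: det_mult[of _ n])
  qed
  have add_step: "red (addrow a k l A)" if "red A" "k < n" "l < n" "k \<noteq> l" for A a k l
  proof -
    have A: "A \<in> carrier_mat n n" using that(1) by (simp add: red_def)
    have "addrow_mat n (- a) k l * addrow_mat n a k l = 1\<^sub>m n"
      using addrow_mat_inv[OF that(2-4), of "- a"] by simp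
    from red_step[OF that(1) _ _ this] add[OF that(2-4)] show ?thesis
      by (simp add: addrow_mat[OF A that(3), symmetric])
  qed
  have mult_step: "red (multrow k a A)" if "red A" "k < n" "a \<noteq> 0" for A a k
  proof -
    have A: "A \<in> carrier_mat n n" using that(1) by (simp add: red_def)
    have "multrow_mat n k (inverse a) * multrow_mat n k a = 1\<^sub>m n"
      using multrow_mat_inv[OF that(2), of "inverse a"] that(3) by simp
    from red_step[OF that(1) _ _ this] mult[OF that(2), of "inverse a"] that(3) show ?thesis
      by (simp add: multrow_mat[OF A, symmetric])
  qed
  have main: "\<exists>A. red A \<and> (\<forall>i<n. \<forall>j<k. A $$ (i, j) = (if i = j then 1 else 0))" if "k \<le> n" for k
    using that
  proof (induction k)
    case 0
    have "red P" unfolding red_def using P det one by (intro conjI bexI[of _ "1\<^sub>m n"]) auto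
    thus ?case by auto
  next
    case (Suc k)
    hence k: "k < n" by simp
    from Suc obtain A where A: "red A" "\<And>i j. i < n \<Longrightarrow> j < k \<Longrightarrow> A $$ (i, j) = (if i = j then 1 else 0)"
      by auto
    have "\<exists>A. red A \<and> (\<forall>i<n. \<forall>j<k. A $$ (i, j) = (if i = j then 1 else 0)) \<and> A $$ (k, k) \<noteq> 0"
    proof (cases "A $$ (k, k) = 0")
      case True
      obtain l where l: "k \<le> l" "l < n" "A $$ (l, k) \<noteq> 0"
        using nonsingular_column_pivot[of A n k] A k unfolding red_def by blast
      have lk: "k \<noteq> l" using l True by auto
      have AC: "A \<in> carrier_mat n n" using A by (simp add: red_def)
      \<comment> \<open>Adding row \<open>l\<close> to row \<open>k\<close> makes the pivot nonzero.
        Both rows vanish in the columns before \<open>k\<close>, so these remain unit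
        vectors.\<close>
      show ?thesis
        using add_step[OF A(1) k l(2) lk, of 1] A(2) l k True AC
        by (intro exI[of _ "addrow 1 k l A"]) auto
    qed (use A in auto)
    then obtain B where B: "red B" "\<And>i j. i < n \<Longrightarrow> j < k \<Longrightarrow> B $$ (i, j) = (if i = j then 1 else 0)"
       "B $$ (k, k) \<noteq> 0" by blast
    define C where "C = multrow k (inverse (B $$ (k, k))) B"
    have BC: "B \<in> carrier_mat n n" using B by (simp add: red_def)
    have C: "red C" "\<And>i j. i < n \<Longrightarrow> j < k \<Longrightarrow> C $$ (i, j) = (if i = j then 1 else 0)" "C $$ (k, k) = 1"
      unfolding C_def using mult_step[OF B(1) k] B k BC by auto
    have "\<exists>A. red A \<and> (\<forall>i<n. \<forall>j<k. A $$ (i, j) = (if i = j then 1 else 0)) \<and> A $$ (k, k) = 1 \<and>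
       (\<forall>i<m. i \<noteq> k \<longrightarrow> A $$ (i, k) = 0)" if "m \<le> n" for m
      using that
    proof (induction m)
      case 0
      thus ?case using C by auto
    next
      case (Suc m)
      hence m: "m < n" by simp
      from Suc obtain A where A: "red A" "\<And>i j. i < n \<Longrightarrow> j < k \<Longrightarrow> A $$ (i, j) = (if i = j then 1 else 0)"
        "A $$ (k, k) = 1" "\<And>i. i < m \<Longrightarrow> i \<noteq> k \<Longrightarrow> A $$ (i, k) = 0" by auto
      have AC: "A \<in> carrier_mat n n" using A by (simp add: red_def)
      show ?case
      proof (cases "m = k")
        case True
        thus ?thesis using A by (intro exI[of _ A]) (auto simp: less_Suc_eq)
      next
        case False
        thus ?thesis using add_step[OF A(1) m k False, of "- A $$ (m, k)"] A m k AC
          by (intro exI[of _ "addrow (- A $$ (m, k)) m k A"]) (auto simp: less_Suc_eq)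
      qed
    qed
    from this[of n] show ?case by (auto simp: less_Suc_eq)
  qed
  from main[of n] obtain A where A: "red A" "\<And>i j. i < n \<Longrightarrow> j < n \<Longrightarrow> A $$ (i, j) = (if i = j then 1 else 0)"
    by auto
  hence "A = 1\<^sub>m n" by (intro eq_matI) (auto simp: red_def)
  with A(1) show ?thesis by (auto simp: red_def)
qed

section \<open>Maps that scale Lebesgue measure on finite powers of the complex plane\<close>

abbreviation lborel_PiM :: "'i set \<Rightarrow> ('i \<Rightarrow> complex) measure" where
  "lborel_PiM I \<equiv> PiM I (\<lambda>_. lborel)"

interpretation lborel_PiM: product_sigma_finite "\<lambda>_. lborel :: complex measure"
  by standard

abbreviation lborel_vec :: "nat \<Rightarrow> (nat \<Rightarrow> complex) measure" where
  "lborel_vec n \<equiv> lborel_PiM {..<n}"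

abbreviation lborel_mat :: "nat \<Rightarrow> (nat \<times> nat \<Rightarrow> complex) measure" where
  "lborel_mat n \<equiv> lborel_PiM ({..<n} \<times> {..<n})"

text \<open>The constant \<open>c\<close> is the real Jacobian of \<open>T\<close>; for a complex
  linear map it is the squared modulus of the determinant. Stated for integrals, the property
  composes without any mention of inverse maps.\<close>

definition scales_lebesgue :: "'i set \<Rightarrow> (('i \<Rightarrow> complex) \<Rightarrow> ('i \<Rightarrow> complex)) \<Rightarrow> real \<Rightarrow> bool" where
  "scales_lebesgue I T c \<longleftrightarrow> T \<in> lborel_PiM I \<rightarrow>\<^sub>M lborel_PiM I \<and>
     (\<forall>f \<in> borel_measurable (lborel_PiM I).
        ennreal c * (\<integral>\<^sup>+x. f (T x) \<partial>lborel_PiM I) = (\<integral>\<^sup>+x. f x \<partial>lborel_PiM I))"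

lemma scales_lebesgueD:
  assumes "scales_lebesgue I T c" "f \<in> borel_measurable (lborel_PiM I)"
  shows "(\<integral>\<^sup>+x. f x \<partial>lborel_PiM I) = ennreal c * (\<integral>\<^sup>+x. f (T x) \<partial>lborel_PiM I)"
  using assms unfolding scales_lebesgue_def by simp

lemma scales_lebesgue_measurable: "scales_lebesgue I T c \<Longrightarrow> T \<in> lborel_PiM I \<rightarrow>\<^sub>M lborel_PiM I"
  unfolding scales_lebesgue_def by simp

lemma scales_lebesgue_id: "scales_lebesgue I (\<lambda>x. x) 1"
  unfolding scales_lebesgue_def by simp

lemma scales_lebesgue_comp:
  assumes S: "scales_lebesgue I S c" and T: "scales_lebesgue I T d" and "0 \<le> c" "0 \<le> d"
  shows "scales_lebesgue I (\<lambda>x. S (T x)) (c * d)"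
  unfolding scales_lebesgue_def
proof safe
  note S' = scales_lebesgue_measurable[OF S] and T' = scales_lebesgue_measurable[OF T]
  show "(\<lambda>x. S (T x)) \<in> lborel_PiM I \<rightarrow>\<^sub>M lborel_PiM I"
    using measurable_compose[OF T' S'] .
  fix f :: "_ \<Rightarrow> ennreal" assume f: "f \<in> borel_measurable (lborel_PiM I)"
  have "(\<integral>\<^sup>+x. f x \<partial>lborel_PiM I) = ennreal c * (\<integral>\<^sup>+x. f (S x) \<partial>lborel_PiM I)"
    using scales_lebesgueD[OF S f] .
  also have "(\<integral>\<^sup>+x. f (S x) \<partial>lborel_PiM I) = ennreal d * (\<integral>\<^sup>+x. f (S (T x)) \<partial>lborel_PiM I)"
    using scales_lebesgueD[OF T measurable_compose[OF S' f]] .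
  finally show "ennreal (c * d) * (\<integral>\<^sup>+x. f (S (T x)) \<partial>lborel_PiM I) = (\<integral>\<^sup>+x. f x \<partial>lborel_PiM I)"
    using assms by (simp add: ennreal_mult mult.assoc)
qed

lemma scales_lebesgue_cong:
  assumes "scales_lebesgue I S c" "\<And>x. x \<in> extensional I \<Longrightarrow> S x = T x"
  shows "scales_lebesgue I T c"
proof -
  have *: "S x = T x" if "x \<in> space (lborel_PiM I)" for x
    using assms(2) that by (auto simp: space_PiM PiE_def)
  have "(\<integral>\<^sup>+x. f (S x) \<partial>lborel_PiM I) = (\<integral>\<^sup>+x. f (T x) \<partial>lborel_PiM I)" for f
    using * by (intro nn_integral_cong) auto
  moreover have "S \<in> lborel_PiM I \<rightarrow>\<^sub>M lborel_PiM I \<longleftrightarrow> T \<in> lborel_PiM I \<rightarrow>\<^sub>M lborel_PiM I"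
    using * by (intro measurable_cong) auto
  ultimately show ?thesis using assms(1) unfolding scales_lebesgue_def by simp
qed

text \<open>Tonelli with coordinate \<open>i\<close> innermost reduces this to one complex variable.
  The condition \<open>indep\<close> says that the parameters of the substitution do not involve the
  coordinate being replaced.\<close>

lemma scales_lebesgue_coord:
  assumes I: "finite I" and i: "i \<in> I"
    and T: "(\<lambda>x. x(i := g x (x i))) \<in> lborel_PiM I \<rightarrow>\<^sub>M lborel_PiM I"
    and indep: "\<And>x a. g (x(i := a)) = g x"
    and g: "\<And>x (f :: complex \<Rightarrow> ennreal). f \<in> borel_measurable borel \<Longrightarrow>
       ennreal c * (\<integral>\<^sup>+a. f (g x a) \<partial>lborel) = (\<integral>\<^sup>+a. f a \<partial>lborel)"
  shows "scales_lebesgue I (\<lambda>x. x(i := g x (x i))) c"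
  unfolding scales_lebesgue_def
proof safe
  fix f :: "_ \<Rightarrow> ennreal" assume f: "f \<in> borel_measurable (lborel_PiM I)"
  define J where "J = I - {i}"
  have IJ: "I = insert i J" "finite J" "i \<notin> J" using I i by (auto simp: J_def)
  have upd: "(\<lambda>(x, a). x(i := a)) \<in> lborel_PiM J \<Otimes>\<^sub>M lborel \<rightarrow>\<^sub>M lborel_PiM I"
    unfolding IJ(1) by (rule measurable_add_dim)
  let ?F = "\<lambda>x. f (x(i := g x (x i)))"
  have F: "?F \<in> borel_measurable (lborel_PiM I)" by (rule measurable_compose[OF T f])
  have upd_a: "(\<lambda>a. x(i := a)) \<in> lborel \<rightarrow>\<^sub>M lborel_PiM I" if "x \<in> space (lborel_PiM J)" for x
    using measurable_compose[OF measurable_Pair1'[OF that] upd] by simp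
  have FI: "(\<lambda>(x, a). ?F (x(i := a))) \<in> borel_measurable (lborel_PiM J \<Otimes>\<^sub>M lborel)"
    using measurable_compose[OF upd F] by (simp add: case_prod_unfold)
  have "ennreal c * (\<integral>\<^sup>+x. ?F x \<partial>lborel_PiM I) = ennreal c * (\<integral>\<^sup>+x. \<integral>\<^sup>+a. ?F (x(i := a)) \<partial>lborel \<partial>lborel_PiM J)"
    unfolding IJ(1) using F IJ by (subst lborel_PiM.product_nn_integral_insert) auto
  also have "\<dots> = (\<integral>\<^sup>+x. ennreal c * (\<integral>\<^sup>+a. ?F (x(i := a)) \<partial>lborel) \<partial>lborel_PiM J)"
    using FI by (intro nn_integral_cmult[symmetric] lborel.borel_measurable_nn_integral)
  also have "\<dots> = (\<integral>\<^sup>+x. (\<integral>\<^sup>+a. f (x(i := a)) \<partial>lborel) \<partial>lborel_PiM J)"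
  proof (rule nn_integral_cong)
    fix x assume "x \<in> space (lborel_PiM J)"
    from measurable_compose[OF upd_a[OF this] f]
    have "(\<lambda>a. f (x(i := a))) \<in> borel_measurable borel" by simp
    from g[OF this, of x] show "ennreal c * (\<integral>\<^sup>+a. ?F (x(i := a)) \<partial>lborel) = (\<integral>\<^sup>+a. f (x(i := a)) \<partial>lborel)"
      by (simp add: indep)
  qed
  also have "\<dots> = (\<integral>\<^sup>+x. f x \<partial>lborel_PiM I)"
    unfolding IJ(1) using f IJ by (subst lborel_PiM.product_nn_integral_insert) auto
  finally show "ennreal c * (\<integral>\<^sup>+x. ?F x \<partial>lborel_PiM I) = (\<integral>\<^sup>+x. f x \<partial>lborel_PiM I)" .
qed (rule T)

lemma nn_integral_lborel_translate:
  fixes f :: "complex \<Rightarrow> ennreal"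
  assumes "f \<in> borel_measurable borel"
  shows "(\<integral>\<^sup>+a. f (a + c) \<partial>lborel) = (\<integral>\<^sup>+a. f a \<partial>lborel)"
proof -
  have "(\<integral>\<^sup>+a. f a \<partial>lborel) = (\<integral>\<^sup>+a. f a \<partial>distr lborel borel ((+) c))"
    by (simp add: lborel_distr_plus)
  also have "\<dots> = (\<integral>\<^sup>+a. f (c + a) \<partial>lborel)"
    using assms by (intro nn_integral_distr) auto
  finally show ?thesis by (simp add: add.commute)
qed

text \<open>The fibres of a multiplication are single points, so the one-sided substitution bound
  holds with factor 1; applied to \<open>c\<close> and to \<open>inverse c\<close> it gives both
  inequalities.\<close>

lemma nn_integral_lborel_complex_mult:
  fixes f :: "complex \<Rightarrow> ennreal"
  assumes [measurable]: "f \<in> borel_measurable borel" and c: "c \<noteq> 0"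
  shows "ennreal ((norm c)\<^sup>2) * (\<integral>\<^sup>+a. f (c * a) \<partial>lborel) = (\<integral>\<^sup>+a. f a \<partial>lborel)"
proof -
  have le: "ennreal ((norm c)\<^sup>2) * (\<integral>\<^sup>+a. f (c * a) \<partial>lborel) \<le> (\<integral>\<^sup>+a. f a \<partial>lborel)"
    if [measurable]: "f \<in> borel_measurable borel" and c: "c \<noteq> 0" for c :: complex and f :: "complex \<Rightarrow> ennreal"
  proof -
    have "{z. c * z = a} = {a / c}" for a using c by (auto simp: field_simps)
    hence "(\<integral>\<^sup>+z. indicator UNIV z * (norm c)\<^sup>2 * f (c * z) \<partial>lborel)
        \<le> of_nat 1 * (\<integral>\<^sup>+a. f a \<partial>lborel)"
      by (intro nn_integral_holomorphic_subst_le) (auto intro!: derivative_eq_intros)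
    thus ?thesis by (simp add: nn_integral_cmult)
  qed
  have "(\<integral>\<^sup>+a. f a \<partial>lborel) = ennreal ((norm c)\<^sup>2) * (ennreal ((norm (inverse c))\<^sup>2) * (\<integral>\<^sup>+a. f (c * (inverse c * a)) \<partial>lborel))"
  proof -
    have "ennreal ((norm c)\<^sup>2) * ennreal ((norm (inverse c))\<^sup>2) = 1"
      using c by (simp add: ennreal_mult[symmetric] norm_inverse power_mult_distrib[symmetric])
    thus ?thesis using c by (simp add: mult.assoc[symmetric])
  qed
  also have "\<dots> \<le> ennreal ((norm c)\<^sup>2) * (\<integral>\<^sup>+a. f (c * a) \<partial>lborel)"
    using le[of "\<lambda>a. f (c * a)" "inverse c"] c by (intro mult_left_mono) auto
  finally show ?thesis using le[of f c] c by (intro antisym) auto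
qed

text \<open>The injection \<iota> picks the coordinates on which the matrix acts. One rotation lemma
  thus serves vectors, single columns and single rows of a matrix alike.\<close>

definition act :: "(nat \<Rightarrow> 'i) \<Rightarrow> nat \<Rightarrow> complex mat \<Rightarrow> ('i \<Rightarrow> complex) \<Rightarrow> 'i \<Rightarrow> complex" where
  "act \<iota> n P x = (\<lambda>k. if k \<in> \<iota> ` {..<n}
      then \<Sum>l<n. P $$ (the_inv_into {..<n} \<iota> k, l) * x (\<iota> l) else x k)"

lemma act_apply: "inj_on \<iota> {..<n} \<Longrightarrow> k < n \<Longrightarrow> act \<iota> n P x (\<iota> k) = (\<Sum>l<n. P $$ (k, l) * x (\<iota> l))"
  by (simp add: act_def the_inv_into_f_f)

lemma act_other: "k \<notin> \<iota> ` {..<n} \<Longrightarrow> act \<iota> n P x k = x k"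
  by (simp add: act_def)

lemma act_eqI:
  assumes "inj_on \<iota> {..<n}" "\<And>k. k < n \<Longrightarrow> (\<Sum>l<n. P $$ (k, l) * x (\<iota> l)) = y (\<iota> k)"
    "\<And>k. k \<notin> \<iota> ` {..<n} \<Longrightarrow> x k = y k"
  shows "act \<iota> n P x = y"
proof
  fix k show "act \<iota> n P x k = y k"
    by (cases "k \<in> \<iota> ` {..<n}") (auto simp: act_apply act_other assms)
qed

text \<open>By elementary factorisation: adding a multiple of one coordinate to another is a
  translation in a single variable with factor 1, scaling a coordinate by \<open>a\<close> has
  factor |a|^2, and both the maps and the determinants are multiplicative.\<close>

lemma scales_lebesgue_act:
  assumes I: "finite I" and inj: "inj_on \<iota> {..<n}" and \<iota>: "\<iota> ` {..<n} \<subseteq> I"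
    and P: "P \<in> carrier_mat n n" "Determinant.det P \<noteq> 0"
  shows "scales_lebesgue I (act \<iota> n P) ((norm (Determinant.det P))\<^sup>2)"
  using P
proof (induction rule: elementary_mat_induct)
  case one
  have "act \<iota> n (1\<^sub>m n) x = x" for x
    by (intro act_eqI inj) (auto simp: one_mat_def if_distrib[of "\<lambda>c. c * _"] cong: if_cong)
  hence "act \<iota> n (1\<^sub>m n) = (\<lambda>x. x)" by auto
  thus ?case using scales_lebesgue_id by simp
next
  case (add a k l)
  have ik: "\<iota> k \<in> I" "\<iota> l \<in> I" "\<iota> l \<noteq> \<iota> k" using add \<iota> inj by (auto dest: inj_onD)
  have eq: "act \<iota> n (addrow_mat n a k l) x = x(\<iota> k := x (\<iota> k) + a * x (\<iota> l))" for x
  proof (intro act_eqI inj)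
    fix i assume i: "i < n"
    show "(\<Sum>j<n. addrow_mat n a k l $$ (i, j) * x (\<iota> j)) = (x(\<iota> k := x (\<iota> k) + a * x (\<iota> l))) (\<iota> i)"
    proof (cases "i = k")
      case True
      have "(\<Sum>j<n. addrow_mat n a k l $$ (i, j) * x (\<iota> j))
        = (\<Sum>j<n. (if j = l then a * x (\<iota> l) else 0) + (if j = k then x (\<iota> k) else 0))"
        using True add by (intro sum.cong) auto
      also have "\<dots> = x (\<iota> k) + a * x (\<iota> l)" using add by (simp add: sum.distrib)
      finally show ?thesis using True by simp
    next
      case False
      have "(\<Sum>j<n. addrow_mat n a k l $$ (i, j) * x (\<iota> j)) = (\<Sum>j<n. if j = i then x (\<iota> i) else 0)"
        using False add i by (intro sum.cong) auto
      thus ?thesis using False add i inj by (auto dest: inj_onD)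
    qed
  next
    fix i assume "i \<notin> \<iota> ` {..<n}"
    thus "x i = (x(\<iota> k := x (\<iota> k) + a * x (\<iota> l))) i" using add by auto
  qed
  have "scales_lebesgue I (\<lambda>x. x(\<iota> k := (\<lambda>x b. b + a * x (\<iota> l)) x (x (\<iota> k)))) 1"
  proof (rule scales_lebesgue_coord[OF I ik(1)])
    show "(\<lambda>x. x(\<iota> k := (\<lambda>x b. b + a * x (\<iota> l)) x (x (\<iota> k)))) \<in> lborel_PiM I \<rightarrow>\<^sub>M lborel_PiM I"
      using ik by (intro measurable_fun_upd[where J=I]) (auto simp: insert_absorb)
  qed (use ik in \<open>auto simp: nn_integral_lborel_translate\<close>)
  moreover have "(norm (Determinant.det (addrow_mat n a k l)))\<^sup>2 = 1"
    using add by (simp add: det_addrow_mat)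
  moreover have "act \<iota> n (addrow_mat n a k l) = (\<lambda>x. x(\<iota> k := x (\<iota> k) + a * x (\<iota> l)))"
    using eq by (rule ext)
  ultimately show ?case by (simp only:)
next
  case (mult a k)
  have ik: "\<iota> k \<in> I" using mult \<iota> by auto
  have eq: "act \<iota> n (multrow_mat n k a) x = x(\<iota> k := a * x (\<iota> k))" for x
  proof (intro act_eqI inj)
    fix i assume i: "i < n"
    have "(\<Sum>j<n. multrow_mat n k a $$ (i, j) * x (\<iota> j)) = (\<Sum>j<n. if j = i then (if i = k then a else 1) * x (\<iota> i) else 0)"
      using mult i by (intro sum.cong) auto
    thus "(\<Sum>j<n. multrow_mat n k a $$ (i, j) * x (\<iota> j)) = (x(\<iota> k := a * x (\<iota> k))) (\<iota> i)"
      using i mult inj by (auto dest: inj_onD)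
  next
    fix i assume "i \<notin> \<iota> ` {..<n}"
    thus "x i = (x(\<iota> k := a * x (\<iota> k))) i" using mult by auto
  qed
  have "scales_lebesgue I (\<lambda>x. x(\<iota> k := (\<lambda>x b. a * b) x (x (\<iota> k)))) ((norm a)\<^sup>2)"
  proof (rule scales_lebesgue_coord[OF I ik])
    show "(\<lambda>x. x(\<iota> k := (\<lambda>x b. a * b) x (x (\<iota> k)))) \<in> lborel_PiM I \<rightarrow>\<^sub>M lborel_PiM I"
      using ik by (intro measurable_fun_upd[where J=I]) (auto simp: insert_absorb)
  qed (use mult in \<open>auto simp: nn_integral_lborel_complex_mult\<close>)
  moreover have "Determinant.det (multrow_mat n k a) = a"
    using mult by (simp add: det_multrow_mat)
  moreover have "act \<iota> n (multrow_mat n k a) = (\<lambda>x. x(\<iota> k := a * x (\<iota> k)))"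
    using eq by (rule ext)
  ultimately show ?case by (simp only:)
next
  case (times A B)
  have "act \<iota> n (A * B) x = act \<iota> n A (act \<iota> n B x)" for x
  proof (intro act_eqI inj)
    fix k assume k: "k < n"
    have "(\<Sum>l<n. (A * B) $$ (k, l) * x (\<iota> l)) = (\<Sum>l<n. \<Sum>j<n. A $$ (k, j) * (B $$ (j, l) * x (\<iota> l)))"
      using times k by (auto simp: scalar_prod_def sum_distrib_right sum_distrib_left atLeast0LessThan mult.assoc intro!: sum.cong)
    also have "\<dots> = (\<Sum>j<n. A $$ (k, j) * act \<iota> n B x (\<iota> j))"
      by (subst sum.swap) (simp add: act_apply inj sum_distrib_left)
    finally show "(\<Sum>l<n. (A * B) $$ (k, l) * x (\<iota> l)) = act \<iota> n A (act \<iota> n B x) (\<iota> k)"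
      using k by (simp add: act_apply inj)
  qed (simp add: act_other)
  hence "act \<iota> n (A * B) = (\<lambda>x. act \<iota> n A (act \<iota> n B x))" by auto
  moreover have "(norm (Determinant.det (A * B)))\<^sup>2 = (norm (Determinant.det A))\<^sup>2 * (norm (Determinant.det B))\<^sup>2"
    using times by (simp add: det_mult[of _ n] norm_mult power_mult_distrib)
  ultimately show ?case using scales_lebesgue_comp[OF times(5,6)] by simp
qed

lemma scales_lebesgue_shift:
  assumes I: "finite I"
  shows "scales_lebesgue I (\<lambda>x. \<lambda>i\<in>I. x i + c i) 1"
proof -
  let ?T = "\<lambda>x. \<lambda>i\<in>I. x i + c i"
  have T[measurable]: "?T \<in> lborel_PiM I \<rightarrow>\<^sub>M lborel_PiM I"
    by measurable
  have "distr (lborel_PiM I) (lborel_PiM I) ?T = lborel_PiM I"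
  proof (rule lborel_PiM.PiM_eqI)
    fix A :: "'a \<Rightarrow> complex set" assume A: "\<And>i. i \<in> I \<Longrightarrow> A i \<in> sets lborel"
    have m: "(+) (c i) -` A i \<in> sets borel" if "i \<in> I" for i
      using measurable_sets[of "(+) (c i)" borel borel "A i"] A[OF that] by simp
    have "emeasure (distr (lborel_PiM I) (lborel_PiM I) ?T) (Pi\<^sub>E I A)
        = emeasure (lborel_PiM I) (?T -` Pi\<^sub>E I A \<inter> space (lborel_PiM I))"
      using A I by (intro emeasure_distr T sets_PiM_I_finite) auto
    also have "?T -` Pi\<^sub>E I A \<inter> space (lborel_PiM I) = (\<Pi>\<^sub>E i\<in>I. (+) (c i) -` A i)"
      by (auto simp: space_PiM PiE_def Pi_def add.commute)
    also have "emeasure (lborel_PiM I) \<dots> = (\<Prod>i\<in>I. emeasure lborel ((+) (c i) -` A i))"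
      using m I by (intro lborel_PiM.emeasure_PiM) auto
    also have "\<dots> = (\<Prod>i\<in>I. emeasure lborel (A i))"
    proof (rule prod.cong)
      fix i assume "i \<in> I"
      hence "emeasure (distr lborel borel ((+) (c i))) (A i) = emeasure lborel ((+) (c i) -` A i)"
        using A by (subst emeasure_distr) auto
      thus "emeasure lborel ((+) (c i) -` A i) = emeasure lborel (A i)"
        by (simp add: lborel_distr_plus)
    qed simp
    finally show "emeasure (distr (lborel_PiM I) (lborel_PiM I) ?T) (Pi\<^sub>E I A) = (\<Prod>i\<in>I. emeasure lborel (A i))" .
  qed (use I in auto)
  hence "(\<integral>\<^sup>+x. f (?T x) \<partial>lborel_PiM I) = (\<integral>\<^sup>+x. f x \<partial>lborel_PiM I)"
    if "f \<in> borel_measurable (lborel_PiM I)" for f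
    using nn_integral_distr[OF T, of f] that by simp
  thus ?thesis unfolding scales_lebesgue_def using T by simp
qed

text \<open>Left multiplication acts on the \<open>n\<close> columns separately, each contributing
  one factor |det P|^2. \<open>T m\<close> is the state in which the first \<open>m\<close> columns
  have been treated.\<close>

lemma scales_lebesgue_mult_left:
  assumes P: "P \<in> carrier_mat n n" "Determinant.det P \<noteq> 0"
  shows "scales_lebesgue ({..<n} \<times> {..<n})
    (\<lambda>x (i, j). if i < n \<and> j < n then \<Sum>l<n. P $$ (i, l) * x (l, j) else x (i, j))
    ((norm (Determinant.det P))\<^sup>2 ^ n)"
proof -
  define T where "T m = (\<lambda>x (i, j). if i < n \<and> j < m then \<Sum>l<n. P $$ (i, l) * x (l, j) else x (i, j))" for m :: nat
  have "scales_lebesgue ({..<n} \<times> {..<n}) (T m) ((norm (Determinant.det P))\<^sup>2 ^ m)" if "m \<le> n" for m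
    using that
  proof (induction m)
    case 0
    have "T 0 = (\<lambda>x. x)" by (auto simp: T_def)
    thus ?case using scales_lebesgue_id by simp
  next
    case (Suc m)
    have "scales_lebesgue ({..<n} \<times> {..<n}) (act (\<lambda>i. (i, m)) n P) ((norm (Determinant.det P))\<^sup>2)"
      using Suc P by (intro scales_lebesgue_act) (auto simp: inj_on_def)
    from scales_lebesgue_comp[OF this Suc.IH] Suc.prems
    have "scales_lebesgue ({..<n} \<times> {..<n}) (\<lambda>x. act (\<lambda>i. (i, m)) n P (T m x)) ((norm (Determinant.det P))\<^sup>2 ^ Suc m)"
      by simp
    moreover have "act (\<lambda>i. (i, m)) n P (T m x) = T (Suc m) x" for x
      by (intro act_eqI) (auto simp: inj_on_def T_def image_iff)
    ultimately show ?case by simp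
  qed
  from this[of n] show ?thesis by (simp add: T_def)
qed

text \<open>The same argument by rows: right multiplication by \<open>P\<close> acts on every row
  through the transpose, whose determinant is the same.\<close>

lemma scales_lebesgue_mult_right:
  assumes P: "P \<in> carrier_mat n n" "Determinant.det P \<noteq> 0"
  shows "scales_lebesgue ({..<n} \<times> {..<n})
    (\<lambda>x (i, j). if i < n \<and> j < n then \<Sum>l<n. x (i, l) * P $$ (l, j) else x (i, j))
    ((norm (Determinant.det P))\<^sup>2 ^ n)"
proof -
  define T where "T m = (\<lambda>x (i, j). if i < m \<and> j < n then \<Sum>l<n. x (i, l) * P $$ (l, j) else x (i, j))" for m :: nat
  let ?Q = "transpose_mat P"
  have Q: "?Q \<in> carrier_mat n n" "Determinant.det ?Q = Determinant.det P"
    using P by (auto simp: det_transpose)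
  have "scales_lebesgue ({..<n} \<times> {..<n}) (T m) ((norm (Determinant.det P))\<^sup>2 ^ m)" if "m \<le> n" for m
    using that
  proof (induction m)
    case 0
    have "T 0 = (\<lambda>x. x)" by (auto simp: T_def)
    thus ?case using scales_lebesgue_id by simp
  next
    case (Suc m)
    have "scales_lebesgue ({..<n} \<times> {..<n}) (act (\<lambda>j. (m, j)) n ?Q) ((norm (Determinant.det P))\<^sup>2)"
      using Suc P Q unfolding Q(2)[symmetric] by (intro scales_lebesgue_act) (auto simp: inj_on_def)
    from scales_lebesgue_comp[OF this Suc.IH] Suc.prems
    have "scales_lebesgue ({..<n} \<times> {..<n}) (\<lambda>x. act (\<lambda>j. (m, j)) n ?Q (T m x)) ((norm (Determinant.det P))\<^sup>2 ^ Suc m)"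
      by simp
    moreover have "act (\<lambda>j. (m, j)) n ?Q (T m x) = T (Suc m) x" for x
      using P by (intro act_eqI) (auto simp: inj_on_def T_def image_iff mult.commute intro!: sum.cong)
    ultimately show ?case by simp
  qed
  from this[of n] show ?thesis by (simp add: T_def)
qed

section \<open>Bordered matrices: block, bottom row, right column, corner\<close>

definition border ::
  "nat \<Rightarrow> (nat \<times> nat \<Rightarrow> complex) \<Rightarrow> (nat \<Rightarrow> complex) \<Rightarrow> (nat \<Rightarrow> complex) \<Rightarrow> complex \<Rightarrow> nat \<times> nat \<Rightarrow> complex"
  where "border n D w v a = (\<lambda>(i, j)\<in>{..<Suc n} \<times> {..<Suc n}.
    if i < n then (if j < n then D (i, j) else v i) else (if j < n then w j else a))"

lemma border_simps:
  "i < n \<Longrightarrow> j < n \<Longrightarrow> border n D w v a (i, j) = D (i, j)"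
  "i < n \<Longrightarrow> border n D w v a (i, n) = v i"
  "j < n \<Longrightarrow> border n D w v a (n, j) = w j"
  "border n D w v a (n, n) = a"
  by (auto simp: border_def)

abbreviation border_measure where
  "border_measure n \<equiv> lborel_mat n \<Otimes>\<^sub>M (lborel_vec n \<Otimes>\<^sub>M (lborel_vec n \<Otimes>\<^sub>M (lborel :: complex measure)))"

lemma border_measurable:
  "(\<lambda>(D, w, v, a). border n D w v a) \<in> border_measure n \<rightarrow>\<^sub>M lborel_mat (Suc n)"
  unfolding border_def split_beta
proof (rule measurable_restrict)
  fix ij :: "nat \<times> nat" assume "ij \<in> {..<Suc n} \<times> {..<Suc n}"
  show "(\<lambda>x. if fst ij < n then (if snd ij < n then fst x (fst ij, snd ij) else fst (snd (snd x)) (fst ij))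
     else (if snd ij < n then fst (snd x) (snd ij) else snd (snd (snd x)))) \<in> border_measure n \<rightarrow>\<^sub>M lborel"
  proof (cases ij)
    case (Pair i j)
    show ?thesis unfolding Pair fst_conv snd_conv
      by (cases "i < n"; cases "j < n"; simp only: if_True if_False)
        (rule measurable_compose[OF measurable_fst measurable_component_singleton]
         measurable_compose[OF measurable_compose[OF measurable_snd measurable_compose[OF measurable_snd measurable_fst]] measurable_component_singleton]
         measurable_compose[OF measurable_compose[OF measurable_snd measurable_fst] measurable_component_singleton]
         measurable_compose[OF measurable_snd measurable_compose[OF measurable_snd measurable_snd]]; simp)+
  qed
qed

text \<open>A product measure is determined by its values on boxes, and the preimage of a box is a
  product of four boxes, one for each part of the matrix.\<close>

lemma distr_border:
  "distr (border_measure n) (lborel_mat (Suc n)) (\<lambda>(D, w, v, a). border n D w v a)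
    = lborel_mat (Suc n)"
proof (rule lborel_PiM.PiM_eqI)
  let ?I = "{..<Suc n} \<times> {..<Suc n}"
  let ?E = "\<lambda>(D, w, v, a). border n D w v a"
  fix A :: "nat \<times> nat \<Rightarrow> complex set" assume A: "\<And>i. i \<in> ?I \<Longrightarrow> A i \<in> sets lborel"
  interpret b1: sigma_finite_measure "lborel_vec n"
    by (rule lborel_PiM.sigma_finite) simp
  interpret b2: pair_sigma_finite "lborel_vec n" "lborel :: complex measure" ..
  interpret b3: pair_sigma_finite "lborel_vec n"
     "lborel_vec n \<Otimes>\<^sub>M (lborel :: complex measure)" ..
  have sf2: "sigma_finite_measure (lborel_vec n \<Otimes>\<^sub>M (lborel :: complex measure))"
    and sf3: "sigma_finite_measure (lborel_vec n \<Otimes>\<^sub>M (lborel_vec n \<Otimes>\<^sub>M (lborel :: complex measure)))"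
    by unfold_locales
  have "emeasure (distr (border_measure n) (lborel_PiM ?I) ?E) (Pi\<^sub>E ?I A)
      = emeasure (border_measure n) (?E -` Pi\<^sub>E ?I A \<inter> space (border_measure n))"
    using A by (intro emeasure_distr border_measurable sets_PiM_I_finite) auto
  also have "?E -` Pi\<^sub>E ?I A \<inter> space (border_measure n) =
     (\<Pi>\<^sub>E ij\<in>{..<n} \<times> {..<n}. A ij) \<times> (\<Pi>\<^sub>E j\<in>{..<n}. A (n, j)) \<times> (\<Pi>\<^sub>E i\<in>{..<n}. A (i, n)) \<times> A (n, n)"
    (is "?L = ?R")
  proof (intro equalityI subsetI)
    fix x assume "x \<in> ?L"
    then obtain D w v a where x: "x = (D, w, v, a)" "D \<in> extensional ({..<n} \<times> {..<n})"
       "w \<in> extensional {..<n}" "v \<in> extensional {..<n}"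
      and m: "\<And>i j. i < Suc n \<Longrightarrow> j < Suc n \<Longrightarrow> border n D w v a (i, j) \<in> A (i, j)"
      by (cases x) (auto simp: space_pair_measure space_PiM PiE_def Pi_def)
    have "D (i, j) \<in> A (i, j)" "w j \<in> A (n, j)" "v i \<in> A (i, n)" if "i < n" "j < n" for i j
      using m[of i j] m[of n j] m[of i n] that by (simp_all add: border_simps)
    moreover have "a \<in> A (n, n)" using m[of n n] by (simp add: border_simps)
    ultimately show "x \<in> ?R" using x by (auto simp: PiE_def Pi_def)
  next
    fix x assume "x \<in> ?R"
    then obtain D w v a where x: "x = (D, w, v, a)" "D \<in> (\<Pi>\<^sub>E ij\<in>{..<n} \<times> {..<n}. A ij)"
       "w \<in> (\<Pi>\<^sub>E j\<in>{..<n}. A (n, j))" "v \<in> (\<Pi>\<^sub>E i\<in>{..<n}. A (i, n))" "a \<in> A (n, n)"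
      by (cases x) auto
    have "border n D w v a \<in> Pi\<^sub>E ?I A"
    proof (rule PiE_I)
      fix ij assume "ij \<in> ?I"
      thus "border n D w v a ij \<in> A ij"
        using x by (auto simp: border_def PiE_def Pi_def less_Suc_eq split: if_splits)
    qed (auto simp: border_def)
    thus "x \<in> ?L" using x by (auto simp: space_pair_measure space_PiM PiE_def)
  qed
  also have "emeasure (border_measure n) ?R =
     (\<Prod>ij\<in>{..<n} \<times> {..<n}. emeasure lborel (A ij)) * ((\<Prod>j<n. emeasure lborel (A (n, j))) *
       ((\<Prod>i<n. emeasure lborel (A (i, n))) * emeasure lborel (A (n, n))))"
  proof -
    have A1: "A ij \<in> sets lborel" if "ij \<in> {..<n} \<times> {..<n}" for ij
      using that by (intro A) auto
    have A2: "A (n, j) \<in> sets lborel" "A (j, n) \<in> sets lborel" if "j \<in> {..<n}" for j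
      using that by (auto intro!: A simp del: sets_lborel)
    have A3: "A (n, n) \<in> sets lborel" by (intro A) auto
    have S1: "Pi\<^sub>E ({..<n} \<times> {..<n}) A \<in> sets (lborel_mat n)"
      using A1 by (intro sets_PiM_I_finite) auto
    have S2: "(\<Pi>\<^sub>E j\<in>{..<n}. A (n, j)) \<in> sets (lborel_vec n)" "(\<Pi>\<^sub>E i\<in>{..<n}. A (i, n)) \<in> sets (lborel_vec n)"
      using A2 by (intro sets_PiM_I_finite; auto)+
    show ?thesis
      using A1 A2
      by (simp only: sigma_finite_measure.emeasure_pair_measure_Times[OF sf3 S1 pair_measureI[OF S2(1) pair_measureI[OF S2(2) A3]]]
        sigma_finite_measure.emeasure_pair_measure_Times[OF sf2 S2(1) pair_measureI[OF S2(2) A3]]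
        lborel.emeasure_pair_measure_Times[OF S2(2) A3] lborel_PiM.emeasure_PiM finite_lessThan finite_SigmaI)
  qed
  also have "\<dots> = (\<Prod>i<Suc n. \<Prod>j<Suc n. emeasure lborel (A (i, j)))"
    by (simp add: prod.distrib prod.cartesian_product' mult_ac)
  also have "\<dots> = (\<Prod>ij\<in>?I. emeasure lborel (A ij))"
    unfolding prod.cartesian_product by (simp add: case_prod_unfold)
  finally show "emeasure (distr (border_measure n) (lborel_PiM ?I) ?E) (Pi\<^sub>E ?I A) = (\<Prod>ij\<in>?I. emeasure lborel (A ij))" .
qed auto


text \<open>The order of the integrals is that of the substitutions to come: the corner, to be
  exchanged for an eigenvalue, is innermost, followed by the column, to be exchanged for an
  eigenvector. Block and row stay fixed during both.\<close>

lemma nn_integral_border: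
  assumes f: "f \<in> borel_measurable (lborel_mat (Suc n))"
  shows "(\<integral>\<^sup>+x. f x \<partial>lborel_mat (Suc n)) =
    (\<integral>\<^sup>+D. \<integral>\<^sup>+w. \<integral>\<^sup>+v. \<integral>\<^sup>+a. f (border n D w v a) \<partial>lborel \<partial>lborel_vec n
       \<partial>lborel_vec n \<partial>lborel_mat n)"
proof -
  interpret b1: sigma_finite_measure "lborel_vec n"
    by (rule lborel_PiM.sigma_finite) simp
  interpret b2: pair_sigma_finite "lborel_vec n" "lborel :: complex measure" ..
  interpret b3: pair_sigma_finite "lborel_vec n"
     "lborel_vec n \<Otimes>\<^sub>M (lborel :: complex measure)" ..
  have sf2: "sigma_finite_measure (lborel_vec n \<Otimes>\<^sub>M (lborel :: complex measure))"
    and sf3: "sigma_finite_measure (lborel_vec n \<Otimes>\<^sub>M (lborel_vec n \<Otimes>\<^sub>M (lborel :: complex measure)))"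
    by unfold_locales
  have F: "(\<lambda>(D, w, v, a). f (border n D w v a)) \<in> borel_measurable (border_measure n)"
    using measurable_compose[OF border_measurable f] by (simp add: case_prod_unfold)
  have "(\<integral>\<^sup>+x. f x \<partial>lborel_mat (Suc n)) = (\<integral>\<^sup>+(D, w, v, a). f (border n D w v a) \<partial>border_measure n)"
    by (subst distr_border[symmetric], subst nn_integral_distr[OF border_measurable])
      (use f in \<open>auto simp: case_prod_unfold\<close>)
  also have "\<dots> = (\<integral>\<^sup>+D. \<integral>\<^sup>+(w, v, a). f (border n D w v a)
     \<partial>(lborel_vec n \<Otimes>\<^sub>M (lborel_vec n \<Otimes>\<^sub>M lborel)) \<partial>lborel_mat n)"
    using sigma_finite_measure.nn_integral_fst[OF sf3 F] by (simp add: case_prod_unfold)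
  also have "\<dots> = (\<integral>\<^sup>+D. \<integral>\<^sup>+w. \<integral>\<^sup>+(v, a). f (border n D w v a)
     \<partial>(lborel_vec n \<Otimes>\<^sub>M lborel) \<partial>lborel_vec n \<partial>lborel_mat n)"
  proof (rule nn_integral_cong)
    fix D :: "nat \<times> nat \<Rightarrow> complex" assume D: "D \<in> space (lborel_mat n)"
    from sigma_finite_measure.nn_integral_fst[OF sf2 measurable_compose[OF measurable_Pair1'[OF D] F]]
    show "(\<integral>\<^sup>+(w, v, a). f (border n D w v a) \<partial>(lborel_vec n \<Otimes>\<^sub>M (lborel_vec n \<Otimes>\<^sub>M lborel))) =
      (\<integral>\<^sup>+w. \<integral>\<^sup>+(v, a). f (border n D w v a) \<partial>(lborel_vec n \<Otimes>\<^sub>M lborel) \<partial>lborel_vec n)"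
      by (simp add: case_prod_unfold)
  qed
  also have "\<dots> = (\<integral>\<^sup>+D. \<integral>\<^sup>+w. \<integral>\<^sup>+v. \<integral>\<^sup>+a. f (border n D w v a) \<partial>lborel \<partial>lborel_vec n
       \<partial>lborel_vec n \<partial>lborel_mat n)"
  proof (intro nn_integral_cong)
    fix D :: "nat \<times> nat \<Rightarrow> complex" and w :: "nat \<Rightarrow> complex"
    assume D: "D \<in> space (lborel_mat n)" and w: "w \<in> space (lborel_vec n)"
    from lborel.nn_integral_fst[OF measurable_compose[OF measurable_Pair1'[OF w] measurable_compose[OF measurable_Pair1'[OF D] F]]]
    show "(\<integral>\<^sup>+(v, a). f (border n D w v a) \<partial>(lborel_vec n \<Otimes>\<^sub>M lborel)) =
      (\<integral>\<^sup>+v. \<integral>\<^sup>+a. f (border n D w v a) \<partial>lborel \<partial>lborel_vec n)"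
      by (simp add: case_prod_unfold)
  qed
  finally show ?thesis .
qed

section \<open>Determinants, traces and characteristic polynomials\<close>

lemma mult_mat_index_sum:
  assumes "A \<in> carrier_mat n m" "B \<in> carrier_mat m k" "i < n" "j < k"
  shows "(A * B) $$ (i, j) = (\<Sum>l<m. A $$ (i, l) * B $$ (l, j))"
  using assms by (auto simp: scalar_prod_def atLeast0LessThan intro!: sum.cong)

lemma mat_adjoint_index:
  fixes A :: "complex mat"
  assumes "A \<in> carrier_mat n m" "i < m" "j < n"
  shows "mat_adjoint A $$ (i, j) = cnj (A $$ (j, i))"
  using assms unfolding mat_adjoint_def by (simp add: mat_of_rows_index conjugate_complex_def)

lemma mat_adjoint_carrier:
  assumes "A \<in> carrier_mat n m"
  shows "mat_adjoint A \<in> carrier_mat m n"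
  using assms unfolding mat_adjoint_def by (auto intro!: carrier_matI)

lemma mat_adjoint_mult:
  fixes A B :: "complex mat"
  assumes "A \<in> carrier_mat n m" "B \<in> carrier_mat m k"
  shows "mat_adjoint (A * B) = mat_adjoint B * mat_adjoint A"
proof (rule eq_matI)
  note c = mat_adjoint_carrier[OF assms(1)] mat_adjoint_carrier[OF assms(2)]
  fix i j assume "i < dim_row (mat_adjoint B * mat_adjoint A)" "j < dim_col (mat_adjoint B * mat_adjoint A)"
  hence ij: "i < k" "j < n" using c by auto
  have "mat_adjoint (A * B) $$ (i, j) = cnj ((A * B) $$ (j, i))"
    using mult_carrier_mat[OF assms] ij by (rule mat_adjoint_index)
  also have "\<dots> = (\<Sum>l<m. cnj (A $$ (j, l)) * cnj (B $$ (l, i)))"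
    using ij assms by (simp add: mult_mat_index_sum[OF assms] del: index_mult_mat)
  also have "\<dots> = (\<Sum>l<m. mat_adjoint B $$ (i, l) * mat_adjoint A $$ (l, j))"
    using ij assms by (intro sum.cong) (auto simp: mat_adjoint_index mult.commute)
  also have "\<dots> = (mat_adjoint B * mat_adjoint A) $$ (i, j)"
    using mult_mat_index_sum[OF c(2,1) ij] by simp
  finally show "mat_adjoint (A * B) $$ (i, j) = (mat_adjoint B * mat_adjoint A) $$ (i, j)" .
qed (use mat_adjoint_carrier[OF assms(1)] mat_adjoint_carrier[OF assms(2)]
    mat_adjoint_carrier[OF mult_carrier_mat[OF assms]] in auto)

lemma mat_adjoint_adjoint:
  fixes A :: "complex mat"
  assumes "A \<in> carrier_mat n m"
  shows "mat_adjoint (mat_adjoint A) = A"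
proof -
  note c = mat_adjoint_carrier[OF assms] mat_adjoint_carrier[OF mat_adjoint_carrier[OF assms]]
  show ?thesis
    using assms c by (intro eq_matI) (auto simp: mat_adjoint_index[OF c(1)] mat_adjoint_index[OF assms])
qed

lemma det_mat_adjoint:
  fixes A :: "complex mat"
  assumes A: "A \<in> carrier_mat n n"
  shows "Determinant.det (mat_adjoint A) = cnj (Determinant.det A)"
proof -
  have "mat_adjoint A = map_mat cnj (transpose_mat A)"
    using A mat_adjoint_carrier[OF A] by (intro eq_matI) (auto simp: mat_adjoint_index)
  moreover have "Determinant.det (map_mat cnj (transpose_mat A)) = cnj (Determinant.det (transpose_mat A))"
  proof -
    interpret comm_ring_hom cnj by unfold_locales auto
    show ?thesis by simp
  qed
  ultimately show ?thesis using A by (simp add: det_transpose)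
qed

lemma mat_trace_mult_commute:
  assumes "A \<in> carrier_mat n m" "B \<in> carrier_mat m n"
  shows "mat_trace (A * B) = mat_trace (B * A)"
proof -
  have "mat_trace (A * B) = (\<Sum>i<n. \<Sum>l<m. A $$ (i, l) * B $$ (l, i))"
    using assms by (simp add: mat_trace_def mult_mat_index_sum[OF assms] del: index_mult_mat(1))
  also have "\<dots> = (\<Sum>l<m. \<Sum>i<n. B $$ (l, i) * A $$ (i, l))"
    by (subst sum.swap) (simp add: mult.commute)
  also have "\<dots> = mat_trace (B * A)"
    using assms by (simp add: mat_trace_def mult_mat_index_sum[OF assms(2,1)] del: index_mult_mat(1))
  finally show ?thesis .
qed

definition frob_square :: "nat \<Rightarrow> (nat \<times> nat \<Rightarrow> complex) \<Rightarrow> real" where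
  "frob_square n x = (\<Sum>i<n. \<Sum>j<n. (norm (x (i, j)))\<^sup>2)"

lemma mat_trace_adjoint_mult:
  assumes A: "A \<in> carrier_mat n n"
  shows "mat_trace (mat_adjoint A * A) = of_real (frob_square n (($$) A))"
proof -
  note c = mat_adjoint_carrier[OF A]
  have "mat_trace (mat_adjoint A * A) = (\<Sum>j<n. \<Sum>i<n. cnj (A $$ (i, j)) * A $$ (i, j))"
    using A c by (simp add: mat_trace_def mult_mat_index_sum[OF c A] mat_adjoint_index[OF A] del: index_mult_mat(1))
  also have "\<dots> = (\<Sum>i<n. \<Sum>j<n. cnj (A $$ (i, j)) * A $$ (i, j))"
    by (rule sum.swap)
  also have "\<dots> = of_real (frob_square n (($$) A))"
    by (simp add: frob_square_def complex_norm_square[symmetric] mult.commute[of "cnj _"] del: of_real_power)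
  finally show ?thesis .
qed

lemma mat_trace_unitary_conj:
  fixes U T :: "complex mat"
  assumes U: "U \<in> carrier_mat n n" "mat_adjoint U * U = 1\<^sub>m n" and T: "T \<in> carrier_mat n n"
  defines "A \<equiv> U * T * mat_adjoint U"
  shows "mat_trace (mat_adjoint A * A) = mat_trace (mat_adjoint T * T)"
proof -
  note c = mat_adjoint_carrier[OF U(1)] mat_adjoint_carrier[OF T]
  note as = assoc_mult_mat[of _ n n _ n _ n]
  have "mat_adjoint A = U * mat_adjoint T * mat_adjoint U"
    unfolding A_def using U T c by (simp add: mat_adjoint_mult[of _ n n _ n] mat_adjoint_adjoint[of _ n n] as)
  hence "mat_adjoint A * A = U * (mat_adjoint T * ((mat_adjoint U * U) * (T * mat_adjoint U)))"
    unfolding A_def using U(1) T c by (simp add: as)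
  also have "\<dots> = U * (mat_adjoint T * (T * mat_adjoint U))"
    using U T c by simp
  finally have "mat_trace (mat_adjoint A * A) = mat_trace (U * (mat_adjoint T * (T * mat_adjoint U)))" by simp
  also have "\<dots> = mat_trace ((mat_adjoint T * (T * mat_adjoint U)) * U)"
    using U T c by (intro mat_trace_mult_commute[of _ n n]) auto
  also have "(mat_adjoint T * (T * mat_adjoint U)) * U = mat_adjoint T * T"
    using U T c by (simp add: as)
  finally show ?thesis .
qed

abbreviation fmat :: "nat \<Rightarrow> (nat \<times> nat \<Rightarrow> complex) \<Rightarrow> complex mat" where
  "fmat n x \<equiv> Matrix.mat n n x"

lemma frob_square_fmat: "frob_square n (($$) (fmat n x)) = frob_square n x"
  by (simp add: frob_square_def)

lemma mat_delete_char_poly_matrix_border: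
  "mat_delete (char_poly_matrix (fmat (Suc n) (border n D w v a))) n n = char_poly_matrix (fmat n D)"
  by (rule eq_matI) (auto simp: mat_delete_def char_poly_matrix_def border_simps)

text \<open>In the expansion along the last row the corner occurs only in the last entry, whose
  cofactor is the characteristic polynomial of \<open>D\<close>; the other cofactors in this row do
  not see it.\<close>

lemma char_poly_border_affine:
  "char_poly (fmat (Suc n) (border n D w v a)) =
     char_poly (fmat (Suc n) (border n D w v 0)) - Polynomial.smult a (char_poly (fmat n D))"
proof -
  let ?X = "\<lambda>a. char_poly_matrix (fmat (Suc n) (border n D w v a))"
  have c: "?X a \<in> carrier_mat (Suc n) (Suc n)" for a by simp
  have cn: "cofactor (?X 0) n n = char_poly (fmat n D)"
    by (simp add: cofactor_def mat_delete_char_poly_matrix_border char_poly_def mult_2[symmetric])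
  have *: "char_poly (fmat (Suc n) (border n D w v a)) = (\<Sum>j<Suc n. ?X a $$ (n, j) * cofactor (?X 0) n j)" for a
  proof -
    have "char_poly (fmat (Suc n) (border n D w v a)) = (\<Sum>j<Suc n. ?X a $$ (n, j) * cofactor (?X a) n j)"
      unfolding char_poly_def by (rule laplace_expansion_row[OF c]) simp
    also have "\<dots> = (\<Sum>j<Suc n. ?X a $$ (n, j) * cofactor (?X 0) n j)"
    proof (rule sum.cong)
      fix j assume j: "j \<in> {..<Suc n}"
      have "mat_delete (?X a) n j = mat_delete (?X 0) n j"
        using j by (intro eq_matI) (auto simp: mat_delete_def char_poly_matrix_def border_def)
      thus "?X a $$ (n, j) * cofactor (?X a) n j = ?X a $$ (n, j) * cofactor (?X 0) n j"
        by (simp add: cofactor_def)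
    qed simp
    finally show ?thesis .
  qed
  have "(\<Sum>j<n. ?X a $$ (n, j) * cofactor (?X 0) n j) = (\<Sum>j<n. ?X 0 $$ (n, j) * cofactor (?X 0) n j)"
    by (intro sum.cong) (auto simp: char_poly_matrix_def border_def)
  moreover have "?X a $$ (n, n) = [:- a, 1:]" "?X 0 $$ (n, n) = [:0, 1:]"
    by (simp_all add: char_poly_matrix_def border_simps)
  moreover have "[:- a, 1:] * char_poly (fmat n D) = [:0, 1:] * char_poly (fmat n D) - Polynomial.smult a (char_poly (fmat n D))"
    by simp
  ultimately show ?thesis
    unfolding *[of a] *[of 0] sum.lessThan_Suc cn by simp
qed

lemma char_poly_border_zero:
  "char_poly (fmat (Suc n) (border n B w (\<lambda>_. 0) l)) = [:- l, 1:] * char_poly (fmat n B)"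
proof -
  let ?X = "char_poly_matrix (fmat (Suc n) (border n B w (\<lambda>_. 0) l))"
  have c: "?X \<in> carrier_mat (Suc n) (Suc n)" by simp
  have "char_poly (fmat (Suc n) (border n B w (\<lambda>_. 0) l)) = (\<Sum>i<Suc n. ?X $$ (i, n) * cofactor ?X i n)"
    unfolding char_poly_def by (rule laplace_expansion_column[OF c]) simp
  also have "(\<Sum>i<n. ?X $$ (i, n) * cofactor ?X i n) = 0"
    by (intro sum.neutral) (auto simp: char_poly_matrix_def border_simps)
  hence "(\<Sum>i<Suc n. ?X $$ (i, n) * cofactor ?X i n) = ?X $$ (n, n) * cofactor ?X n n" by simp
  also have "?X $$ (n, n) = [:- l, 1:]"
    by (simp add: char_poly_matrix_def border_simps)
  also have "cofactor ?X n n = char_poly (fmat n B)"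
    by (simp add: cofactor_def mat_delete_char_poly_matrix_border char_poly_def mult_2[symmetric])
  finally show ?thesis .
qed

section \<open>Unitary deflation of an eigenvector\<close>

text \<open>
  For a column \<open>u\<close> with \<open>b = scale_of n u\<close>, the contraction \<open>C\<close> is the inverse square root of
  \<open>1 + u u\<^sup>\<dagger>\<close> and the expansion is its inverse; \<open>C u = u / b\<close>.  The matrix with blocks \<open>C\<close>, \<open>u / b\<close>, \<open>- u\<^sup>\<dagger> / b\<close>, \<open>1 / b\<close> is unitary
  and its last column is the normalised vector \<open>(u, 1)\<close>.
\<close>

definition scale_of :: "nat \<Rightarrow> (nat \<Rightarrow> complex) \<Rightarrow> real" where
  "scale_of n u = sqrt (1 + (\<Sum>i<n. (norm (u i))\<^sup>2))"

lemma scale_of_pos: "scale_of n u > 0"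
  unfolding scale_of_def by (auto intro!: add_pos_nonneg sum_nonneg)

lemma scale_of_square: "(scale_of n u)\<^sup>2 = 1 + (\<Sum>i<n. (norm (u i))\<^sup>2)"
  unfolding scale_of_def by (auto intro!: add_nonneg_nonneg sum_nonneg)

lemma scale_of_complex_square:
  "(of_real (scale_of n u) :: complex) * of_real (scale_of n u) = 1 + (\<Sum>m<n. cnj (u m) * u m)"
proof -
  have "(of_real (scale_of n u) :: complex) * of_real (scale_of n u) = of_real ((scale_of n u)\<^sup>2)"
    by (simp only: power2_eq_square of_real_mult)
  also have "\<dots> = 1 + (\<Sum>m<n. of_real ((norm (u m))\<^sup>2))"
    by (simp only: scale_of_square of_real_add of_real_1 of_real_sum)
  also have "\<dots> = 1 + (\<Sum>m<n. cnj (u m) * u m)"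
    by (simp only: complex_norm_square mult.commute)
  finally show ?thesis .
qed

lemma scale_of_complex_nonzero:
  "(of_real (scale_of n u) :: complex) \<noteq> 0" "(of_real (scale_of n u) + 1 :: complex) \<noteq> 0"
proof -
  have "of_real (scale_of n u) + 1 = (of_real (scale_of n u + 1) :: complex)" by simp
  moreover have "scale_of n u + 1 \<noteq> 0" using scale_of_pos[of n u] by linarith
  ultimately show "(of_real (scale_of n u) + 1 :: complex) \<noteq> 0"
    by (simp only: of_real_eq_0_iff not_False_eq_True)
qed (use scale_of_pos[of n u] in auto)

definition contraction :: "nat \<Rightarrow> (nat \<Rightarrow> complex) \<Rightarrow> complex mat" where
  "contraction n u = Matrix.mat n n (\<lambda>(i, j). (if i = j then 1 else 0)
     - u i * cnj (u j) / of_real (scale_of n u * (scale_of n u + 1)))"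

definition expansion :: "nat \<Rightarrow> (nat \<Rightarrow> complex) \<Rightarrow> complex mat" where
  "expansion n u = Matrix.mat n n (\<lambda>(i, j). (if i = j then 1 else 0)
     + u i * cnj (u j) / of_real (scale_of n u + 1))"

text \<open>
  The substitution for the block \<open>D\<close> and the row \<open>w\<close> under which \<open>eigen_border\<close> below, the general
  matrix with eigenvector \<open>(u, 1)\<close> for the eigenvalue \<open>l\<close>, becomes unitarily conjugate to the block
  triangular matrix with diagonal blocks \<open>B\<close>, \<open>l\<close> and last row \<open>(w, l)\<close>.
\<close>

definition deflated_row where
  "deflated_row n u l B w = (\<lambda>j. (\<Sum>m<n. w m * contraction n u $$ (m, j)) / of_real (scale_of n u)
     + (l * cnj (u j) / of_real (scale_of n u) -
        (\<Sum>i<n. cnj (u i) * (\<Sum>m<n. B (i, m) * contraction n u $$ (m, j)))) / of_real (scale_of n u))"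

definition deflated_block where
  "deflated_block n u B w = (\<lambda>(i, j). (\<Sum>k<n. expansion n u $$ (i, k) * (\<Sum>m<n. B (k, m) * contraction n u $$ (m, j)))
     + u i * w j)"

text \<open>Column and corner are forced: they solve \<open>D u + v = l u\<close> and
  \<open>w u + a = l\<close>, the two blocks of the eigenvector equation.\<close>

definition eigen_border where
  "eigen_border n D w u l = border n D w (\<lambda>i. l * u i - (\<Sum>j<n. D (i, j) * u j)) (l - (\<Sum>j<n. w j * u j))"

text \<open>\<open>contraction\<close> and \<open>expansion\<close> are rank one perturbations of
  the identity; products with them from either side reduce to these two sums.\<close>

lemma sum_rank_one_update:
  fixes f :: "nat \<Rightarrow> complex"
  assumes "j < n"
  shows "(\<Sum>m<n. f m * ((if m = j then 1 else 0) + g m * c)) = f j + (\<Sum>m<n. f m * g m) * c"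
    "(\<Sum>m<n. ((if j = m then 1 else 0) + g m * c) * f m) = f j + (\<Sum>m<n. g m * f m) * c"
  using assms
  by (simp_all add: ring_distribs sum.distrib sum_distrib_right sum_distrib_left mult_ac if_distrib[of "\<lambda>x. x * _"]
      if_distrib[of "\<lambda>x. _ * x"] cong: if_cong)

lemma sum_mult_contraction:
  assumes "j < n"
  shows "(\<Sum>m<n. f m * contraction n u $$ (m, j)) =
    f j - (\<Sum>m<n. f m * u m) * cnj (u j) / of_real (scale_of n u * (scale_of n u + 1))"
  using sum_rank_one_update(1)[OF assms, of f u "- cnj (u j) / of_real (scale_of n u * (scale_of n u + 1))"] assms
  by (simp add: contraction_def cong: if_cong)

lemma sum_contraction_mult:
  assumes "i < n"
  shows "(\<Sum>m<n. contraction n u $$ (i, m) * f m) =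
    f i - u i * (\<Sum>m<n. cnj (u m) * f m) / of_real (scale_of n u * (scale_of n u + 1))"
  using sum_rank_one_update(2)[OF assms, of "\<lambda>m. cnj (u m)" "- u i / of_real (scale_of n u * (scale_of n u + 1))" f] assms
  by (simp add: contraction_def mult_ac cong: if_cong)

lemma sum_expansion_mult:
  assumes "i < n"
  shows "(\<Sum>m<n. expansion n u $$ (i, m) * f m) =
    f i + u i * (\<Sum>m<n. cnj (u m) * f m) / of_real (scale_of n u + 1)"
  using sum_rank_one_update(2)[OF assms, of "\<lambda>m. cnj (u m)" "u i / of_real (scale_of n u + 1)" f] assms
  by (simp add: expansion_def mult_ac cong: if_cong)

text \<open>On the orthogonal complement of \<open>u\<close> both matrices are the identity, and on
  \<open>u\<close> they multiply by \<open>b\<close> and \<open>1 / b\<close> with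
  \<open>b = scale_of n u\<close>, because |u|^2 = b^2 - 1. The entrywise computation verifies
  exactly this cancellation.\<close>

lemma expansion_contraction:
  "expansion n u * contraction n u = 1\<^sub>m n"
proof (rule eq_matI)
  fix i j assume "i < dim_row (1\<^sub>m n :: complex mat)" "j < dim_col (1\<^sub>m n :: complex mat)"
  hence ij: "i < n" "j < n" by auto
  define b where "b = (of_real (scale_of n u) :: complex)"
  have b: "b \<noteq> 0" "b + 1 \<noteq> 0" "b * b = 1 + (\<Sum>m<n. cnj (u m) * u m)"
    unfolding b_def by (rule scale_of_complex_nonzero scale_of_complex_square)+
  have "(expansion n u * contraction n u) $$ (i, j) = (\<Sum>m<n. expansion n u $$ (i, m) * contraction n u $$ (m, j))"
    using ij by (intro mult_mat_index_sum) (auto simp: expansion_def contraction_def)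
  also have "\<dots> = contraction n u $$ (i, j) + u i * (\<Sum>m<n. cnj (u m) * contraction n u $$ (m, j)) / (b + 1)"
    using sum_expansion_mult[OF ij(1)] by (simp add: b_def)
  also have "(\<Sum>m<n. cnj (u m) * contraction n u $$ (m, j)) = cnj (u j) - (b * b - 1) * cnj (u j) / (b * (b + 1))"
    using sum_mult_contraction[OF ij(2)] b(3) by (simp add: b_def)
  also have "contraction n u $$ (i, j) + u i * (cnj (u j) - (b * b - 1) * cnj (u j) / (b * (b + 1))) / (b + 1)
    = (if i = j then 1 else 0)"
  proof -
    have "u i * (cnj (u j) - (b * b - 1) * cnj (u j) / (b * (b + 1))) / (b + 1) = u i * cnj (u j) / (b * (b + 1))"
      using b(1,2) by (simp add: divide_simps) (simp add: algebra_simps)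
    thus ?thesis using ij by (simp add: contraction_def b_def)
  qed
  finally show "(expansion n u * contraction n u) $$ (i, j) = 1\<^sub>m n $$ (i, j)" using ij by simp
qed (auto simp: expansion_def contraction_def)


text \<open>The matrix determinant lemma. Unipotent block factors \<open>?L\<close> and
  \<open>?N\<close> move the rank one term from the \<open>n\<close> by \<open>n\<close> block into
  the 1 by 1 block, without changing the determinant.\<close>

lemma det_one_plus_rank_one:
  fixes p V :: "'a::field mat"
  assumes p: "p \<in> carrier_mat n 1" and V: "V \<in> carrier_mat 1 n"
  shows "Determinant.det (1\<^sub>m n + p * V) = 1 + (V * p) $$ (0, 0)"
proof -
  let ?L = "four_block_mat (1\<^sub>m n) (0\<^sub>m n 1) V (1\<^sub>m 1)"
  let ?M = "four_block_mat (1\<^sub>m n + p * V) p (0\<^sub>m 1 n) (1\<^sub>m 1)"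
  let ?N = "four_block_mat (1\<^sub>m n) (0\<^sub>m n 1) (- V) (1\<^sub>m 1)"
  have pV: "p * V \<in> carrier_mat n n" "V * p \<in> carrier_mat 1 1" using p V by auto
  have "?L * ?M = four_block_mat (1\<^sub>m n + p * V) p (V + V * (p * V)) (V * p + 1\<^sub>m 1)"
    by (subst mult_four_block_mat[where ?n1.0=n and ?n2.0=1]) (use p V pV in \<open>auto simp: mult_add_distrib_mat[of _ 1 n _ n] right_add_zero_mat\<close>)
  hence "?L * ?M * ?N = four_block_mat (1\<^sub>m n + p * V + p * (- V)) p
      (V + V * (p * V) + (V * p + 1\<^sub>m 1) * (- V)) (V * p + 1\<^sub>m 1)"
    using p V pV by (simp add: mult_four_block_mat[where ?n1.0=n and ?n2.0=1 and ?nr1.0=n and ?nr2.0=1 and ?nc1.0=n and ?nc2.0=1])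
  also have "1\<^sub>m n + p * V + p * (- V) = 1\<^sub>m n"
    using p V pV by (intro eq_matI) auto
  also have "V + V * (p * V) + (V * p + 1\<^sub>m 1) * (- V) = 0\<^sub>m 1 n"
  proof -
    have "(V * p + 1\<^sub>m 1) * (- V) = - ((V * p) * V + V)"
      using p V pV by (subst uminus_mult_right_mat) (auto simp: add_mult_distrib_mat[of _ 1 1 _ _ n])
    moreover have "V * (p * V) = (V * p) * V" using p V by (simp add: assoc_mult_mat[of _ 1 n _ 1 _ n])
    moreover have "V + X + - (X + V) = 0\<^sub>m 1 n" if "X \<in> carrier_mat 1 n" for X
      using V that by (intro eq_matI) auto
    ultimately show ?thesis using V pV by simp
  qed
  finally have eq: "?L * ?M * ?N = four_block_mat (1\<^sub>m n) p (0\<^sub>m 1 n) (V * p + 1\<^sub>m 1)" .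
  have c: "?L \<in> carrier_mat (n + 1) (n + 1)" "?M \<in> carrier_mat (n + 1) (n + 1)" "?N \<in> carrier_mat (n + 1) (n + 1)"
    using p V pV by auto
  have "Determinant.det (?L * ?M * ?N) = Determinant.det ?L * Determinant.det ?M * Determinant.det ?N"
    using c by (simp add: det_mult[of _ "n + 1"])
  also have "Determinant.det ?L = 1"
    using V by (subst det_four_block_mat_upper_right_zero[of _ n _ 1]) auto
  also have "Determinant.det ?N = 1"
    using V by (subst det_four_block_mat_upper_right_zero[of _ n _ 1]) auto
  also have "Determinant.det ?M = Determinant.det (1\<^sub>m n + p * V)"
    using p pV by (subst det_four_block_mat_lower_left_zero[of _ n _ 1]) auto
  also have "Determinant.det (?L * ?M * ?N) = Determinant.det (V * p + 1\<^sub>m 1)"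
    unfolding eq using p pV by (subst det_four_block_mat_lower_left_zero[of _ n _ 1]) auto
  also have "Determinant.det (V * p + 1\<^sub>m 1) = (V * p + 1\<^sub>m 1) $$ (0, 0)"
    using pV(2) by (intro det_single) auto
  also have "\<dots> = 1 + (V * p) $$ (0, 0)" using pV(2) by auto
  finally show ?thesis by simp
qed

lemma det_contraction:
  "Determinant.det (contraction n u) = 1 / of_real (scale_of n u)"
proof -
  define b where "b = (of_real (scale_of n u) :: complex)"
  have b: "b \<noteq> 0" "b + 1 \<noteq> 0" "b * b = 1 + (\<Sum>m<n. cnj (u m) * u m)"
    unfolding b_def by (rule scale_of_complex_nonzero scale_of_complex_square)+
  define p where "p = Matrix.mat n 1 (\<lambda>(i, j). - u i / (b * (b + 1)))"
  define V where "V = Matrix.mat 1 n (\<lambda>(i, j). cnj (u j))"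
  have eq: "contraction n u = 1\<^sub>m n + p * V"
    by (rule eq_matI) (auto simp: contraction_def p_def V_def b_def scalar_prod_def)
  have "(V * p) $$ (0, 0) = - (\<Sum>m<n. cnj (u m) * u m) / (b * (b + 1))"
    by (simp add: V_def p_def scalar_prod_def atLeast0LessThan sum_negf sum_divide_distrib)
  hence "1 + (V * p) $$ (0, 0) = 1 - (b * b - 1) / (b * (b + 1))" using b(3) by simp
  also have "\<dots> = 1 / b" using b(1,2) by (simp add: divide_simps) (simp add: algebra_simps)
  finally show ?thesis
    using det_one_plus_rank_one[of p n V] by (simp add: eq p_def V_def b_def)
qed

lemma det_expansion: "Determinant.det (expansion n u) = of_real (scale_of n u)"
proof -
  have "Determinant.det (expansion n u) * Determinant.det (contraction n u) = 1"
    using expansion_contraction[of n u] det_mult[of "expansion n u" n "contraction n u"]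
    by (simp add: expansion_def contraction_def)
  thus ?thesis using scale_of_complex_nonzero(1)[of n u] by (simp add: det_contraction field_simps)
qed

text \<open>Everything follows from \<open>A * U = U * T\<close>, where \<open>U\<close> is unitary
  with the normalised \<open>(u, 1)\<close> as last column and \<open>T\<close> has zeros above its
  corner \<open>l\<close>. Similarity then gives the characteristic polynomial, and unitary
  invariance of the trace of \<open>A\<^sup>\<dagger> A\<close> gives the Frobenius norm, so neither
  result depends on \<open>u\<close>.\<close>

lemma deflation:
  fixes u w :: "nat \<Rightarrow> complex" and B :: "nat \<times> nat \<Rightarrow> complex" and l :: complex and n :: nat
  defines "W \<equiv> deflated_row n u l B w"
  defines "A \<equiv> eigen_border n (deflated_block n u B W) W u l"
  shows "char_poly (fmat (Suc n) A) = [:- l, 1:] * char_poly (fmat n B)"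
    and "frob_square (Suc n) A = frob_square n B + (\<Sum>i<n. (norm (w i))\<^sup>2) + (norm l)\<^sup>2"
proof -
  define b where "b = (of_real (scale_of n u) :: complex)"
  have b: "b \<noteq> 0" "b + 1 \<noteq> 0" "(\<Sum>m<n. cnj (u m) * u m) = b * b - 1"
    unfolding b_def using scale_of_complex_nonzero scale_of_complex_square[of n u] by simp_all
  have s': "(\<Sum>m<n. u m * cnj (u m)) = b * b - 1" using b(3) by (simp add: mult.commute)
  have cb: "cnj b = b" by (simp add: b_def)
  let ?C = "contraction n u"
  have fC: "(\<Sum>m<n. f m * ?C $$ (m, j)) = f j - (\<Sum>m<n. f m * u m) * cnj (u j) / (b * (b + 1))" if "j < n" for f j
    using sum_mult_contraction[OF that] by (simp add: b_def)
  have Cf: "(\<Sum>m<n. ?C $$ (i, m) * f m) = f i - u i * (\<Sum>m<n. cnj (u m) * f m) / (b * (b + 1))" if "i < n" for f i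
    using sum_contraction_mult[OF that] by (simp add: b_def)
  \<comment> \<open>This is \<open>C u = u / b\<close> in scalar form, with |u|^2 written as
    \<open>b * b - 1\<close>.\<close>
  have red: "x - x * (b * b - 1) / (b * (b + 1)) = x / b" for x
    using b(1,2) by (simp add: divide_simps) (simp add: algebra_simps)
  \<comment> \<open>Names for all sums that occur, in matrix notation: \<open>Y = B C\<close>,
    \<open>\<gamma> = B u\<close>, \<open>\<beta> = u\<^sup>\<dagger> B\<close>,
    \<open>\<delta> = u\<^sup>\<dagger> B u\<close>, \<open>\<omega> = w u\<close> and
    \<open>y = u\<^sup>\<dagger> Y\<close>. In these terms the entries of
    \<open>A * U = U * T\<close> become rational identities in \<open>b\<close>.\<close>
  define Y where "Y i j = (\<Sum>m<n. B (i, m) * ?C $$ (m, j))" for i j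
  define \<gamma> where "\<gamma> i = (\<Sum>m<n. B (i, m) * u m)" for i
  define \<beta> where "\<beta> j = (\<Sum>i<n. cnj (u i) * B (i, j))" for j
  define \<delta> where "\<delta> = (\<Sum>i<n. cnj (u i) * \<gamma> i)"
  define \<omega> where "\<omega> = (\<Sum>m<n. w m * u m)"
  define y where "y j = (\<Sum>i<n. cnj (u i) * Y i j)" for j
  have Y: "Y i j = B (i, j) - \<gamma> i * cnj (u j) / (b * (b + 1))" if "j < n" for i j
    unfolding Y_def \<gamma>_def using that by (rule fC)
  have y: "y j = \<beta> j - \<delta> * cnj (u j) / (b * (b + 1))" if "j < n" for j
  proof -
    have "y j = (\<Sum>i<n. cnj (u i) * B (i, j) - cnj (u i) * \<gamma> i * (cnj (u j) / (b * (b + 1))))"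
      unfolding y_def using that by (intro sum.cong) (auto simp: Y algebra_simps)
    thus ?thesis by (simp add: sum_subtractf sum_distrib_right sum_divide_distrib \<beta>_def \<delta>_def)
  qed
  have \<beta>u: "(\<Sum>j<n. \<beta> j * u j) = \<delta>"
    unfolding \<beta>_def \<delta>_def \<gamma>_def sum_distrib_left sum_distrib_right
    by (subst sum.swap) (simp add: mult_ac)
  \<comment> \<open>The bracket is entry \<open>j\<close> of the row \<open>f C\<close>, so this is
    \<open>f C u = f u / b\<close>.\<close>
  have collapse: "(\<Sum>j<n. (f j - x * cnj (u j) / (b * (b + 1))) * u j) = x / b" if "(\<Sum>j<n. f j * u j) = x" for f x
  proof -
    have "(\<Sum>j<n. (f j - x * cnj (u j) / (b * (b + 1))) * u j)
       = (\<Sum>j<n. f j * u j) - x / (b * (b + 1)) * (\<Sum>j<n. cnj (u j) * u j)"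
      by (simp add: sum_distrib_left sum_subtractf[symmetric] algebra_simps)
    thus ?thesis using red[of x] that b(3) by simp
  qed
  have collapse': "(\<Sum>j<n. g j * u j) = x / b" if "(\<Sum>j<n. f j * u j) = x"
      "\<And>j. j < n \<Longrightarrow> g j = f j - x * cnj (u j) / (b * (b + 1))" for f g x
    unfolding collapse[OF that(1), symmetric] using that(2) by (intro sum.cong) auto
  have yu: "(\<Sum>j<n. y j * u j) = \<delta> / b"
    by (rule collapse'[OF \<beta>u y])
  have Yu: "(\<Sum>j<n. Y i j * u j) = \<gamma> i / b" for i
    by (rule collapse'[OF \<gamma>_def[symmetric] Y])
  have W: "W j = (w j - \<omega> * cnj (u j) / (b * (b + 1))) / b + (l * cnj (u j) / b - y j) / b" if "j < n" for j
    unfolding W_def deflated_row_def y_def Y_def b_def[symmetric] fC[OF that] \<omega>_def ..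
  define wu where "wu = (\<Sum>j<n. W j * u j)"
  have wu: "wu = (\<omega> / b + l * (b * b - 1) / b - \<delta> / b) / b"
  proof -
    have "wu = (\<Sum>j<n. (w j - \<omega> * cnj (u j) / (b * (b + 1))) * u j / b + (l * (cnj (u j) * u j) / b - y j * u j) / b)"
      unfolding wu_def by (intro sum.cong) (auto simp: W algebra_simps)
    also have "\<dots> = (\<Sum>j<n. (w j - \<omega> * cnj (u j) / (b * (b + 1))) * u j) / b
      + (l * (\<Sum>j<n. cnj (u j) * u j) / b - (\<Sum>j<n. y j * u j)) / b"
      by (simp add: sum.distrib sum_subtractf sum_divide_distrib sum_distrib_left diff_divide_distrib)
    finally show ?thesis using collapse[of w \<omega>] \<omega>_def yu b(3) by (simp add: diff_divide_distrib add_divide_distrib)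
  qed
  define D where "D = deflated_block n u B W"
  have D: "D (i, j) = Y i j + u i * y j / (b + 1) + u i * W j" if "i < n" for i j
    unfolding D_def deflated_block_def prod.case Y_def[symmetric] sum_expansion_mult[OF that] y_def b_def by simp
  define Du where "Du i = (\<Sum>j<n. D (i, j) * u j)" for i
  have Du: "Du i = \<gamma> i / b + u i * (\<delta> / b) / (b + 1) + u i * wu" if "i < n" for i
  proof -
    have "Du i = (\<Sum>j<n. Y i j * u j + u i / (b + 1) * (y j * u j) + u i * (W j * u j))"
      unfolding Du_def by (intro sum.cong) (auto simp: D[OF that] algebra_simps)
    also have "\<dots> = (\<Sum>j<n. Y i j * u j) + u i / (b + 1) * (\<Sum>j<n. y j * u j) + u i * wu"
      by (simp only: sum.distrib sum_distrib_left wu_def)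
    finally show ?thesis by (simp add: Yu yu)
  qed
  have A: "A = border n D W (\<lambda>i. l * u i - Du i) (l - wu)"
    unfolding A_def eigen_border_def D_def Du_def wu_def ..
  define T where "T = border n B w (\<lambda>_. 0) l"
  define U where "U = fmat (Suc n) (border n (($$) ?C) (\<lambda>j. - cnj (u j) / b) (\<lambda>i. u i / b) (1 / b))"
  have Uc: "U \<in> carrier_mat (Suc n) (Suc n)" by (simp add: U_def)
  have Ui1: "U $$ (i, j) = ?C $$ (i, j)" if "i < n" "j < n" for i j using that by (auto simp: U_def border_simps)
  have Ui2: "U $$ (n, j) = - cnj (u j) / b" if "j < n" for j using that by (auto simp: U_def border_simps)
  have Ui3: "U $$ (i, n) = u i / b" if "i < n" for i using that by (auto simp: U_def border_simps)
  note Ui = Ui1 Ui2 Ui3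
  have Unn: "U $$ (n, n) = 1 / b" by (simp add: U_def border_simps)
  have Cu: "(\<Sum>m<n. ?C $$ (i, m) * u m) = u i / b" if "i < n" for i
    using Cf[OF that, of u] b(3) red[of "u i"] by simp
  have uC: "(\<Sum>m<n. cnj (u m) * ?C $$ (m, j)) = cnj (u j) / b" if "j < n" for j
    using fC[OF that, of "\<lambda>m. cnj (u m)"] b(3) red[of "cnj (u j)"] by (simp add: mult.commute)
  have Uad: "mat_adjoint U $$ (i, j) = cnj (U $$ (j, i))" if "i < Suc n" "j < Suc n" for i j
    using mat_adjoint_index[OF Uc] that by simp
  have hermC: "cnj (?C $$ (i, j)) = ?C $$ (j, i)" if "i < n" "j < n" for i j
    using that by (auto simp: contraction_def mult.commute)
  note Uac = mat_adjoint_carrier[OF Uc]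
  \<comment> \<open>The contraction is hermitian and maps \<open>u\<close> to \<open>u / b\<close>.
    The off-diagonal blocks therefore cancel, and the diagonal ones give the identity by |u|^2 = b^2
    - 1.\<close>
  have UU: "U * mat_adjoint U = 1\<^sub>m (Suc n)"
  proof (rule eq_matI)
    fix i j assume "i < dim_row (1\<^sub>m (Suc n) :: complex mat)" "j < dim_col (1\<^sub>m (Suc n) :: complex mat)"
    hence ij: "i < Suc n" "j < Suc n" by auto
    have "(U * mat_adjoint U) $$ (i, j) = (\<Sum>m<n. U $$ (i, m) * cnj (U $$ (j, m))) + U $$ (i, n) * cnj (U $$ (j, n))"
      using ij by (simp add: mult_mat_index_sum[OF Uc Uac] Uad del: index_mult_mat)
    also have "\<dots> = (if i = j then 1 else 0)"
    proof -
      consider "i < n" "j < n" | "i < n" "j = n" | "i = n" "j < n" | "i = n" "j = n" using ij by linarith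
      thus ?thesis
      proof cases
        case 1
        hence "(\<Sum>m<n. U $$ (i, m) * cnj (U $$ (j, m))) = (\<Sum>m<n. ?C $$ (i, m) * ?C $$ (m, j))"
          by (intro sum.cong) (auto simp: Ui hermC)
        also have "\<dots> = ?C $$ (i, j) - u i / b * cnj (u j) / (b * (b + 1))"
          using 1 by (simp add: fC Cu)
        also have "?C $$ (i, j) = (if i = j then 1 else 0) - u i * cnj (u j) / (b * (b + 1))"
          using 1 by (simp add: contraction_def b_def)
        finally show ?thesis using 1 b(1,2) by (simp add: Ui cb) (simp add: divide_simps; simp add: algebra_simps)
      next
        case 2
        hence "(\<Sum>m<n. U $$ (i, m) * cnj (U $$ (j, m))) = - (\<Sum>m<n. ?C $$ (i, m) * u m) / b"
          by (simp add: Ui cb sum_negf sum_divide_distrib cong: sum.cong_simp)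
        thus ?thesis using 2 by (simp add: Ui Unn Cu cb)
      next
        case 3
        hence "(\<Sum>m<n. U $$ (i, m) * cnj (U $$ (j, m))) = - (\<Sum>m<n. cnj (u m) * ?C $$ (m, j)) / b"
          by (simp add: Ui cb hermC sum_negf sum_divide_distrib cong: sum.cong_simp)
        thus ?thesis using 3 by (simp add: Ui Unn uC cb)
      next
        case 4
        hence "(\<Sum>m<n. U $$ (i, m) * cnj (U $$ (j, m))) = (\<Sum>m<n. cnj (u m) * u m) / (b * b)"
          by (simp add: Ui cb sum_divide_distrib cong: sum.cong_simp)
        thus ?thesis using 4 b by (simp add: Unn cb add_divide_distrib[symmetric])
      qed
    qed
    finally show "(U * mat_adjoint U) $$ (i, j) = 1\<^sub>m (Suc n) $$ (i, j)" using ij by simp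
  qed (use Uc Uac in auto)
  have UU': "mat_adjoint U * U = 1\<^sub>m (Suc n)"
    using mat_mult_left_right_inverse[OF Uc Uac UU] .
  have Ac: "fmat (Suc n) A \<in> carrier_mat (Suc n) (Suc n)" and Tc: "fmat (Suc n) T \<in> carrier_mat (Suc n) (Suc n)" by auto
  \<comment> \<open>For \<open>j = n\<close> this says that the normalised \<open>(u, 1)\<close> is
    an eigenvector. The blocks with \<open>j < n\<close> are the equations from which the formulas
    for \<open>deflated_row\<close> and \<open>deflated_block\<close> arise.\<close>
  have AU: "fmat (Suc n) A * U = U * fmat (Suc n) T"
  proof (rule eq_matI)
    fix i j assume "i < dim_row (U * fmat (Suc n) T)" "j < dim_col (U * fmat (Suc n) T)"
    hence ij: "i < Suc n" "j < Suc n" using Uc by auto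
    have L: "(fmat (Suc n) A * U) $$ (i, j) = (\<Sum>m<n. A (i, m) * U $$ (m, j)) + A (i, n) * U $$ (n, j)"
      using ij by (simp add: mult_mat_index_sum[OF Ac Uc] del: index_mult_mat)
    have R: "(U * fmat (Suc n) T) $$ (i, j) = (\<Sum>m<n. U $$ (i, m) * T (m, j)) + U $$ (i, n) * T (n, j)"
      using ij by (simp add: mult_mat_index_sum[OF Uc Tc] del: index_mult_mat)
    consider "i < n" "j < n" | "i < n" "j = n" | "i = n" "j < n" | "i = n" "j = n" using ij by linarith
    hence "(\<Sum>m<n. A (i, m) * U $$ (m, j)) + A (i, n) * U $$ (n, j) = (\<Sum>m<n. U $$ (i, m) * T (m, j)) + U $$ (i, n) * T (n, j)"
    proof cases
      case 1
      have "(\<Sum>m<n. A (i, m) * U $$ (m, j)) = (\<Sum>m<n. D (i, m) * ?C $$ (m, j))"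
        using 1 by (intro sum.cong) (auto simp: A border_simps Ui)
      also have "\<dots> = D (i, j) - Du i * cnj (u j) / (b * (b + 1))"
        using 1 by (simp add: fC Du_def)
      finally have l: "(\<Sum>m<n. A (i, m) * U $$ (m, j)) = D (i, j) - Du i * cnj (u j) / (b * (b + 1))" .
      have "(\<Sum>m<n. U $$ (i, m) * T (m, j)) = (\<Sum>m<n. ?C $$ (i, m) * B (m, j))"
        using 1 by (intro sum.cong) (auto simp: T_def border_simps Ui)
      also have "\<dots> = B (i, j) - u i * \<beta> j / (b * (b + 1))"
        using 1 by (simp add: Cf \<beta>_def)
      finally have r: "(\<Sum>m<n. U $$ (i, m) * T (m, j)) = B (i, j) - u i * \<beta> j / (b * (b + 1))" .
      have "D (i, j) - Du i * cnj (u j) / (b * (b + 1)) + (l * u i - Du i) * (- cnj (u j) / b)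
          = B (i, j) - u i * \<beta> j / (b * (b + 1)) + u i / b * w j"
        unfolding D[OF 1(1)] Y[OF 1(2)] Du[OF 1(1)] W[OF 1(2)] wu y[OF 1(2)] using b(1,2)
        by (simp add: divide_simps) (simp add: algebra_simps)
      thus ?thesis unfolding l r using 1 by (simp add: A T_def border_simps Ui)
    next
      case 2
      have l: "(\<Sum>m<n. A (i, m) * U $$ (m, j)) = Du i / b"
        using 2 by (simp add: A border_simps Ui Du_def sum_divide_distrib cong: sum.cong_simp)
      have r: "(\<Sum>m<n. U $$ (i, m) * T (m, j)) = 0"
        using 2 by (intro sum.neutral) (auto simp: T_def border_simps)
      show ?thesis unfolding l r using 2 by (simp add: A T_def border_simps Ui Unn diff_divide_distrib)
    next
      case 3
      have "(\<Sum>m<n. A (i, m) * U $$ (m, j)) = (\<Sum>m<n. W m * ?C $$ (m, j))"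
        using 3 by (intro sum.cong) (auto simp: A border_simps Ui)
      also have "\<dots> = W j - wu * cnj (u j) / (b * (b + 1))"
        using 3 by (simp add: fC wu_def)
      finally have l': "(\<Sum>m<n. A (i, m) * U $$ (m, j)) = W j - wu * cnj (u j) / (b * (b + 1))" .
      have r: "(\<Sum>m<n. U $$ (i, m) * T (m, j)) = - \<beta> j / b"
        using 3 by (simp add: T_def border_simps Ui \<beta>_def sum_negf sum_divide_distrib cong: sum.cong_simp)
      have "W j - wu * cnj (u j) / (b * (b + 1)) + (l - wu) * (- cnj (u j) / b) = - \<beta> j / b + w j / b"
        unfolding W[OF 3(2)] wu y[OF 3(2)] using b(1,2)
        by (simp add: divide_simps) (simp add: algebra_simps)
      thus ?thesis unfolding l' r using 3 by (simp add: A T_def border_simps Ui Unn)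
    next
      case 4
      have l: "(\<Sum>m<n. A (i, m) * U $$ (m, j)) = wu / b"
        using 4 by (simp add: A border_simps Ui wu_def sum_divide_distrib cong: sum.cong_simp)
      have r: "(\<Sum>m<n. U $$ (i, m) * T (m, j)) = 0"
        using 4 by (intro sum.neutral) (auto simp: T_def border_simps)
      show ?thesis unfolding l r using 4 by (simp add: A T_def border_simps Unn diff_divide_distrib)
    qed
    thus "(fmat (Suc n) A * U) $$ (i, j) = (U * fmat (Suc n) T) $$ (i, j)" using L R by simp
  qed (use Uc in auto)
  have A': "fmat (Suc n) A = U * fmat (Suc n) T * mat_adjoint U"
  proof -
    have "fmat (Suc n) A = fmat (Suc n) A * (U * mat_adjoint U)" unfolding UU using Ac by simp
    also have "\<dots> = fmat (Suc n) A * U * mat_adjoint U"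
      using Ac Uc Uac by (simp only: assoc_mult_mat)
    finally show ?thesis unfolding AU .
  qed
  have "similar_mat (fmat (Suc n) A) (fmat (Suc n) T)"
    unfolding similar_mat_def similar_mat_wit_def Let_def
    using Ac Tc Uc Uac UU UU' A' by (intro exI[of _ U] exI[of _ "mat_adjoint U"]) auto
  from char_poly_similar[OF this] show "char_poly (fmat (Suc n) A) = [:- l, 1:] * char_poly (fmat n B)"
    unfolding T_def char_poly_border_zero .
  have "of_real (frob_square (Suc n) A) = mat_trace (mat_adjoint (fmat (Suc n) A) * fmat (Suc n) A)"
    by (simp add: mat_trace_adjoint_mult[OF Ac] frob_square_fmat)
  also have "\<dots> = mat_trace (mat_adjoint (fmat (Suc n) T) * fmat (Suc n) T)"
    unfolding A' by (rule mat_trace_unitary_conj[OF Uc UU' Tc])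
  also have "\<dots> = of_real (frob_square (Suc n) T)"
    by (simp add: mat_trace_adjoint_mult[OF Tc] frob_square_fmat)
  finally have "frob_square (Suc n) A = frob_square (Suc n) T" by (simp only: of_real_eq_iff)
  also have "\<dots> = frob_square n B + (\<Sum>i<n. (norm (w i))\<^sup>2) + (norm l)\<^sup>2"
    by (simp add: frob_square_def T_def border_simps cong: sum.cong_simp)
  finally show "frob_square (Suc n) A = frob_square n B + (\<Sum>i<n. (norm (w i))\<^sup>2) + (norm l)\<^sup>2" .
qed

section \<open>Integrals over matrices\<close>

text \<open>The sigma-algebra generated by evaluation at points. It is coarse enough that
  \<open>char_poly\<close> is measurable, its values being determinants, and fine enough to contain
  the events about the location of roots.\<close>

definition poly_space :: "complex poly measure" where
  "poly_space = vimage_algebra UNIV poly (PiM UNIV (\<lambda>_. borel))"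

lemma space_poly_space[simp]: "space poly_space = UNIV"
  by (simp add: poly_space_def)

lemma measurable_poly_spaceI:
  assumes "\<And>z. (\<lambda>x. poly (f x) z) \<in> borel_measurable M"
  shows "f \<in> M \<rightarrow>\<^sub>M poly_space"
  unfolding poly_space_def
proof (rule measurable_vimage_algebra2)
  show "(\<lambda>x. poly (f x)) \<in> M \<rightarrow>\<^sub>M PiM UNIV (\<lambda>_. borel)"
    using assms by (intro measurable_PiM_single') auto
qed auto

lemma poly_space_eval[measurable]: "(\<lambda>p. poly p z) \<in> borel_measurable poly_space"
proof -
  have "poly \<in> poly_space \<rightarrow>\<^sub>M PiM UNIV (\<lambda>_. borel)"
    unfolding poly_space_def by (rule measurable_vimage_algebra1) (auto simp: space_PiM)
  from measurable_compose[OF this measurable_component_singleton[of z]] show ?thesis by simp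
qed

lemma measurable_det:
  fixes f :: "'a \<Rightarrow> nat \<times> nat \<Rightarrow> complex"
  assumes "\<And>i j. i < n \<Longrightarrow> j < n \<Longrightarrow> (\<lambda>x. f x (i, j)) \<in> borel_measurable M"
  shows "(\<lambda>x. Determinant.det (fmat n (f x))) \<in> borel_measurable M"
proof -
  have "(\<lambda>x. \<Sum>p | p permutes {0..<n}. signof p * (\<Prod>i = 0..<n. f x (i, p i))) \<in> borel_measurable M"
  proof (intro borel_measurable_sum borel_measurable_times borel_measurable_prod borel_measurable_const)
    fix p i assume "p \<in> {p. p permutes {0..<n}}" "i \<in> {0..<n}"
    hence "i < n" "p i < n" using permutes_in_image[of p "{0..<n}" i] by auto
    thus "(\<lambda>x. f x (i, p i)) \<in> borel_measurable M" by (rule assms)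
  qed
  also have "(\<lambda>x. \<Sum>p | p permutes {0..<n}. signof p * (\<Prod>i = 0..<n. f x (i, p i)))
     = (\<lambda>x. Determinant.det (fmat n (f x)))"
    unfolding Determinant.det_def
    by (auto intro!: ext sum.cong prod.cong simp: permutes_in_image)
  finally show ?thesis .
qed

lemma poly_char_poly_fmat:
  "poly (char_poly (fmat n x)) z = Determinant.det (fmat n (\<lambda>(i, j). (if i = j then z else 0) - x (i, j)))"
proof -
  have "- (char_matrix (fmat n x) z) = fmat n (\<lambda>(i, j). (if i = j then z else 0) - x (i, j))"
    by (rule eq_matI) (auto simp: char_matrix_def)
  thus ?thesis by (subst char_poly_matrix[of _ n]) auto
qed

lemma measurable_poly_char_poly:
  assumes "\<And>i j. i < n \<Longrightarrow> j < n \<Longrightarrow> (\<lambda>x. f x (i, j)) \<in> borel_measurable M"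
    and [measurable]: "g \<in> borel_measurable M"
  shows "(\<lambda>x. poly (char_poly (fmat n (f x))) (g x)) \<in> borel_measurable M"
proof -
  note assms(1)[measurable]
  show ?thesis unfolding poly_char_poly_fmat
    by (rule measurable_det) auto
qed

lemma measurable_char_poly:
  assumes "\<And>i j. i < n \<Longrightarrow> j < n \<Longrightarrow> (\<lambda>x. f x (i, j)) \<in> borel_measurable M"
  shows "(\<lambda>x. char_poly (fmat n (f x))) \<in> M \<rightarrow>\<^sub>M poly_space"
  using assms by (intro measurable_poly_spaceI measurable_poly_char_poly) auto

text \<open>The derivative of a characteristic polynomial is the sum of the characteristic
  polynomials of the matrices with one row and the same column deleted, so measurability again
  reduces to determinants.\<close>

lemma measurable_poly_pderiv_char_poly:
  assumes "\<And>i j. i < n \<Longrightarrow> j < n \<Longrightarrow> (\<lambda>x. f x (i, j)) \<in> borel_measurable M"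
    and "g \<in> borel_measurable M"
  shows "(\<lambda>x. poly (pderiv (char_poly (fmat n (f x)))) (g x)) \<in> borel_measurable M"
proof -
  have "mat_delete (fmat n y) k k = fmat (n - 1) (\<lambda>(i, j). y (if i < k then i else Suc i, if j < k then j else Suc j))"
    if "k < n" for k y
    using that by (intro eq_matI) (auto simp: mat_delete_def)
  hence "poly (pderiv (char_poly (fmat n (f x)))) (g x) =
     (\<Sum>k<n. poly (char_poly (fmat (n - 1) (\<lambda>(i, j). f x (if i < k then i else Suc i, if j < k then j else Suc j)))) (g x))" for x
    by (subst pderiv_char_poly[of _ n]) (auto simp: poly_sum intro!: sum.cong)
  thus ?thesis
    using assms by (auto intro!: borel_measurable_sum measurable_poly_char_poly)
qed

lemma measurable_lborel_PiM_component:
  "i \<in> I \<Longrightarrow> f \<in> M \<rightarrow>\<^sub>M lborel_PiM I \<Longrightarrow> (\<lambda>x. f x i) \<in> borel_measurable M"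
  using measurable_compose[OF _ measurable_component_singleton[of i I "\<lambda>_. lborel"]] by simp

lemma measurable_lborel_PiM_coord: "i \<in> I \<Longrightarrow> (\<lambda>x. x i) \<in> borel_measurable (lborel_PiM I)"
  by (rule measurable_lborel_PiM_component[OF _ measurable_ident, simplified])

text \<open>
  As a function of its corner entry \<open>a\<close> alone, a bordered matrix has \<open>l\<close> as an eigenvalue exactly for
  \<open>a = g l\<close>, with \<open>g\<close> a quotient of characteristic polynomials; its fibres have at most \<open>n + 1\<close> points.
\<close>

lemma nn_integral_eigenvalue_subst:
  fixes D :: "nat \<times> nat \<Rightarrow> complex" and w v :: "nat \<Rightarrow> complex"
    and \<psi> :: "complex \<Rightarrow> ennreal" and n :: nat
  defines "q \<equiv> char_poly (fmat n D)"
    and "A \<equiv> \<lambda>a. border n D w v a"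
  defines "g \<equiv> \<lambda>l. poly (char_poly (fmat (Suc n) (A 0))) l / poly q l"
  assumes \<psi>: "\<psi> \<in> borel_measurable borel"
  shows "(\<integral>\<^sup>+l. indicator {l. poly q l \<noteq> 0} l *
      ((norm (poly (pderiv (char_poly (fmat (Suc n) (A (g l))))) l))\<^sup>2 / (norm (poly q l))\<^sup>2) * \<psi> (g l) \<partial>lborel)
    \<le> of_nat (Suc n) * (\<integral>\<^sup>+a. \<psi> a \<partial>lborel)"
proof -
  define p where "p = char_poly (fmat (Suc n) (A 0))"
  define W where "W = {l. poly q l \<noteq> 0}"
  define g' where "g' l = (poly (pderiv p) l * poly q l - poly p l * poly (pderiv q) l) / (poly q l * poly q l)" for l
  have chi: "char_poly (fmat (Suc n) (A a)) = p - Polynomial.smult a q" for a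
    unfolding A_def p_def q_def by (rule char_poly_border_affine)
  have g: "g l = poly p l / poly q l" for l by (simp add: g_def p_def)
  have meas: "(\<lambda>l. poly r l) \<in> borel_measurable borel" for r :: "complex poly"
    by (intro borel_measurable_continuous_onI continuous_intros)
  have opW: "open W" unfolding W_def
    by (intro open_Collect_neq continuous_intros)
  have der: "(g has_field_derivative g' l) (at l)" if "l \<in> W" for l
    using that unfolding g[abs_def] g'_def W_def
    by (auto intro!: derivative_eq_intros poly_DERIV)
  have fib: "finite {z \<in> W. g z = a} \<and> card {z \<in> W. g z = a} \<le> Suc n" for a
  proof -
    let ?r = "char_poly (fmat (Suc n) (A a))"
    have deg: "degree ?r = Suc n" "?r \<noteq> 0"
      using degree_monic_char_poly[of "fmat (Suc n) (A a)" "Suc n"] by auto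
    have sub: "{z \<in> W. g z = a} \<subseteq> {z. poly ?r z = 0}"
      by (auto simp: chi g W_def)
    moreover have "finite {z. poly ?r z = 0}" using deg(2) by (rule poly_roots_finite)
    ultimately show ?thesis
      using card_mono[OF \<open>finite {z. poly ?r z = 0}\<close> sub] card_poly_roots_bound[OF deg(2)] deg(1)
      by (auto intro: finite_subset)
  qed
  have "(\<integral>\<^sup>+l. indicator W l * (norm (g' l))\<^sup>2 * \<psi> (g l) \<partial>lborel) \<le> of_nat (Suc n) * (\<integral>\<^sup>+a. \<psi> a \<partial>lborel)"
  proof (rule nn_integral_holomorphic_subst_le)
    show "(g has_field_derivative g' l) (at l)" if "l \<in> W" for l using that by (rule der)
    show "finite {z \<in> W. g z = a} \<and> card {z \<in> W. g z = a} \<le> Suc n" for a by (rule fib)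
    show "g \<in> borel_measurable borel" unfolding g[abs_def] by (intro borel_measurable_divide meas)
    show "g' \<in> borel_measurable borel" unfolding g'_def[abs_def]
      by (intro borel_measurable_divide borel_measurable_diff borel_measurable_times meas)
  qed (use opW \<psi> in auto)
  also have "(\<integral>\<^sup>+l. indicator W l * (norm (g' l))\<^sup>2 * \<psi> (g l) \<partial>lborel) =
    (\<integral>\<^sup>+l. indicator W l * ((norm (poly (pderiv (char_poly (fmat (Suc n) (A (g l))))) l))\<^sup>2 / (norm (poly q l))\<^sup>2) * \<psi> (g l) \<partial>lborel)"
  proof (intro nn_integral_cong)
    fix l
    \<comment> \<open>Since \<open>p - g l * q\<close> vanishes at \<open>l\<close>, the quotient
      rule simplifies to the derivative of this polynomial, with \<open>g l\<close> held constant,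
      divided by \<open>q\<close>.\<close>
    have "g' l = poly (pderiv (char_poly (fmat (Suc n) (A (g l))))) l / poly q l" if "l \<in> W"
      using that by (simp add: chi g g'_def W_def pderiv_diff pderiv_smult field_simps)
    thus "ennreal (indicator W l * (norm (g' l))\<^sup>2) * \<psi> (g l) =
      ennreal (indicator W l * ((norm (poly (pderiv (char_poly (fmat (Suc n) (A (g l))))) l))\<^sup>2 / (norm (poly q l))\<^sup>2)) * \<psi> (g l)"
      by (cases "l \<in> W") (auto simp: norm_divide power_divide)
  qed
  finally show ?thesis unfolding W_def .
qed

lemma measurable_borderI:
  assumes "\<And>i j. i < n \<Longrightarrow> j < n \<Longrightarrow> (\<lambda>x. D x (i, j)) \<in> borel_measurable M"
    and "\<And>j. j < n \<Longrightarrow> (\<lambda>x. w x j) \<in> borel_measurable M"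
    and "\<And>i. i < n \<Longrightarrow> (\<lambda>x. v x i) \<in> borel_measurable M"
    and "a \<in> borel_measurable M"
  shows "(\<lambda>x. border n (D x) (w x) (v x) (a x)) \<in> M \<rightarrow>\<^sub>M lborel_mat (Suc n)"
  unfolding border_def
proof (rule measurable_restrict)
  fix ij :: "nat \<times> nat" assume "ij \<in> {..<Suc n} \<times> {..<Suc n}"
  show "(\<lambda>x. case ij of (i, j) \<Rightarrow> if i < n then if j < n then D x (i, j) else v x i
     else if j < n then w x j else a x) \<in> M \<rightarrow>\<^sub>M lborel"
  proof (cases ij)
    case (Pair i j)
    have "(\<lambda>x. if i < n then if j < n then D x (i, j) else v x i
       else if j < n then w x j else a x) \<in> borel_measurable M"
    proof (cases "i < n")
      case True
      show ?thesis unfolding if_P[OF True]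
        using assms(1)[OF True, of j] assms(3)[OF True] by (cases "j < n") (simp_all only: if_True if_False)
    next
      case False
      show ?thesis unfolding if_not_P[OF False]
        using assms(2)[of j] assms(4) by (cases "j < n") (simp_all only: if_True if_False)
    qed
    thus ?thesis unfolding Pair prod.case by (simp only: measurable_lborel1)
  qed
qed

lemma measurable_eigen_borderI:
  assumes "\<And>i j. i < n \<Longrightarrow> j < n \<Longrightarrow> (\<lambda>x. D x (i, j)) \<in> borel_measurable M"
    "\<And>j. j < n \<Longrightarrow> (\<lambda>x. w x j) \<in> borel_measurable M"
    "\<And>i. i < n \<Longrightarrow> (\<lambda>x. u x i) \<in> borel_measurable M"
    "l \<in> borel_measurable M"
  shows "(\<lambda>x. eigen_border n (D x) (w x) (u x) (l x)) \<in> M \<rightarrow>\<^sub>M lborel_mat (Suc n)"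
  unfolding eigen_border_def
proof (rule measurable_borderI)
  show "(\<lambda>x. l x * u x i - (\<Sum>j<n. D x (i, j) * u x j)) \<in> borel_measurable M" if "i < n" for i
    using that by (intro borel_measurable_diff borel_measurable_times borel_measurable_sum assms) simp_all
  show "(\<lambda>x. l x - (\<Sum>j<n. w x j * u x j)) \<in> borel_measurable M"
    by (intro borel_measurable_diff borel_measurable_times borel_measurable_sum assms) simp_all
qed (rule assms; assumption)+

lemma poly_char_poly_eigen_border:
  "poly (char_poly (fmat (Suc n) (eigen_border n D w u l))) l = 0"
proof -
  define x where "x = Matrix.vec (Suc n) (\<lambda>i. if i < n then u i else 1)"
  let ?A = "fmat (Suc n) (eigen_border n D w u l)"
  have A: "?A \<in> carrier_mat (Suc n) (Suc n)" by simp
  have "x $ n \<noteq> 0\<^sub>v (Suc n) $ n" by (simp add: x_def)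
  hence "x \<noteq> 0\<^sub>v (Suc n)" by auto
  moreover have "?A *\<^sub>v x = l \<cdot>\<^sub>v x"
  proof (rule eq_vecI)
    fix i assume "i < dim_vec (l \<cdot>\<^sub>v x)"
    hence i: "i < Suc n" by (simp add: x_def)
    have "(?A *\<^sub>v x) $ i = (\<Sum>j<n. eigen_border n D w u l (i, j) * u j) + eigen_border n D w u l (i, n)"
      using i by (simp add: mult_mat_vec_def scalar_prod_def x_def atLeast0LessThan cong: sum.cong_simp)
    also have "\<dots> = (l \<cdot>\<^sub>v x) $ i"
    proof (cases "i < n")
      case True
      thus ?thesis by (simp add: x_def eigen_border_def border_simps cong: sum.cong_simp)
    next
      case False
      hence "i = n" using i by simp
      thus ?thesis by (simp add: x_def eigen_border_def border_simps cong: sum.cong_simp)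
    qed
    finally show "(?A *\<^sub>v x) $ i = (l \<cdot>\<^sub>v x) $ i" .
  qed (simp add: x_def)
  ultimately have "eigenvalue ?A l"
    unfolding eigenvalue_def eigenvector_def by (intro exI[of _ x]) (simp add: x_def)
  thus ?thesis using eigenvalue_root_char_poly[OF A] by simp
qed

lemma nn_integral_resolvent_subst:
  assumes q: "poly (char_poly (fmat n D)) l \<noteq> 0"
    and \<Phi>: "\<Phi> \<in> borel_measurable (lborel_vec n)"
  shows "(\<integral>\<^sup>+v. \<Phi> v \<partial>lborel_vec n) = ennreal ((norm (poly (char_poly (fmat n D)) l))\<^sup>2) *
    (\<integral>\<^sup>+u. \<Phi> (\<lambda>i\<in>{..<n}. l * u i - (\<Sum>j<n. D (i, j) * u j)) \<partial>lborel_vec n)"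
proof -
  define P where "P = fmat n (\<lambda>(i, j). (if i = j then l else 0) - D (i, j))"
  have P: "P \<in> carrier_mat n n" "Determinant.det P = poly (char_poly (fmat n D)) l"
    by (simp_all add: P_def poly_char_poly_fmat)
  have "scales_lebesgue {..<n} (act id n P) ((norm (Determinant.det P))\<^sup>2)"
    using P q by (intro scales_lebesgue_act) auto
  moreover have "act id n P u = (\<lambda>i\<in>{..<n}. l * u i - (\<Sum>j<n. D (i, j) * u j))"
    if "u \<in> extensional {..<n}" for u
  proof (rule act_eqI)
    fix k assume "k < n"
    thus "(\<Sum>j<n. P $$ (k, j) * u (id j)) = (\<lambda>i\<in>{..<n}. l * u i - (\<Sum>j<n. D (i, j) * u j)) (id k)"
      by (simp add: P_def left_diff_distrib sum_subtractf if_distrib[of "\<lambda>x. x * _"] cong: if_cong)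
  qed (use that in \<open>auto simp: extensional_def\<close>)
  ultimately have "scales_lebesgue {..<n} (\<lambda>u. \<lambda>i\<in>{..<n}. l * u i - (\<Sum>j<n. D (i, j) * u j)) ((norm (Determinant.det P))\<^sup>2)"
    by (rule scales_lebesgue_cong)
  from scales_lebesgueD[OF this \<Phi>] show ?thesis by (simp add: P)
qed

lemma border_restrict: "border n D w (\<lambda>i\<in>{..<n}. v i) a = border n D w v a"
  by (auto simp: border_def)

lemma AE_poly_nonzero:
  fixes q :: "complex poly"
  assumes "q \<noteq> 0"
  shows "AE l in lborel. poly q l \<noteq> 0"
proof -
  have "finite {l. poly q l = 0}" using assms by (rule poly_roots_finite)
  hence "{l. poly q l = 0} \<in> null_sets lborel"
    by (intro finite_imp_null_set_lborel)
  from AE_not_in[OF this] show ?thesis by simp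
qed

text \<open>Two substitutions with \<open>D\<close> and \<open>w\<close> fixed: corner to
  eigenvalue, then column to eigenvector. The factor |q(l)|^2 of the second cancels the denominator
  from the first, and only the squared derivative of the characteristic polynomial survives.\<close>

lemma nn_integral_eigen_border_le:
  assumes F: "F \<in> borel_measurable (lborel_mat (Suc n))"
    and D: "D \<in> space (lborel_mat n)" and w: "w \<in> space (lborel_vec n)"
  shows "(\<integral>\<^sup>+l. \<integral>\<^sup>+u. ennreal ((norm (poly (pderiv (char_poly (fmat (Suc n) (eigen_border n D w u l)))) l))\<^sup>2) *
       F (eigen_border n D w u l) \<partial>lborel_vec n \<partial>lborel)
    \<le> of_nat (Suc n) * (\<integral>\<^sup>+v. \<integral>\<^sup>+a. F (border n D w v a) \<partial>lborel \<partial>lborel_vec n)"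
proof -
  interpret n: sigma_finite_measure "lborel_vec n"
    by (rule lborel_PiM.sigma_finite) simp
  interpret pair_sigma_finite "lborel_vec n" "lborel :: complex measure" ..
  define q where "q = char_poly (fmat n D)"
  define \<kappa> where "\<kappa> v a = char_poly (fmat (Suc n) (border n D w v a))" for v a
  define g where "g v l = poly (\<kappa> v 0) l / poly q l" for v l
  \<comment> \<open>The intermediate integrand, in which the corner has become the eigenvalue
    \<open>l\<close> while the column is still \<open>v\<close>.\<close>
  define R where "R v l = ennreal (indicator {l. poly q l \<noteq> 0} l * ((norm (poly (pderiv (\<kappa> v (g v l))) l))\<^sup>2 / (norm (poly q l))\<^sup>2))
     * F (border n D w v (g v l))" for v l
  have q0: "q \<noteq> 0"
    using degree_monic_char_poly[of "fmat n D" n] by (auto simp: q_def)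
  have mq: "(\<lambda>l. poly q l) \<in> borel_measurable borel"
    by (intro borel_measurable_continuous_onI continuous_intros)
  have mqs: "{l. poly q l \<noteq> 0} \<in> sets borel"
    by (intro borel_open open_Collect_neq continuous_intros)
  let ?P = "lborel_vec n \<Otimes>\<^sub>M (lborel :: complex measure)"
  have mb: "(\<lambda>x. border n D w (fst x) (a x)) \<in> ?P \<rightarrow>\<^sub>M lborel_mat (Suc n)"
    if "a \<in> borel_measurable ?P" for a
  proof (rule measurable_borderI)
    show "(\<lambda>x. fst x i) \<in> borel_measurable ?P" if "i < n" for i
      using that by (intro measurable_lborel_PiM_component[OF _ measurable_fst]) simp
  qed (use that in simp_all)
  have comp: "(\<lambda>x. border n D w (fst x) (a x) (i, j)) \<in> borel_measurable ?P"
    if "a \<in> borel_measurable ?P" "i < Suc n" "j < Suc n" for a i j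
    by (rule measurable_lborel_PiM_component[OF _ mb[OF that(1)]]) (use that(2,3) in simp)
  have msnd: "snd \<in> borel_measurable ?P"
    using measurable_snd[of "lborel_vec n" "lborel :: complex measure"] by simp
  have mqsnd: "(\<lambda>x. poly q (snd x)) \<in> borel_measurable ?P"
    using measurable_compose[OF msnd mq] .
  have mg: "(\<lambda>x. g (fst x) (snd x)) \<in> borel_measurable ?P"
    unfolding g_def \<kappa>_def
    by (intro borel_measurable_divide measurable_poly_char_poly comp mqsnd msnd borel_measurable_const)
  have mind: "(\<lambda>x. indicator {l. poly q l \<noteq> 0} (snd x) :: real) \<in> borel_measurable ?P"
    using measurable_compose[OF msnd borel_measurable_indicator[OF mqs]] .
  have "(\<lambda>x. R (fst x) (snd x)) \<in> borel_measurable ?P"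
    unfolding R_def \<kappa>_def
  proof (rule borel_measurable_times_ennreal)
    show "(\<lambda>x. F (border n D w (fst x) (g (fst x) (snd x)))) \<in> borel_measurable ?P"
      using measurable_compose[OF mb[OF mg] F] .
    have "(\<lambda>x. poly (pderiv (char_poly (fmat (Suc n) (border n D w (fst x) (g (fst x) (snd x)))))) (snd x)) \<in> borel_measurable ?P"
      by (intro measurable_poly_pderiv_char_poly comp mg msnd)
    note this[measurable] mqsnd[measurable] mind[measurable]
    show "(\<lambda>x. ennreal (indicator {l. poly q l \<noteq> 0} (snd x) *
       ((norm (poly (pderiv (char_poly (fmat (Suc n) (border n D w (fst x) (g (fst x) (snd x)))))) (snd x)))\<^sup>2
        / (norm (poly q (snd x)))\<^sup>2))) \<in> borel_measurable ?P"
      by measurable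
  qed
  hence mR: "(\<lambda>(v, l). R v l) \<in> borel_measurable ?P"
    by (simp add: case_prod_unfold)
  have "(\<integral>\<^sup>+l. \<integral>\<^sup>+u. ennreal ((norm (poly (pderiv (char_poly (fmat (Suc n) (eigen_border n D w u l)))) l))\<^sup>2) *
       F (eigen_border n D w u l) \<partial>lborel_vec n \<partial>lborel) = (\<integral>\<^sup>+l. \<integral>\<^sup>+v. R v l \<partial>lborel_vec n \<partial>lborel)"
  proof (rule nn_integral_cong_AE, rule AE_mp[OF AE_poly_nonzero[OF q0]], intro AE_I2 impI)
    \<comment> \<open>Only the finitely many eigenvalues of \<open>D\<close> are excluded; for any
      other \<open>l\<close> the matrix \<open>l - D\<close> is invertible and the column can be
      exchanged for \<open>u\<close>.\<close>
    fix l assume l: "poly q l \<noteq> 0"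
    have mRl: "(\<lambda>v. R v l) \<in> borel_measurable (lborel_vec n)"
      using measurable_compose[OF measurable_Pair2'[of l lborel "lborel_vec n"] mR] by simp
    define V where "V u = (\<lambda>i\<in>{..<n}. l * u i - (\<Sum>j<n. D (i, j) * u j))" for u
    \<comment> \<open>At \<open>l\<close> the characteristic polynomial is affine in the corner with
      slope \<open>- poly q l\<close>, which is not 0. Hence the corner that makes \<open>l\<close>
      an eigenvalue is unique, and \<open>eigen_border\<close> has one that does.\<close>
    have E: "border n D w (V u) (g (V u) l) = eigen_border n D w u l" for u
    proof -
      have "poly (\<kappa> (V u) (l - (\<Sum>j<n. w j * u j))) l = 0"
        unfolding \<kappa>_def V_def border_restrict using poly_char_poly_eigen_border[of n D w u l]
        by (simp add: eigen_border_def)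
      hence "l - (\<Sum>j<n. w j * u j) = g (V u) l"
        unfolding \<kappa>_def char_poly_border_affine[of n D w _ "l - _"] using l
        by (simp add: g_def \<kappa>_def q_def field_simps)
      thus ?thesis unfolding eigen_border_def by (simp add: V_def border_restrict)
    qed
    have "(\<integral>\<^sup>+v. R v l \<partial>lborel_vec n) = ennreal ((norm (poly q l))\<^sup>2) * (\<integral>\<^sup>+u. R (V u) l \<partial>lborel_vec n)"
      using nn_integral_resolvent_subst[OF _ mRl, of D l] l unfolding V_def q_def by simp
    also have "\<dots> = (\<integral>\<^sup>+u. ennreal ((norm (poly q l))\<^sup>2) * R (V u) l \<partial>lborel_vec n)"
    proof (rule nn_integral_cmult[symmetric])
      have "V \<in> lborel_vec n \<rightarrow>\<^sub>M lborel_vec n"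
        unfolding V_def
      proof (rule measurable_restrict)
        fix i assume "i \<in> {..<n}"
        thus "(\<lambda>u. l * u i - (\<Sum>j<n. D (i, j) * u j)) \<in> lborel_vec n \<rightarrow>\<^sub>M lborel"
          unfolding measurable_lborel1
          by (intro borel_measurable_diff borel_measurable_times borel_measurable_sum borel_measurable_const
              measurable_lborel_PiM_coord)
      qed
      from measurable_compose[OF this mRl] show "(\<lambda>u. R (V u) l) \<in> borel_measurable (lborel_vec n)" .
    qed
    also have "\<dots> = (\<integral>\<^sup>+u. ennreal ((norm (poly (pderiv (char_poly (fmat (Suc n) (eigen_border n D w u l)))) l))\<^sup>2) *
       F (eigen_border n D w u l) \<partial>lborel_vec n)"
      using l unfolding R_def \<kappa>_def E
      by (intro nn_integral_cong) (simp add: mult.assoc[symmetric] ennreal_mult[symmetric])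
    finally show "(\<integral>\<^sup>+u. ennreal ((norm (poly (pderiv (char_poly (fmat (Suc n) (eigen_border n D w u l)))) l))\<^sup>2) *
       F (eigen_border n D w u l) \<partial>lborel_vec n) = (\<integral>\<^sup>+v. R v l \<partial>lborel_vec n)" ..
  qed
  also have "\<dots> = (\<integral>\<^sup>+v. \<integral>\<^sup>+l. R v l \<partial>lborel \<partial>lborel_vec n)"
    using Fubini'[OF mR] by simp
  also have "\<dots> \<le> (\<integral>\<^sup>+v. of_nat (Suc n) * (\<integral>\<^sup>+a. F (border n D w v a) \<partial>lborel) \<partial>lborel_vec n)"
  proof (rule nn_integral_mono)
    fix v :: "nat \<Rightarrow> complex" assume v: "v \<in> space (lborel_vec n)"
    have "(\<lambda>a. F (border n D w v a)) \<in> borel_measurable borel"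
      by (rule measurable_compose[OF measurable_borderI F]) auto
    from nn_integral_eigenvalue_subst[OF this, where D = D and n = n and w = w and v = v]
    show "(\<integral>\<^sup>+l. R v l \<partial>lborel) \<le> of_nat (Suc n) * (\<integral>\<^sup>+a. F (border n D w v a) \<partial>lborel)"
      unfolding R_def g_def \<kappa>_def q_def .
  qed
  also have "\<dots> = of_nat (Suc n) * (\<integral>\<^sup>+v. \<integral>\<^sup>+a. F (border n D w v a) \<partial>lborel \<partial>lborel_vec n)"
  proof (rule nn_integral_cmult)
    have "(\<lambda>(v, a). F (border n D w v a)) \<in> borel_measurable ?P"
      using measurable_compose[OF mb[OF msnd] F] by (simp add: case_prod_unfold)
    thus "(\<lambda>v. \<integral>\<^sup>+a. F (border n D w v a) \<partial>lborel) \<in> borel_measurable (lborel_vec n)"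
      by (rule lborel.borel_measurable_nn_integral)
  qed
  finally show ?thesis .
qed

lemma nn_integral_swap_pairs:
  assumes "sigma_finite_measure M1" "sigma_finite_measure M2" "sigma_finite_measure M3" "sigma_finite_measure M4"
    and f: "(\<lambda>((x, y), (z, t)). f x y z t) \<in> borel_measurable ((M1 \<Otimes>\<^sub>M M2) \<Otimes>\<^sub>M (M3 \<Otimes>\<^sub>M M4))"
  shows "(\<integral>\<^sup>+x. \<integral>\<^sup>+y. \<integral>\<^sup>+z. \<integral>\<^sup>+t. f x y z t \<partial>M4 \<partial>M3 \<partial>M2 \<partial>M1) =
    (\<integral>\<^sup>+z. \<integral>\<^sup>+t. \<integral>\<^sup>+x. \<integral>\<^sup>+y. f x y z t \<partial>M2 \<partial>M1 \<partial>M4 \<partial>M3)"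
proof -
  interpret p12: pair_sigma_finite M1 M2 using assms by (simp add: pair_sigma_finite_def)
  interpret p34: pair_sigma_finite M3 M4 using assms by (simp add: pair_sigma_finite_def)
  have s12: "sigma_finite_measure (M1 \<Otimes>\<^sub>M M2)" by unfold_locales
  have s34: "sigma_finite_measure (M3 \<Otimes>\<^sub>M M4)" by unfold_locales
  interpret p: pair_sigma_finite "M1 \<Otimes>\<^sub>M M2" "M3 \<Otimes>\<^sub>M M4"
    using s12 s34 by (simp add: pair_sigma_finite_def)
  let ?f = "\<lambda>a b. f (fst a) (snd a) (fst b) (snd b)"
  have f': "(\<lambda>(a, b). ?f a b) \<in> borel_measurable ((M1 \<Otimes>\<^sub>M M2) \<Otimes>\<^sub>M (M3 \<Otimes>\<^sub>M M4))"
    using f by (simp add: case_prod_unfold)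
  have g: "(\<lambda>a. \<integral>\<^sup>+b. ?f a b \<partial>(M3 \<Otimes>\<^sub>M M4)) \<in> borel_measurable (M1 \<Otimes>\<^sub>M M2)"
    by (rule sigma_finite_measure.borel_measurable_nn_integral[OF s34 f'])
  have f'': "(\<lambda>(b, a). ?f a b) \<in> borel_measurable ((M3 \<Otimes>\<^sub>M M4) \<Otimes>\<^sub>M (M1 \<Otimes>\<^sub>M M2))"
    using measurable_pair_swap[OF f'] by (simp add: case_prod_unfold)
  have h: "(\<lambda>b. \<integral>\<^sup>+a. ?f a b \<partial>(M1 \<Otimes>\<^sub>M M2)) \<in> borel_measurable (M3 \<Otimes>\<^sub>M M4)"
    by (rule sigma_finite_measure.borel_measurable_nn_integral[OF s12 f''])
  have "(\<integral>\<^sup>+x. \<integral>\<^sup>+y. \<integral>\<^sup>+z. \<integral>\<^sup>+t. f x y z t \<partial>M4 \<partial>M3 \<partial>M2 \<partial>M1) =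
    (\<integral>\<^sup>+x. \<integral>\<^sup>+y. \<integral>\<^sup>+b. ?f (x, y) b \<partial>(M3 \<Otimes>\<^sub>M M4) \<partial>M2 \<partial>M1)"
  proof (intro nn_integral_cong)
    fix x y assume "x \<in> space M1" "y \<in> space M2"
    hence "(x, y) \<in> space (M1 \<Otimes>\<^sub>M M2)" by (simp add: space_pair_measure)
    from sigma_finite_measure.nn_integral_fst[OF assms(4), OF measurable_compose[OF measurable_Pair1'[OF this] f']]
    show "(\<integral>\<^sup>+z. \<integral>\<^sup>+t. f x y z t \<partial>M4 \<partial>M3) = (\<integral>\<^sup>+b. ?f (x, y) b \<partial>(M3 \<Otimes>\<^sub>M M4))"
      by simp
  qed
  also have "\<dots> = (\<integral>\<^sup>+a. \<integral>\<^sup>+b. ?f a b \<partial>(M3 \<Otimes>\<^sub>M M4) \<partial>(M1 \<Otimes>\<^sub>M M2))"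
    by (rule sigma_finite_measure.nn_integral_fst[OF assms(2), OF g])
  also have "\<dots> = (\<integral>\<^sup>+b. \<integral>\<^sup>+a. ?f a b \<partial>(M1 \<Otimes>\<^sub>M M2) \<partial>(M3 \<Otimes>\<^sub>M M4))"
    using p.Fubini'[OF f'] by simp
  also have "\<dots> = (\<integral>\<^sup>+z. \<integral>\<^sup>+t. \<integral>\<^sup>+a. ?f a (z, t) \<partial>(M1 \<Otimes>\<^sub>M M2) \<partial>M4 \<partial>M3)"
    by (rule sigma_finite_measure.nn_integral_fst[OF assms(4), OF h, symmetric])
  also have "\<dots> = (\<integral>\<^sup>+z. \<integral>\<^sup>+t. \<integral>\<^sup>+x. \<integral>\<^sup>+y. f x y z t \<partial>M2 \<partial>M1 \<partial>M4 \<partial>M3)"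
  proof (intro nn_integral_cong)
    fix z t assume "z \<in> space M3" "t \<in> space M4"
    hence "(z, t) \<in> space (M3 \<Otimes>\<^sub>M M4)" by (simp add: space_pair_measure)
    from sigma_finite_measure.nn_integral_fst[OF assms(2), OF measurable_compose[OF measurable_Pair1'[OF this] f'']]
    show "(\<integral>\<^sup>+a. ?f a (z, t) \<partial>(M1 \<Otimes>\<^sub>M M2)) = (\<integral>\<^sup>+x. \<integral>\<^sup>+y. f x y z t \<partial>M2 \<partial>M1)"
      by simp
  qed
  finally show ?thesis .
qed

section \<open>Deflation as a change of variables in block and row\<close>

lemma contraction_carrier: "contraction n u \<in> carrier_mat n n"
  by (simp add: contraction_def)

lemma expansion_carrier: "expansion n u \<in> carrier_mat n n"
  by (simp add: expansion_def)

text \<open>The expansion on the left contributes \<open>b\<^sup>2 ^ n\<close>, the contraction on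
  the right its inverse, and the term \<open>u w\<close> with a fixed row is a translation.\<close>

lemma scales_lebesgue_deflated_block:
  "scales_lebesgue ({..<n} \<times> {..<n}) (\<lambda>B. \<lambda>ij\<in>{..<n} \<times> {..<n}. deflated_block n u B w ij) 1"
proof -
  let ?I = "{..<n} \<times> {..<n}"
  let ?R = "\<lambda>x (i, j). if i < n \<and> j < n then \<Sum>l<n. x (i, l) * contraction n u $$ (l, j) else x (i, j)"
  let ?L = "\<lambda>x (i, j). if i < n \<and> j < n then \<Sum>l<n. expansion n u $$ (i, l) * x (l, j) else x (i, j)"
  let ?S = "\<lambda>x. \<lambda>ij\<in>?I. x ij + u (fst ij) * w (snd ij)"
  define b where "b = scale_of n u"
  have b: "b > 0" by (simp add: b_def scale_of_pos)
  have R: "scales_lebesgue ?I ?R ((1 / b)\<^sup>2 ^ n)"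
    using scales_lebesgue_mult_right[OF contraction_carrier, of n u] b
    by (simp add: det_contraction b_def norm_divide)
  have L: "scales_lebesgue ?I ?L (b\<^sup>2 ^ n)"
    using scales_lebesgue_mult_left[OF expansion_carrier, of n u] b
    by (simp add: det_expansion b_def)
  have "scales_lebesgue ?I (\<lambda>x. ?S (?L (?R x))) (1 * (b\<^sup>2 ^ n * (1 / b)\<^sup>2 ^ n))"
    by (rule scales_lebesgue_comp[OF scales_lebesgue_shift scales_lebesgue_comp[OF L R]]) auto
  moreover have "b\<^sup>2 ^ n * (1 / b)\<^sup>2 ^ n = 1"
    using b by (simp add: power_mult_distrib[symmetric])
  moreover have "?S (?L (?R x)) = (\<lambda>ij\<in>?I. deflated_block n u x w ij)" for x
  proof
    fix ij show "?S (?L (?R x)) ij = (\<lambda>ij\<in>?I. deflated_block n u x w ij) ij"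
      by (cases ij) (auto simp: deflated_block_def)
  qed
  ultimately show ?thesis by simp
qed

text \<open>For fixed \<open>B\<close> the map is affine in the row. Its linear part, the transposed
  contraction divided by \<open>b\<close>, has determinant \<open>(1 / b) ^ Suc n\<close>: one
  factor from the contraction and \<open>n\<close> from the scalar.\<close>

lemma scales_lebesgue_deflated_row:
  "scales_lebesgue {..<n} (\<lambda>w. \<lambda>j\<in>{..<n}. deflated_row n u l B w j) ((1 / (scale_of n u)\<^sup>2) ^ Suc n)"
proof -
  define b where "b = scale_of n u"
  have b: "b > 0" by (simp add: b_def scale_of_pos)
  define Q where "Q = (1 / of_real b) \<cdot>\<^sub>m transpose_mat (contraction n u)"
  have Qc: "Q \<in> carrier_mat n n" by (simp add: Q_def contraction_def)
  have "Determinant.det Q = (1 / of_real b) ^ Suc n"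
    using contraction_carrier[of n u] by (simp add: Q_def det_transpose[OF contraction_carrier] det_contraction b_def)
  hence detQ: "Determinant.det Q \<noteq> 0" "(norm (Determinant.det Q))\<^sup>2 = (1 / b\<^sup>2) ^ Suc n"
    using b by (simp_all add: norm_mult norm_divide norm_power power_mult_distrib power_divide power2_eq_square)
  have 1: "scales_lebesgue {..<n} (act id n Q) ((1 / b\<^sup>2) ^ Suc n)"
    using scales_lebesgue_act[of "{..<n}" id n Q] Qc detQ by simp
  let ?c = "\<lambda>j. (l * cnj (u j) / of_real b -
        (\<Sum>i<n. cnj (u i) * (\<Sum>m<n. B (i, m) * contraction n u $$ (m, j)))) / of_real b"
  have "scales_lebesgue {..<n} (\<lambda>x. \<lambda>j\<in>{..<n}. act id n Q x j + ?c j) (1 * (1 / b\<^sup>2) ^ Suc n)"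
    by (rule scales_lebesgue_comp[OF scales_lebesgue_shift 1]) auto
  moreover have "(\<lambda>j\<in>{..<n}. act id n Q x j + ?c j) = (\<lambda>j\<in>{..<n}. deflated_row n u l B x j)" for x
  proof
    fix j
    show "(\<lambda>j\<in>{..<n}. act id n Q x j + ?c j) j = (\<lambda>j\<in>{..<n}. deflated_row n u l B x j) j"
    proof (cases "j < n")
      case True
      hence "act id n Q x (id j) = (\<Sum>m<n. x m * contraction n u $$ (m, j)) / of_real b"
        using contraction_carrier[of n u]
        by (subst act_apply) (auto simp: Q_def sum_divide_distrib mult.commute intro!: sum.cong)
      thus ?thesis using True by (simp add: deflated_row_def b_def)
    qed simp
  qed
  ultimately show ?thesis by (simp add: b_def)
qed

text \<open>The block formula involves the final row and the row formula the deflated block, so the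
  substitution is triangular: \<open>D\<close> is replaced first for a fixed row, then the row for
  fixed \<open>B\<close>, with Tonelli in between.\<close>

lemma nn_integral_block_subst:
  assumes \<Phi>: "(\<lambda>(D, w). \<Phi> D w) \<in> borel_measurable (lborel_mat n \<Otimes>\<^sub>M lborel_vec n)"
  shows "(\<integral>\<^sup>+D. \<integral>\<^sup>+w. \<Phi> D w \<partial>lborel_vec n \<partial>lborel_mat n) =
    ennreal ((1 / (scale_of n u)\<^sup>2) ^ Suc n) * (\<integral>\<^sup>+B. \<integral>\<^sup>+w.
      \<Phi> (\<lambda>ij\<in>{..<n} \<times> {..<n}. deflated_block n u B (\<lambda>j\<in>{..<n}. deflated_row n u l B w j) ij)
        (\<lambda>j\<in>{..<n}. deflated_row n u l B w j) \<partial>lborel_vec n \<partial>lborel_mat n)"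
proof -
  let ?I = "{..<n} \<times> {..<n}"
  interpret n: sigma_finite_measure "lborel_vec n"
    by (rule lborel_PiM.sigma_finite) simp
  interpret n2: sigma_finite_measure "lborel_PiM ?I :: (nat \<times> nat \<Rightarrow> complex) measure"
    by (rule lborel_PiM.sigma_finite) simp
  interpret p: pair_sigma_finite "lborel_PiM ?I :: (nat \<times> nat \<Rightarrow> complex) measure" "lborel_vec n" ..
  let ?M = "lborel_PiM ?I \<Otimes>\<^sub>M (lborel_vec n)"
  define T where "T B w = (\<lambda>ij\<in>?I. deflated_block n u B w ij)" for B w
  define W where "W B w = (\<lambda>j\<in>{..<n}. deflated_row n u l B w j)" for B w
  have mB: "(\<lambda>x. fst x ij) \<in> borel_measurable ?M" if "ij \<in> ?I" for ij
    using that by (rule measurable_lborel_PiM_component[OF _ measurable_fst])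
  have mw: "(\<lambda>x. snd x j) \<in> borel_measurable ?M" if "j < n" for j
    using that by (intro measurable_lborel_PiM_component[OF _ measurable_snd]) simp
  have mT: "(\<lambda>x. T (fst x) (snd x)) \<in> ?M \<rightarrow>\<^sub>M lborel_PiM ?I"
    unfolding T_def
  proof (rule measurable_restrict)
    fix ij assume "ij \<in> ?I"
    thus "(\<lambda>x. deflated_block n u (fst x) (snd x) ij) \<in> ?M \<rightarrow>\<^sub>M lborel"
      unfolding measurable_lborel1 deflated_block_def case_prod_unfold
      by (intro borel_measurable_add borel_measurable_times borel_measurable_sum borel_measurable_const mB mw) auto
  qed
  have mW: "(\<lambda>x. W (fst x) (snd x)) \<in> ?M \<rightarrow>\<^sub>M lborel_vec n"
    unfolding W_def
  proof (rule measurable_restrict)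
    fix j assume "j \<in> {..<n}"
    thus "(\<lambda>x. deflated_row n u l (fst x) (snd x) j) \<in> ?M \<rightarrow>\<^sub>M lborel"
      unfolding measurable_lborel1 deflated_row_def
      by (intro borel_measurable_add borel_measurable_diff borel_measurable_divide borel_measurable_times
          borel_measurable_sum borel_measurable_const mB mw) auto
  qed
  define \<Psi> where "\<Psi> B w = \<Phi> (T B w) w" for B w
  have m\<Psi>: "(\<lambda>(B, w). \<Psi> B w) \<in> borel_measurable ?M"
    using measurable_compose[OF measurable_Pair[OF mT measurable_snd] \<Phi>] by (simp add: \<Psi>_def case_prod_unfold)
  have m\<Psi>W: "(\<lambda>(B, w). \<Psi> B (W B w)) \<in> borel_measurable ?M"
    using measurable_compose[OF measurable_Pair[OF measurable_fst mW] m\<Psi>] by (simp add: case_prod_unfold)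
  have "(\<integral>\<^sup>+D. \<integral>\<^sup>+w. \<Phi> D w \<partial>lborel_vec n \<partial>lborel_PiM ?I) = (\<integral>\<^sup>+w. \<integral>\<^sup>+D. \<Phi> D w \<partial>lborel_PiM ?I \<partial>lborel_vec n)"
    using p.Fubini'[OF \<Phi>] by simp
  also have "\<dots> = (\<integral>\<^sup>+w. \<integral>\<^sup>+B. \<Psi> B w \<partial>lborel_PiM ?I \<partial>lborel_vec n)"
  proof (rule nn_integral_cong)
    fix w :: "nat \<Rightarrow> complex" assume "w \<in> space (lborel_vec n)"
    from measurable_compose[OF measurable_Pair2'[OF this] \<Phi>]
    have "(\<lambda>D. \<Phi> D w) \<in> borel_measurable (lborel_PiM ?I)" by simp
    from scales_lebesgueD[OF scales_lebesgue_deflated_block this]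
    show "(\<integral>\<^sup>+D. \<Phi> D w \<partial>lborel_PiM ?I) = (\<integral>\<^sup>+B. \<Psi> B w \<partial>lborel_PiM ?I)"
      unfolding \<Psi>_def T_def by simp
  qed
  also have "\<dots> = (\<integral>\<^sup>+B. \<integral>\<^sup>+w. \<Psi> B w \<partial>lborel_vec n \<partial>lborel_PiM ?I)"
    using p.Fubini'[OF m\<Psi>] by simp
  also have "\<dots> = (\<integral>\<^sup>+B. ennreal ((1 / (scale_of n u)\<^sup>2) ^ Suc n) * (\<integral>\<^sup>+w. \<Psi> B (W B w) \<partial>lborel_vec n) \<partial>lborel_PiM ?I)"
  proof (rule nn_integral_cong)
    fix B :: "nat \<times> nat \<Rightarrow> complex" assume "B \<in> space (lborel_PiM ?I)"
    from measurable_compose[OF measurable_Pair1'[OF this] m\<Psi>]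
    have "(\<lambda>w. \<Psi> B w) \<in> borel_measurable (lborel_vec n)" by simp
    from scales_lebesgueD[OF scales_lebesgue_deflated_row this]
    show "(\<integral>\<^sup>+w. \<Psi> B w \<partial>lborel_vec n) = ennreal ((1 / (scale_of n u)\<^sup>2) ^ Suc n) * (\<integral>\<^sup>+w. \<Psi> B (W B w) \<partial>lborel_vec n)"
      unfolding W_def .
  qed
  also have "\<dots> = ennreal ((1 / (scale_of n u)\<^sup>2) ^ Suc n) * (\<integral>\<^sup>+B. \<integral>\<^sup>+w. \<Psi> B (W B w) \<partial>lborel_vec n \<partial>lborel_PiM ?I)"
    by (rule nn_integral_cmult[OF n.borel_measurable_nn_integral[OF m\<Psi>W]])
  finally show ?thesis unfolding \<Psi>_def T_def W_def .
qed

text \<open>Substitutions have to land in the extensional functions that make up the product space,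
  whereas \<open>deflation\<close> speaks of plain functions. Values outside the index range never
  enter the bordered matrix.\<close>

lemma eigen_border_restrict:
  "eigen_border n (\<lambda>ij\<in>{..<n} \<times> {..<n}. deflated_block n u B (\<lambda>j\<in>{..<n}. W j) ij) (\<lambda>j\<in>{..<n}. W j) u l
    = eigen_border n (deflated_block n u B W) W u l"
proof -
  have *: "restrict (deflated_block n u B (restrict W {..<n})) ({..<n} \<times> {..<n}) (i, j) = deflated_block n u B W (i, j)"
    if "i < n" "j < n" for i j
    using that by (simp add: deflated_block_def)
  have W: "restrict W {..<n} j = W j" if "j < n" for j
    using that by simp
  have S: "(\<Sum>j<n. restrict W {..<n} j * u j) = (\<Sum>j<n. W j * u j)"
    by (intro sum.cong) auto
  show ?thesis
    unfolding eigen_border_def border_def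
    by (intro restrict_ext) (auto simp: * W S simp del: restrict_apply split: if_splits)
qed


text \<open>The characteristic polynomial stands for the unordered eigenvalues with multiplicity, so
  \<open>H\<close> is a general class function. The weight is the Gaussian of the case
  \<open>L = 0\<close>, not normalised.\<close>

definition ginibre_integral :: "nat \<Rightarrow> (complex poly \<Rightarrow> ennreal) \<Rightarrow> ennreal" where
  "ginibre_integral n H = (\<integral>\<^sup>+x. H (char_poly (fmat n x)) * ennreal (exp (- frob_square n x))
     \<partial>lborel_mat n)"

text \<open>Splitting off an eigenvalue \<open>l\<close> turns the class function \<open>H\<close> into \<open>conditioned l H\<close>.\<close>

definition conditioned :: "complex \<Rightarrow> (complex poly \<Rightarrow> ennreal) \<Rightarrow> complex poly \<Rightarrow> ennreal" where
  "conditioned l H p = ennreal ((norm (poly p l))\<^sup>2) * H ([:- l, 1:] * p)"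

lemma measurable_frob_square:
  "frob_square n \<in> borel_measurable (lborel_mat n)"
  unfolding frob_square_def[abs_def]
  by (intro borel_measurable_sum borel_measurable_power measurable_compose[OF _ borel_measurable_norm]
      measurable_lborel_PiM_coord) auto

lemma measurable_ginibre_weight:
  assumes "H \<in> borel_measurable poly_space"
  shows "(\<lambda>x. H (char_poly (fmat n x)) * ennreal (exp (- frob_square n x)))
    \<in> borel_measurable (lborel_mat n)"
proof -
  note measurable_frob_square[measurable]
  have [measurable]: "(\<lambda>x. char_poly (fmat n x)) \<in> lborel_mat n \<rightarrow>\<^sub>M poly_space"
    by (intro measurable_char_poly measurable_lborel_PiM_coord) auto
  note assms[measurable]
  show ?thesis by measurable
qed

lemma measurable_conditioned:
  assumes H: "H \<in> borel_measurable poly_space"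
    and f: "f \<in> M \<rightarrow>\<^sub>M poly_space" and l[measurable]: "l \<in> borel_measurable M"
    and fl[measurable]: "(\<lambda>x. poly (f x) (l x)) \<in> borel_measurable M"
  shows "(\<lambda>x. conditioned (l x) H (f x)) \<in> borel_measurable M"
proof -
  have [measurable]: "(\<lambda>x. poly (f x) z) \<in> borel_measurable M" for z
    using measurable_compose[OF f poly_space_eval] .
  have "(\<lambda>x. [:- l x, 1:] * f x) \<in> M \<rightarrow>\<^sub>M poly_space"
    by (rule measurable_poly_spaceI) simp
  note [measurable] = measurable_compose[OF this H]
  show ?thesis unfolding conditioned_def by measurable
qed

text \<open>In the new variables the integrand splits into a factor in \<open>u\<close>, a Gaussian
  in \<open>w\<close>, a Gaussian in \<open>l\<close>, and an integrand in \<open>B\<close> of the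
  same kind as before with \<open>conditioned l H\<close> for \<open>H\<close>. The factor
  \<open>Suc n\<close> bounds the number of eigenvalues that a matrix offers as
  \<open>l\<close>.\<close>

lemma ginibre_integral_Suc_ge:
  assumes H: "H \<in> borel_measurable poly_space"
  shows "(\<integral>\<^sup>+u. ennreal ((1 / (scale_of n u)\<^sup>2) ^ Suc n) \<partial>lborel_vec n) *
      (\<integral>\<^sup>+w. ennreal (exp (- (\<Sum>i<n. (norm (w i))\<^sup>2))) \<partial>lborel_vec n) *
      (\<integral>\<^sup>+l. ennreal (exp (- (norm l)\<^sup>2)) * ginibre_integral n (conditioned l H) \<partial>lborel)
    \<le> of_nat (Suc n) * ginibre_integral (Suc n) H"
proof -
  let ?I = "{..<n} \<times> {..<n}"
  let ?L = "lborel :: complex measure"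
  have sn: "sigma_finite_measure (lborel_vec n)"
    by (rule lborel_PiM.sigma_finite) simp
  have sn2: "sigma_finite_measure (lborel_PiM ?I :: (nat \<times> nat \<Rightarrow> complex) measure)"
    by (rule lborel_PiM.sigma_finite) simp
  have sl: "sigma_finite_measure ?L" by unfold_locales
  define F where "F x = H (char_poly (fmat (Suc n) x)) * ennreal (exp (- frob_square (Suc n) x))" for x
  have F: "F \<in> borel_measurable (lborel_mat (Suc n))"
    unfolding F_def[abs_def] by (rule measurable_ginibre_weight[OF H])
  define G where "G D w l u = ennreal ((norm (poly (pderiv (char_poly (fmat (Suc n) (eigen_border n D w u l)))) l))\<^sup>2) *
       F (eigen_border n D w u l)" for D w l u
  let ?M = "(lborel_PiM ?I \<Otimes>\<^sub>M (lborel_vec n)) \<Otimes>\<^sub>M (?L \<Otimes>\<^sub>M (lborel_vec n))"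
  have cD: "(\<lambda>x. fst (fst x) ij) \<in> borel_measurable ?M" if "ij \<in> ?I" for ij
    using that by (rule measurable_lborel_PiM_component[OF _ measurable_compose[OF measurable_fst measurable_fst]])
  have cw: "(\<lambda>x. snd (fst x) j) \<in> borel_measurable ?M" if "j < n" for j
    using that by (intro measurable_lborel_PiM_component[OF _ measurable_compose[OF measurable_fst measurable_snd]]) simp
  have cu: "(\<lambda>x. snd (snd x) j) \<in> borel_measurable ?M" if "j < n" for j
    using that by (intro measurable_lborel_PiM_component[OF _ measurable_compose[OF measurable_snd measurable_snd]]) simp
  have cl: "(\<lambda>x. fst (snd x)) \<in> borel_measurable ?M"
    using measurable_compose[OF measurable_snd measurable_fst] by (simp add: measurable_lborel1[symmetric] del: measurable_lborel1)
  have E: "(\<lambda>x. eigen_border n (fst (fst x)) (snd (fst x)) (snd (snd x)) (fst (snd x))) \<in> ?M \<rightarrow>\<^sub>M lborel_mat (Suc n)"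
    by (rule measurable_eigen_borderI) (use cD cw cu cl in auto)
  have mG: "(\<lambda>((D, w), (l, u)). G D w l u) \<in> borel_measurable ?M"
  proof -
    note [measurable] = measurable_compose[OF E F]
    have "(\<lambda>x. eigen_border n (fst (fst x)) (snd (fst x)) (snd (snd x)) (fst (snd x)) (i, j)) \<in> borel_measurable ?M"
      if "i < Suc n" "j < Suc n" for i j
      using that by (intro measurable_lborel_PiM_component[OF _ E]) simp
    from measurable_poly_pderiv_char_poly[where f = "\<lambda>x. eigen_border n (fst (fst x)) (snd (fst x)) (snd (snd x)) (fst (snd x))", OF this cl]
    have [measurable]: "(\<lambda>x. poly (pderiv (char_poly (fmat (Suc n)
       (eigen_border n (fst (fst x)) (snd (fst x)) (snd (snd x)) (fst (snd x)))))) (fst (snd x))) \<in> borel_measurable ?M" .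
    show ?thesis unfolding G_def case_prod_unfold by measurable
  qed
  define c2 where "c2 = (\<integral>\<^sup>+w. ennreal (exp (- (\<Sum>i<n. (norm (w i))\<^sup>2))) \<partial>lborel_vec n)"
  define \<alpha> where "\<alpha> u = ennreal ((1 / (scale_of n u)\<^sup>2) ^ Suc n)" for u
  define K where "K l = ennreal (exp (- (norm l)\<^sup>2)) * ginibre_integral n (conditioned l H)" for l
  have norm_coord: "(\<lambda>w. norm (w i)) \<in> borel_measurable (lborel_vec n)" if "i < n" for i
    using that by (intro measurable_compose[OF measurable_lborel_PiM_coord borel_measurable_norm]) simp
  have m\<alpha>: "\<alpha> \<in> borel_measurable (lborel_vec n)"
  proof -
    have "(\<lambda>u. (scale_of n u)\<^sup>2) \<in> borel_measurable (lborel_vec n)"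
      unfolding scale_of_square
      by (intro borel_measurable_add borel_measurable_const borel_measurable_sum borel_measurable_power norm_coord) auto
    note [measurable] = this
    show ?thesis unfolding \<alpha>_def[abs_def] by measurable
  qed
  have inner: "(\<integral>\<^sup>+D. \<integral>\<^sup>+w. G D w l u \<partial>lborel_vec n \<partial>lborel_PiM ?I) = \<alpha> u * (c2 * K l)"
    if u: "u \<in> space (lborel_vec n)" for l u
  proof -
    have "(l, u) \<in> space (?L \<Otimes>\<^sub>M lborel_vec n)" using u by (simp add: space_pair_measure)
    from measurable_compose[OF measurable_Pair2'[OF this] mG]
    have mGl: "(\<lambda>(D, w). G D w l u) \<in> borel_measurable (lborel_PiM ?I \<Otimes>\<^sub>M lborel_vec n)"
      by (simp add: case_prod_unfold)
    have eq: "G (\<lambda>ij\<in>?I. deflated_block n u B (\<lambda>j\<in>{..<n}. deflated_row n u l B w j) ij) (\<lambda>j\<in>{..<n}. deflated_row n u l B w j) l u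
       = ennreal (exp (- (\<Sum>i<n. (norm (w i))\<^sup>2))) * (ennreal (exp (- (norm l)\<^sup>2)) *
          (conditioned l H (char_poly (fmat n B)) * ennreal (exp (- frob_square n B))))" for B w
    proof -
      \<comment> \<open>This turns the squared derivative left by the corner substitution into the
        weight of \<open>conditioned\<close>.\<close>
      have pd: "poly (pderiv ([:- l, 1:] * p)) l = poly p l" for p
        by (simp add: pderiv_pCons pderiv_diff pderiv_smult)
      have ex: "ennreal (exp (- (a + b + c))) = ennreal (exp (- a)) * ennreal (exp (- b)) * ennreal (exp (- c))" for a b c
        by (simp add: ennreal_mult[symmetric] exp_add[symmetric])
      show ?thesis
        unfolding G_def F_def eigen_border_restrict deflation conditioned_def pd ex
        by (simp only: mult_ac)
    qed
    have "(\<integral>\<^sup>+D. \<integral>\<^sup>+w. G D w l u \<partial>lborel_vec n \<partial>lborel_PiM ?I) = \<alpha> u * (\<integral>\<^sup>+B. \<integral>\<^sup>+w.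
        ennreal (exp (- (\<Sum>i<n. (norm (w i))\<^sup>2))) * (ennreal (exp (- (norm l)\<^sup>2)) *
          (conditioned l H (char_poly (fmat n B)) * ennreal (exp (- frob_square n B)))) \<partial>lborel_vec n \<partial>lborel_PiM ?I)"
      unfolding \<alpha>_def eq[symmetric] by (rule nn_integral_block_subst[OF mGl])
    also have "\<dots> = \<alpha> u * (\<integral>\<^sup>+B. c2 * (ennreal (exp (- (norm l)\<^sup>2)) *
          (conditioned l H (char_poly (fmat n B)) * ennreal (exp (- frob_square n B)))) \<partial>lborel_PiM ?I)"
    proof -
      have "(\<lambda>w. \<Sum>i<n. (norm (w i))\<^sup>2) \<in> borel_measurable (lborel_vec n)"
        by (intro borel_measurable_sum borel_measurable_power norm_coord) auto
      note [measurable] = this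
      have "(\<lambda>w. ennreal (exp (- (\<Sum>i<n. (norm (w i))\<^sup>2)))) \<in> borel_measurable (lborel_vec n)"
        by measurable
      thus ?thesis unfolding c2_def by (simp only: nn_integral_multc)
    qed
    also have "\<dots> = \<alpha> u * (c2 * K l)"
    proof -
      have "conditioned l H \<in> borel_measurable poly_space"
        by (rule measurable_conditioned[OF H]) (auto intro: measurable_ident)
      note m = measurable_ginibre_weight[OF this, of n]
      note [measurable] = m
      show ?thesis unfolding K_def ginibre_integral_def
        by (simp add: nn_integral_cmult)
    qed
    finally show ?thesis .
  qed
  have mK: "K \<in> borel_measurable borel"
  proof -
    let ?N = "?L \<Otimes>\<^sub>M lborel_PiM ?I"
    have fst_m: "fst \<in> borel_measurable ?N"
      using measurable_fst[of ?L "lborel_PiM ?I"] by (simp add: measurable_lborel1[symmetric] del: measurable_lborel1)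
    have coord: "(\<lambda>x. snd x ij) \<in> borel_measurable ?N" if "ij \<in> ?I" for ij
      using that by (rule measurable_lborel_PiM_component[OF _ measurable_snd])
    have "(\<lambda>x. conditioned (fst x) H (char_poly (fmat n (snd x)))) \<in> borel_measurable ?N"
      by (intro measurable_conditioned H measurable_char_poly measurable_poly_char_poly fst_m coord) auto
    moreover have "(\<lambda>x. frob_square n (snd x)) \<in> borel_measurable ?N"
      by (rule measurable_compose[OF measurable_snd measurable_frob_square])
    moreover note [measurable] = calculation
    have "(\<lambda>x. conditioned (fst x) H (char_poly (fmat n (snd x))) * ennreal (exp (- frob_square n (snd x)))) \<in> borel_measurable ?N"
      by measurable
    hence "(\<lambda>(l, x). conditioned l H (char_poly (fmat n x)) * ennreal (exp (- frob_square n x))) \<in> borel_measurable ?N"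
      by (simp add: case_prod_unfold)
    from sigma_finite_measure.borel_measurable_nn_integral[OF sn2 this]
    have [measurable]: "(\<lambda>l. ginibre_integral n (conditioned l H)) \<in> borel_measurable borel"
      unfolding ginibre_integral_def by simp
    show ?thesis unfolding K_def[abs_def] by measurable
  qed
  have "(\<integral>\<^sup>+u. \<alpha> u \<partial>lborel_vec n) * c2 * (\<integral>\<^sup>+l. K l \<partial>lborel) = (\<integral>\<^sup>+l. (\<integral>\<^sup>+u. \<alpha> u \<partial>lborel_vec n) * c2 * K l \<partial>lborel)"
    using mK by (intro nn_integral_cmult[symmetric]) simp
  also have "\<dots> = (\<integral>\<^sup>+l. \<integral>\<^sup>+u. \<alpha> u * (c2 * K l) \<partial>lborel_vec n \<partial>lborel)"
    using m\<alpha> by (simp add: nn_integral_multc mult.assoc)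
  also have "\<dots> = (\<integral>\<^sup>+l. \<integral>\<^sup>+u. \<integral>\<^sup>+D. \<integral>\<^sup>+w. G D w l u \<partial>lborel_vec n \<partial>lborel_PiM ?I \<partial>lborel_vec n \<partial>lborel)"
    using inner by (intro nn_integral_cong) auto
  also have "\<dots> = (\<integral>\<^sup>+D. \<integral>\<^sup>+w. \<integral>\<^sup>+l. \<integral>\<^sup>+u. G D w l u \<partial>lborel_vec n \<partial>lborel \<partial>lborel_vec n \<partial>lborel_PiM ?I)"
    by (rule nn_integral_swap_pairs[OF sn2 sn sl sn mG, symmetric])
  also have "\<dots> \<le> (\<integral>\<^sup>+D. \<integral>\<^sup>+w. of_nat (Suc n) * (\<integral>\<^sup>+v. \<integral>\<^sup>+a. F (border n D w v a) \<partial>lborel \<partial>lborel_vec n)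
      \<partial>lborel_vec n \<partial>lborel_PiM ?I)"
    unfolding G_def by (intro nn_integral_mono nn_integral_eigen_border_le[OF F])
  also have "\<dots> = of_nat (Suc n) * (\<integral>\<^sup>+D. \<integral>\<^sup>+w. \<integral>\<^sup>+v. \<integral>\<^sup>+a. F (border n D w v a) \<partial>lborel \<partial>lborel_vec n
      \<partial>lborel_vec n \<partial>lborel_PiM ?I)"
  proof -
    interpret n: sigma_finite_measure "lborel_vec n" by (rule sn)
    have 0: "(\<lambda>x. border n (fst x) (fst (snd x)) (fst (snd (snd x))) (snd (snd (snd x)))) \<in> border_measure n \<rightarrow>\<^sub>M lborel_mat (Suc n)"
      using border_measurable[of n] by (simp add: case_prod_unfold)
    have 1: "(\<lambda>((D, w), v, a). F (border n D w v a)) \<in> borel_measurable ((lborel_PiM ?I \<Otimes>\<^sub>M lborel_vec n) \<Otimes>\<^sub>M (lborel_vec n \<Otimes>\<^sub>M ?L))"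
      using measurable_compose[OF measurable_compose[OF measurable_Pair[OF measurable_compose[OF measurable_fst measurable_fst]
         measurable_Pair[OF measurable_compose[OF measurable_fst measurable_snd] measurable_snd]] 0] F]
      by (simp add: case_prod_unfold)
    have 2: "(\<lambda>(D, w). \<integral>\<^sup>+v. \<integral>\<^sup>+a. F (border n D w v a) \<partial>lborel \<partial>lborel_vec n) \<in> borel_measurable (lborel_PiM ?I \<Otimes>\<^sub>M lborel_vec n)"
    proof -
      have "(\<lambda>(y, a). F (border n (fst (fst y)) (snd (fst y)) (snd y) a)) \<in>
         borel_measurable (((lborel_PiM ?I \<Otimes>\<^sub>M lborel_vec n) \<Otimes>\<^sub>M lborel_vec n) \<Otimes>\<^sub>M ?L)"
        using measurable_compose[OF measurable_Pair[OF measurable_compose[OF measurable_fst measurable_fst]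
           measurable_Pair[OF measurable_compose[OF measurable_fst measurable_snd] measurable_snd]] 1]
        by (simp add: case_prod_unfold)
      from lborel.borel_measurable_nn_integral[OF this]
      have "(\<lambda>(x, v). \<integral>\<^sup>+a. F (border n (fst x) (snd x) v a) \<partial>lborel) \<in>
         borel_measurable ((lborel_PiM ?I \<Otimes>\<^sub>M lborel_vec n) \<Otimes>\<^sub>M lborel_vec n)"
        by (simp add: case_prod_unfold)
      from n.borel_measurable_nn_integral[OF this] show ?thesis by (simp add: case_prod_unfold)
    qed
    have 3: "(\<lambda>w. \<integral>\<^sup>+v. \<integral>\<^sup>+a. F (border n D w v a) \<partial>lborel \<partial>lborel_vec n) \<in> borel_measurable (lborel_vec n)"
      if "D \<in> space (lborel_PiM ?I)" for D
      using measurable_compose[OF measurable_Pair1'[OF that] 2] by simp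
    show ?thesis
      using n.borel_measurable_nn_integral[OF 2] 3
      by (simp add: nn_integral_cmult cong: nn_integral_cong)
  qed
  also have "\<dots> = of_nat (Suc n) * ginibre_integral (Suc n) H"
    using nn_integral_border[OF F] unfolding ginibre_integral_def F_def[symmetric] by simp
  finally show ?thesis unfolding \<alpha>_def c2_def K_def .
qed

section \<open>Gaussian integrals\<close>

text \<open>A disc of radius \<open>sqrt a\<close> has area \<open>pi * a\<close>, so in the
  variable |z|^2 planar Lebesgue measure is \<pi> times Lebesgue measure on the half-line.
  Half-lines \<open>{..a}\<close> determine both measures.\<close>

lemma distr_cmod_square:
  "distr lborel borel (\<lambda>z::complex. (norm z)\<^sup>2) = density lborel (\<lambda>t. ennreal pi * indicator {0..} t)"
proof (rule measure_eqI_generator_eq[where E = "range atMost" and \<Omega> = UNIV and A = "\<lambda>i. {..real i}"])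
  have emb: "emeasure (distr lborel borel (\<lambda>z::complex. (norm z)\<^sup>2)) {..a} = ennreal pi * ennreal (max 0 a)" for a :: real
  proof -
    have "(norm z)\<^sup>2 \<le> a \<longleftrightarrow> a \<ge> 0 \<and> norm z \<le> sqrt a" for z :: complex
      using real_sqrt_le_iff[of "(norm z)\<^sup>2" a] order_trans[OF zero_le_power2[of "norm z"], of a] by auto
    hence "(\<lambda>z::complex. (norm z)\<^sup>2) -` {..a} = (if a \<ge> 0 then cball 0 (sqrt a) else {})"
      by auto
    thus ?thesis
      by (simp add: emeasure_distr emeasure_cball unit_ball_vol_2 ennreal_mult ennreal_neg max_def)
  qed
  have emb': "emeasure (density lborel (\<lambda>t. ennreal pi * indicator {0..} t)) {..a} = ennreal pi * ennreal (max 0 a)" for a :: real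
  proof -
    have "emeasure (density lborel (\<lambda>t. ennreal pi * indicator {0..} t)) {..a}
        = (\<integral>\<^sup>+t. ennreal pi * indicator {0..a} t \<partial>lborel)"
      by (simp add: emeasure_density mult.assoc indicator_inter_arith[symmetric])
        (intro nn_integral_cong; auto simp: indicator_def)
    also have "\<dots> = ennreal pi * emeasure lborel {0..a}"
      by (simp add: nn_integral_cmult)
    finally show ?thesis by (simp add: max_def)
  qed
  show "emeasure (distr lborel borel (\<lambda>z::complex. (norm z)\<^sup>2)) X = emeasure (density lborel (\<lambda>t. ennreal pi * indicator {0..} t)) X"
    if "X \<in> range atMost" for X
    using that emb emb' by auto
  show "emeasure (distr lborel borel (\<lambda>z::complex. (norm z)\<^sup>2)) {..real i} \<noteq> \<infinity>" for i
    unfolding emb by (simp add: ennreal_mult_eq_top_iff)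
  show "Int_stable (range (atMost :: real \<Rightarrow> real set))"
    by (auto simp: Int_stable_def)
  show "(\<Union>i. {..real i}) = UNIV"
    by (auto intro: real_arch_simple)
qed (auto simp: borel_eq_atMost)

lemma nn_integral_cmod_square:
  fixes \<phi> :: "real \<Rightarrow> ennreal"
  assumes [measurable]: "\<phi> \<in> borel_measurable borel"
  shows "(\<integral>\<^sup>+z. \<phi> ((norm (z :: complex))\<^sup>2) \<partial>lborel) = ennreal pi * (\<integral>\<^sup>+t. \<phi> t * indicator {0..} t \<partial>lborel)"
proof -
  have "(\<integral>\<^sup>+z. \<phi> ((norm (z :: complex))\<^sup>2) \<partial>lborel) = (\<integral>\<^sup>+t. \<phi> t \<partial>distr lborel borel (\<lambda>z::complex. (norm z)\<^sup>2))"
    by (rule nn_integral_distr[symmetric]) auto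
  also have "\<dots> = (\<integral>\<^sup>+t. ennreal pi * (\<phi> t * indicator {0..} t) \<partial>lborel)"
    unfolding distr_cmod_square by (subst nn_integral_density) (auto simp: mult_ac)
  also have "\<dots> = ennreal pi * (\<integral>\<^sup>+t. \<phi> t * indicator {0..} t \<partial>lborel)"
    by (rule nn_integral_cmult) auto
  finally show ?thesis .
qed

lemma nn_integral_gaussian_moment:
  "(\<integral>\<^sup>+z. ennreal ((norm (z :: complex)) ^ (2 * k) * exp (- (norm z)\<^sup>2)) \<partial>lborel) = ennreal (pi * fact k)"
proof -
  have "(\<integral>\<^sup>+z. ennreal ((norm (z :: complex)) ^ (2 * k) * exp (- (norm z)\<^sup>2)) \<partial>lborel)
     = ennreal pi * (\<integral>\<^sup>+t. ennreal (t ^ k * exp (- t)) * indicator {0..} t \<partial>lborel)"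
    using nn_integral_cmod_square[of "\<lambda>t. ennreal (t ^ k * exp (- t))"] by (simp add: power_mult)
  also have "(\<integral>\<^sup>+t. ennreal (t ^ k * exp (- t)) * indicator {0..} t \<partial>lborel) = ennreal (fact k)"
    using nn_intergal_power_times_exp_Ici[of k] by (simp add: ennreal_indicator ennreal_mult'' )
  finally show ?thesis by (simp add: ennreal_mult)
qed

lemma nn_integral_gaussian:
  fixes t :: real
  assumes "t > 0"
  shows "(\<integral>\<^sup>+z. ennreal (exp (- t * (norm (z :: complex))\<^sup>2)) \<partial>lborel) = ennreal (pi / t)"
proof -
  let ?c = "of_real (sqrt t) :: complex"
  have "ennreal t * (\<integral>\<^sup>+z. ennreal (exp (- t * (norm (z :: complex))\<^sup>2)) \<partial>lborel) =
     ennreal ((norm ?c)\<^sup>2) * (\<integral>\<^sup>+z. ennreal (exp (- (norm (?c * (z :: complex)))\<^sup>2)) \<partial>lborel)"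
    using assms by (simp add: norm_mult power_mult_distrib)
  also have "\<dots> = (\<integral>\<^sup>+z. ennreal (exp (- (norm (z :: complex))\<^sup>2)) \<partial>lborel)"
    using assms by (intro nn_integral_lborel_complex_mult) auto
  also have "\<dots> = ennreal pi"
    using nn_integral_gaussian_moment[of 0] by simp
  finally have *: "ennreal t * (\<integral>\<^sup>+z. ennreal (exp (- t * (norm (z :: complex))\<^sup>2)) \<partial>lborel) = ennreal pi" .
  have "(\<integral>\<^sup>+z. ennreal (exp (- t * (norm (z :: complex))\<^sup>2)) \<partial>lborel)
    = ennreal (1 / t) * (ennreal t * (\<integral>\<^sup>+z. ennreal (exp (- t * (norm (z :: complex))\<^sup>2)) \<partial>lborel))"
    using assms by (simp add: mult.assoc[symmetric] ennreal_mult[symmetric])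
  thus ?thesis unfolding * using assms by (simp add: ennreal_mult[symmetric])
qed

lemma nn_integral_PiM_gaussian:
  fixes t :: real
  assumes t: "t > 0" and I: "finite I"
  shows "(\<integral>\<^sup>+w. ennreal (exp (- t * (\<Sum>i\<in>I. (norm (w i))\<^sup>2))) \<partial>lborel_PiM I) = ennreal ((pi / t) ^ card I)"
proof -
  have "(\<integral>\<^sup>+w. ennreal (exp (- t * (\<Sum>i\<in>I. (norm (w i))\<^sup>2))) \<partial>lborel_PiM I) =
    (\<integral>\<^sup>+w. (\<Prod>i\<in>I. ennreal (exp (- t * (norm (w i))\<^sup>2))) \<partial>lborel_PiM I)"
    using I by (simp add: prod_ennreal exp_sum[symmetric] sum_distrib_left sum_negf)
  also have "\<dots> = (\<Prod>i\<in>I. \<integral>\<^sup>+z. ennreal (exp (- t * (norm (z :: complex))\<^sup>2)) \<partial>lborel)"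
    using I by (intro lborel_PiM.product_nn_integral_prod) auto
  also have "\<dots> = ennreal ((pi / t) ^ card I)"
    unfolding nn_integral_gaussian[OF t] using t by (simp add: ennreal_power)
  finally show ?thesis .
qed

text \<open>A negative power is written as a Gamma integral, b^-(n+1) = (1 / n!) times the integral
  of t^n exp(-t b) over t > 0, with b = 1 + |u|^2. After swapping the integrals, the Gaussian in
  \<open>u\<close> yields (\<pi> / t)^n, which cancels t^n and leaves the integral of exp(-t), equal
  to 1.\<close>

lemma nn_integral_scale_of:
  "(\<integral>\<^sup>+u. ennreal ((1 / (scale_of n u)\<^sup>2) ^ Suc n) \<partial>lborel_vec n) = ennreal (pi ^ n / fact n)"
proof -
  interpret n: sigma_finite_measure "lborel_vec n"
    by (rule lborel_PiM.sigma_finite) simp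
  interpret p: pair_sigma_finite "lborel_vec n" "lborel :: real measure" ..
  let ?s = "\<lambda>u. \<Sum>i<n. (norm (u i :: complex))\<^sup>2"
  define g where "g u t = ennreal (t ^ n * exp (- t * (1 + ?s u)) / fact n) * indicator {0<..} t" for u t
  have ms: "?s \<in> borel_measurable (lborel_vec n)"
    by (intro borel_measurable_sum borel_measurable_power measurable_compose[OF measurable_lborel_PiM_coord borel_measurable_norm]) auto
  have m: "(\<lambda>(u, t). g u t) \<in> borel_measurable (lborel_vec n \<Otimes>\<^sub>M (lborel :: real measure))"
  proof -
    note [measurable] = measurable_compose[OF measurable_fst ms]
    show ?thesis unfolding g_def case_prod_unfold by measurable
  qed
  have "(\<integral>\<^sup>+u. ennreal ((1 / (scale_of n u)\<^sup>2) ^ Suc n) \<partial>lborel_vec n) = (\<integral>\<^sup>+u. \<integral>\<^sup>+t. g u t \<partial>lborel \<partial>lborel_vec n)"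
  proof (rule nn_integral_cong)
    fix u :: "nat \<Rightarrow> complex"
    define b where "b = 1 + ?s u"
    have b: "b > 0" unfolding b_def by (intro add_pos_nonneg sum_nonneg) auto
    interpret e: prob_space "density lborel (erlang_density n b)"
      using b by (rule prob_space_erlang_density)
    have "(\<integral>\<^sup>+t. ennreal (erlang_density n b t) \<partial>lborel) = 1"
      using e.emeasure_space_1 by (simp add: emeasure_density)
    have "(\<integral>\<^sup>+t. g u t \<partial>lborel) = (\<integral>\<^sup>+t. ennreal (1 / b ^ Suc n) * ennreal (erlang_density n b t) \<partial>lborel)"
    \<comment> \<open>The indicator in \<open>g\<close> is 0 at \<open>t = 0\<close>, where the
      Erlang density is positive if \<open>n = 0\<close>; this one point is discarded.\<close>
    proof (rule nn_integral_cong_AE, rule AE_mp[OF AE_lborel_singleton[of 0]], intro AE_I2 impI)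
      fix t :: real assume "t \<noteq> 0"
      have "t ^ n * exp (- t * b) / fact n = (1 / b ^ Suc n) * (b ^ Suc n * t ^ n * exp (- b * t) / fact n)"
        using b by (simp add: mult.commute)
      thus "g u t = ennreal (1 / b ^ Suc n) * ennreal (erlang_density n b t)"
        using b \<open>t \<noteq> 0\<close> unfolding g_def b_def[symmetric] erlang_density_def
        by (cases "t > 0") (auto simp: ennreal_mult'[symmetric] simp del: power_Suc)
    qed
    also have "\<dots> = ennreal (1 / b ^ Suc n)"
      using \<open>(\<integral>\<^sup>+t. ennreal (erlang_density n b t) \<partial>lborel) = 1\<close> by (simp add: nn_integral_cmult)
    finally show "ennreal ((1 / (scale_of n u)\<^sup>2) ^ Suc n) = (\<integral>\<^sup>+t. g u t \<partial>lborel)"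
      unfolding scale_of_square b_def by (simp add: power_divide power_one_over)
  qed
  also have "\<dots> = (\<integral>\<^sup>+t. \<integral>\<^sup>+u. g u t \<partial>lborel_vec n \<partial>lborel)"
    using p.Fubini'[OF m] by simp
  also have "\<dots> = (\<integral>\<^sup>+t. ennreal (pi ^ n / fact n) * (ennreal (t ^ 0 * exp (- t)) * indicator {0..} t) \<partial>lborel)"
  proof (rule nn_integral_cong_AE, rule AE_mp[OF AE_lborel_singleton[of 0]], intro AE_I2 impI)
    fix t :: real assume t0: "t \<noteq> 0"
    show "(\<integral>\<^sup>+u. g u t \<partial>lborel_vec n) = ennreal (pi ^ n / fact n) * (ennreal (t ^ 0 * exp (- t)) * indicator {0..} t)"
    proof (cases "t > 0")
      case True
      have "g u t = ennreal (t ^ n * exp (- t) / fact n) * ennreal (exp (- t * ?s u))" for u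
        using True by (simp add: g_def ennreal_mult[symmetric] exp_add[symmetric] algebra_simps)
      hence "(\<integral>\<^sup>+u. g u t \<partial>lborel_vec n) = ennreal (t ^ n * exp (- t) / fact n) * (\<integral>\<^sup>+u. ennreal (exp (- t * ?s u)) \<partial>lborel_vec n)"
        using ms by (simp add: nn_integral_cmult)
      also have "\<dots> = ennreal (t ^ n * exp (- t) / fact n) * ennreal ((pi / t) ^ n)"
        using nn_integral_PiM_gaussian[OF True, of "{..<n}"] by simp
      also have "\<dots> = ennreal (t ^ n * exp (- t) / fact n * (pi / t) ^ n)"
        using True by (intro ennreal_mult[symmetric]) auto
      also have "t ^ n * exp (- t) / fact n * (pi / t) ^ n = pi ^ n / fact n * exp (- t)"
        using True by (simp add: power_divide)
      finally show ?thesis using True by (simp add: ennreal_mult[symmetric])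
    next
      case False
      with t0 show ?thesis by (simp add: g_def)
    qed
  qed
  also have "\<dots> = ennreal (pi ^ n / fact n) * (\<integral>\<^sup>+t. ennreal (t ^ 0 * exp (- t)) * indicator {0..} t \<partial>lborel)"
    by (rule nn_integral_cmult) auto
  also have "(\<integral>\<^sup>+t. ennreal (t ^ 0 * exp (- t)) * indicator {0..} t \<partial>lborel) = ennreal (fact 0)"
    using nn_intergal_power_times_exp_Ici[of 0] by (simp add: ennreal_indicator ennreal_mult'' )
  finally show ?thesis by simp
qed

section \<open>The eigenvalue density\<close>

definition vandermonde_square :: "nat \<Rightarrow> (nat \<Rightarrow> complex) \<Rightarrow> real" where
  "vandermonde_square n x = (\<Prod>j<n. \<Prod>i<j. (norm (x j - x i))\<^sup>2)"

text \<open>The counterpart of \<open>ginibre_integral\<close> on the eigenvalue side: the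
  unnormalised joint density for \<open>L = 0\<close>, tested on the monic polynomial with the given
  roots.\<close>

definition eigenvalue_integral :: "nat \<Rightarrow> (complex poly \<Rightarrow> ennreal) \<Rightarrow> ennreal" where
  "eigenvalue_integral n H = (\<integral>\<^sup>+x. H (\<Prod>i<n. [:- x i, 1:]) *
     ennreal (vandermonde_square n x * exp (- (\<Sum>i<n. (norm (x i))\<^sup>2))) \<partial>lborel_vec n)"

lemma measurable_vandermonde_square:
  assumes "\<And>i. i < n \<Longrightarrow> (\<lambda>\<omega>. x \<omega> i) \<in> borel_measurable M"
  shows "(\<lambda>\<omega>. vandermonde_square n (x \<omega>)) \<in> borel_measurable M"
  unfolding vandermonde_square_def
  by (intro borel_measurable_prod borel_measurable_power measurable_compose[OF _ borel_measurable_norm]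
      borel_measurable_diff assms) auto

lemma measurable_sum_norm_square:
  fixes x :: "'a \<Rightarrow> nat \<Rightarrow> complex"
  assumes "\<And>i. i < n \<Longrightarrow> (\<lambda>\<omega>. x \<omega> i) \<in> borel_measurable M"
  shows "(\<lambda>\<omega>. \<Sum>i<n. (norm (x \<omega> i))\<^sup>2) \<in> borel_measurable M"
  by (intro borel_measurable_sum borel_measurable_power measurable_compose[OF _ borel_measurable_norm] assms) auto

lemma measurable_eigenvalue_weight:
  assumes x: "\<And>i. i < n \<Longrightarrow> (\<lambda>\<omega>. x \<omega> i) \<in> borel_measurable M"
  shows "(\<lambda>\<omega>. ennreal (vandermonde_square n (x \<omega>) * exp (- (\<Sum>i<n. (norm (x \<omega> i))\<^sup>2)))) \<in> borel_measurable M"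
proof -
  note measurable_vandermonde_square[OF x, measurable] measurable_sum_norm_square[OF x, measurable]
  show ?thesis by measurable
qed

lemma poly_prod_linear:
  fixes x :: "nat \<Rightarrow> complex"
  shows "poly (\<Prod>i<n. [:- x i, 1:]) z = (\<Prod>i<n. z - x i)"
  by (simp add: poly_prod uminus_add_conv_diff)

lemma measurable_prod_linear:
  fixes x :: "'a \<Rightarrow> nat \<Rightarrow> complex"
  assumes "\<And>i. i < n \<Longrightarrow> (\<lambda>\<omega>. x \<omega> i) \<in> borel_measurable M"
  shows "(\<lambda>\<omega>. \<Prod>i<n. [:- x \<omega> i, 1:]) \<in> M \<rightarrow>\<^sub>M poly_space"
  by (rule measurable_poly_spaceI, unfold poly_prod_linear)
    (intro borel_measurable_prod borel_measurable_diff borel_measurable_const assms; simp)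

text \<open>The Vandermonde factors that involve the last variable \<open>l\<close> multiply to
  |p(l)|^2, where \<open>p\<close> has the remaining variables as roots. This is the recursion
  through \<open>conditioned\<close> known from the matrix side, here with equality.\<close>

lemma eigenvalue_integral_Suc:
  assumes H: "H \<in> borel_measurable poly_space"
  shows "eigenvalue_integral (Suc n) H =
    (\<integral>\<^sup>+l. ennreal (exp (- (norm l)\<^sup>2)) * eigenvalue_integral n (conditioned l H) \<partial>lborel)"
    and "(\<lambda>l. ennreal (exp (- (norm l)\<^sup>2)) * eigenvalue_integral n (conditioned l H)) \<in> borel_measurable borel"
proof -
  let ?L = "lborel :: complex measure"
  let ?N = "?L \<Otimes>\<^sub>M lborel_vec n"
  have sn: "sigma_finite_measure (lborel_vec n)"
    by (rule lborel_PiM.sigma_finite) simp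
  let ?f = "\<lambda>n x. H (\<Prod>i<n. [:- x i, 1:]) * ennreal (vandermonde_square n x * exp (- (\<Sum>i<n. (norm (x i))\<^sup>2)))"
  have m: "?f (Suc n) \<in> borel_measurable (lborel_vec (Suc n))"
    by (intro borel_measurable_times_ennreal measurable_compose[OF measurable_prod_linear H]
        measurable_eigenvalue_weight measurable_lborel_PiM_coord) auto
  have eq: "?f (Suc n) (x(n := l)) = ennreal (exp (- (norm l)\<^sup>2)) *
      (conditioned l H (\<Prod>i<n. [:- x i, 1:]) * ennreal (vandermonde_square n x * exp (- (\<Sum>i<n. (norm (x i))\<^sup>2))))" for x l
  proof -
    have "(\<Prod>i<Suc n. [:- (x(n := l)) i, 1:]) = [:- l, 1:] * (\<Prod>i<n. [:- x i, 1:])"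
      by (simp only: prod.lessThan_Suc fun_upd_same mult.commute) (intro arg_cong2[of _ _ _ _ "(*)"] refl prod.cong; simp)
    moreover have "vandermonde_square (Suc n) (x(n := l)) = vandermonde_square n x * (norm (poly (\<Prod>i<n. [:- x i, 1:]) l))\<^sup>2"
      unfolding poly_prod_linear
      by (simp add: vandermonde_square_def prod_norm[symmetric] prod_power_distrib)
    moreover have "(\<Sum>i<Suc n. (norm ((x(n := l)) i))\<^sup>2) = (\<Sum>i<n. (norm (x i))\<^sup>2) + (norm l)\<^sup>2"
      by simp
    moreover have "vandermonde_square n x \<ge> 0"
      by (auto simp: vandermonde_square_def intro!: prod_nonneg)
    ultimately show ?thesis
      by (simp only: conditioned_def minus_add_distrib exp_add)
        (simp add: ennreal_mult mult_ac del: prod.lessThan_Suc mult_pCons_left)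
  qed
  have "eigenvalue_integral (Suc n) H = (\<integral>\<^sup>+l. \<integral>\<^sup>+x. ?f (Suc n) (x(n := l)) \<partial>lborel_vec n \<partial>lborel)"
    unfolding eigenvalue_integral_def using m unfolding lessThan_Suc
    by (intro lborel_PiM.product_nn_integral_insert_rev) auto
  also have "\<dots> = (\<integral>\<^sup>+l. ennreal (exp (- (norm l)\<^sup>2)) * eigenvalue_integral n (conditioned l H) \<partial>lborel)"
  proof (rule nn_integral_cong)
    fix l :: complex
    have "conditioned l H \<in> borel_measurable poly_space"
      by (rule measurable_conditioned[OF H]) (auto intro: measurable_ident)
    hence "(\<lambda>x. conditioned l H (\<Prod>i<n. [:- x i, 1:]) *
       ennreal (vandermonde_square n x * exp (- (\<Sum>i<n. (norm (x i))\<^sup>2)))) \<in> borel_measurable (lborel_vec n)"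
      by (intro borel_measurable_times_ennreal measurable_compose[OF measurable_prod_linear]
        measurable_eigenvalue_weight measurable_lborel_PiM_coord) auto
    thus "(\<integral>\<^sup>+x. ?f (Suc n) (x(n := l)) \<partial>lborel_vec n) =
      ennreal (exp (- (norm l)\<^sup>2)) * eigenvalue_integral n (conditioned l H)"
      unfolding eq eigenvalue_integral_def by (rule nn_integral_cmult)
  qed
  finally show "eigenvalue_integral (Suc n) H =
    (\<integral>\<^sup>+l. ennreal (exp (- (norm l)\<^sup>2)) * eigenvalue_integral n (conditioned l H) \<partial>lborel)" .
  have fst_m: "fst \<in> borel_measurable ?N"
    using measurable_fst[of ?L "lborel_vec n"] by (simp add: measurable_lborel1[symmetric] del: measurable_lborel1)
  have coord: "(\<lambda>x. snd x i) \<in> borel_measurable ?N" if "i < n" for i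
    using that by (intro measurable_lborel_PiM_component[OF _ measurable_snd]) simp
  have "(\<lambda>x. conditioned (fst x) H (\<Prod>i<n. [:- snd x i, 1:]) *
      ennreal (vandermonde_square n (snd x) * exp (- (\<Sum>i<n. (norm (snd x i))\<^sup>2)))) \<in> borel_measurable ?N"
  proof (intro borel_measurable_times_ennreal measurable_conditioned H measurable_prod_linear measurable_eigenvalue_weight coord fst_m)
    show "(\<lambda>x. poly (\<Prod>i<n. [:- snd x i, 1:]) (fst x)) \<in> borel_measurable ?N"
      unfolding poly_prod_linear by (intro borel_measurable_prod borel_measurable_diff fst_m coord) simp
  qed
  hence "(\<lambda>(l, x). conditioned l H (\<Prod>i<n. [:- x i, 1:]) *
      ennreal (vandermonde_square n x * exp (- (\<Sum>i<n. (norm (x i))\<^sup>2)))) \<in> borel_measurable ?N"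
    by (simp add: case_prod_unfold)
  from sigma_finite_measure.borel_measurable_nn_integral[OF sn this]
  have "(\<lambda>l. eigenvalue_integral n (conditioned l H)) \<in> borel_measurable borel"
    unfolding eigenvalue_integral_def by simp
  note [measurable] = this
  show "(\<lambda>l. ennreal (exp (- (norm l)\<^sup>2)) * eigenvalue_integral n (conditioned l H)) \<in> borel_measurable borel"
    by measurable
qed

text \<open>The factor at \<open>m\<close> collects the constants of one deflation step:
  \<open>pi ^ m / fact m\<close> from the eigenvector, \<open>pi ^ m\<close> from the Gaussian row,
  and \<open>1 / (m + 1)\<close> from the multiplicity.\<close>

definition ginibre_constant :: "nat \<Rightarrow> real" where
  "ginibre_constant n = (\<Prod>m<n. pi ^ (2 * m) / fact (Suc m))"

lemma ginibre_constant_pos: "ginibre_constant n > 0"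
  unfolding ginibre_constant_def by (intro prod_pos) auto

text \<open>Both functionals satisfy a recursion through \<open>conditioned l H\<close>, so the
  induction has to run over all \<open>H\<close> at once.\<close>

lemma eigenvalue_integral_le:
  assumes "H \<in> borel_measurable poly_space"
  shows "ennreal (ginibre_constant n) * eigenvalue_integral n H \<le> ginibre_integral n H"
  using assms
proof (induction n arbitrary: H)
  case 0
  have "char_poly (fmat 0 x) = 1" for x
    by (simp add: char_poly_def)
  thus ?case
    by (simp add: ginibre_constant_def eigenvalue_integral_def ginibre_integral_def frob_square_def vandermonde_square_def PiM_empty)
next
  case (Suc n)
  define c where "c = pi ^ (2 * n) / fact (Suc n)"
  have c: "c > 0" by (simp add: c_def)
  let ?e = "\<lambda>l :: complex. ennreal (exp (- (norm l)\<^sup>2))"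
  have m: "conditioned l H \<in> borel_measurable poly_space" for l
    by (rule measurable_conditioned[OF Suc.prems]) (auto intro: measurable_ident)
  have "ennreal (ginibre_constant (Suc n)) * eigenvalue_integral (Suc n) H =
    ennreal c * (ennreal (ginibre_constant n) * (\<integral>\<^sup>+l. ?e l * eigenvalue_integral n (conditioned l H) \<partial>lborel))"
  proof -
    have "ginibre_constant (Suc n) = c * ginibre_constant n"
      by (simp add: ginibre_constant_def c_def mult.commute)
    thus ?thesis
      using c ginibre_constant_pos[of n] unfolding eigenvalue_integral_Suc(1)[OF Suc.prems]
      by (simp add: ennreal_mult less_imp_le mult.assoc)
  qed
  also have "ennreal (ginibre_constant n) * (\<integral>\<^sup>+l. ?e l * eigenvalue_integral n (conditioned l H) \<partial>lborel)
      = (\<integral>\<^sup>+l. ennreal (ginibre_constant n) * (?e l * eigenvalue_integral n (conditioned l H)) \<partial>lborel)"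
    using eigenvalue_integral_Suc(2)[OF Suc.prems] by (intro nn_integral_cmult[symmetric]) simp
  also have "\<dots> = (\<integral>\<^sup>+l. ?e l * (ennreal (ginibre_constant n) * eigenvalue_integral n (conditioned l H)) \<partial>lborel)"
    by (simp only: mult.left_commute)
  also have "\<dots> \<le> (\<integral>\<^sup>+l. ?e l * ginibre_integral n (conditioned l H) \<partial>lborel)"
    by (intro nn_integral_mono mult_left_mono Suc.IH m) auto
  also have "ennreal c * \<dots> = ennreal (1 / real (Suc n)) * (ennreal (pi ^ n / fact n) * ennreal (pi ^ n) * \<dots>)"
  proof -
    have "ennreal c = ennreal (1 / real (Suc n)) * (ennreal (pi ^ n / fact n) * ennreal (pi ^ n))"
      by (simp add: c_def ennreal_mult[symmetric] power_add[symmetric] mult_2)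
    thus ?thesis by (simp add: mult.assoc)
  qed
  also have "\<dots> \<le> ennreal (1 / real (Suc n)) * (of_nat (Suc n) * ginibre_integral (Suc n) H)"
    using ginibre_integral_Suc_ge[OF Suc.prems, of n] nn_integral_PiM_gaussian[of 1 "{..<n}"]
    unfolding nn_integral_scale_of by (intro mult_left_mono) auto
  also have "\<dots> = ginibre_integral (Suc n) H"
  proof -
    have "ennreal (1 / real (Suc n)) * of_nat (Suc n) = 1"
      by (simp add: ennreal_of_nat_eq_real_of_nat ennreal_mult[symmetric] del: of_nat_Suc)
    thus ?thesis by (simp add: mult.assoc[symmetric] del: of_nat_Suc)
  qed
  finally show ?case by (simp add: mult_left_mono)
qed

section \<open>Radial weights\<close>

text \<open>With the last point as a variable \<open>z\<close>, the determinant is a polynomial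
  \<open>f\<close> of degree at most \<open>n\<close> that vanishes at the earlier points and whose
  coefficient at degree \<open>n\<close> is the smaller determinant. For distinct earlier points
  this determines \<open>f\<close>; if two of them coincide, both sides are 0.\<close>

lemma det_vandermonde:
  fixes x :: "nat \<Rightarrow> 'a::{field,ring_char_0}"
  shows "Determinant.det (Matrix.mat n n (\<lambda>(i, j). x i ^ j)) = (\<Prod>j<n. \<Prod>i<j. x j - x i)"
proof (induction n)
  case (Suc n)
  let ?V = "\<lambda>z. Matrix.mat (Suc n) (Suc n) (\<lambda>(i, j). (if i < n then x i else z) ^ j)"
  define c where "c j = cofactor (?V 0) n j" for j
  define f where "f = (\<Sum>j<Suc n. monom (c j) j)"
  have f: "poly f z = Determinant.det (?V z)" for z
  proof -
    have "Determinant.det (?V z) = (\<Sum>j<Suc n. ?V z $$ (n, j) * cofactor (?V z) n j)"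
      by (rule laplace_expansion_row) auto
    also have "\<dots> = (\<Sum>j<Suc n. c j * z ^ j)"
    proof (rule sum.cong)
      fix j assume "j \<in> {..<Suc n}"
      moreover have "mat_delete (?V z) n j = mat_delete (?V 0) n j"
        by (rule eq_matI) (auto simp: mat_delete_def)
      ultimately show "?V z $$ (n, j) * cofactor (?V z) n j = c j * z ^ j"
        by (simp add: c_def cofactor_def)
    qed simp
    finally show ?thesis by (simp add: f_def poly_sum poly_monom)
  qed
  have cn: "c n = (\<Prod>j<n. \<Prod>i<j. x j - x i)"
  proof -
    have "mat_delete (?V 0) n n = Matrix.mat n n (\<lambda>(i, j). x i ^ j)"
      by (rule eq_matI) (auto simp: mat_delete_def)
    thus ?thesis by (simp add: c_def cofactor_def Suc.IH mult_2[symmetric])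
  qed
  have root: "poly f (x i) = 0" if "i < n" for i
    unfolding f
  proof (rule det_identical_rows[of _ "Suc n" i n])
    show "row (?V (x i)) i = row (?V (x i)) n"
      using that by (intro eq_vecI) auto
  qed (use that in auto)
  have "Matrix.mat (Suc n) (Suc n) (\<lambda>(i, j). x i ^ j) = ?V (x n)"
    by (rule eq_matI) (auto simp: less_Suc_eq)
  hence goal: "Determinant.det (Matrix.mat (Suc n) (Suc n) (\<lambda>(i, j). x i ^ j)) = poly f (x n)"
    by (simp only: f)
  show ?case
  proof (cases "inj_on x {..<n}")
    case False
    then obtain i j where ij: "i < n" "j < n" "i \<noteq> j" "x i = x j" by (auto simp: inj_on_def)
    have "Determinant.det (?V (x n)) = 0"
    proof (rule det_identical_rows[of _ "Suc n" i j])
      show "row (?V (x n)) i = row (?V (x n)) j"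
        using ij by (intro eq_vecI) auto
    qed (use ij in auto)
    moreover have "(\<Prod>j<n. \<Prod>i<j. x j - x i) = 0"
    proof -
      obtain a b where "a < b" "b < n" "x a = x b"
        using ij by (cases "i < j") (auto simp: not_less_iff_gr_or_eq)
      hence h: "(\<Prod>i<b. x b - x i) = 0" by (intro prod_zero bexI[of _ a]) auto
      show ?thesis
        by (rule prod_zero[OF finite_lessThan], rule bexI[of _ b], rule h) (use \<open>b < n\<close> in simp)
    qed
    ultimately show ?thesis using goal f by simp
  next
    case True
    define g where "g = Polynomial.smult (c n) (\<Prod>i<n. [:- x i, 1:])"
    have degp: "degree (\<Prod>i<n. [:- x i, 1:]) = n" and lead: "coeff (\<Prod>i<n. [:- x i, 1:]) n = 1"
    proof -
      show "degree (\<Prod>i<n. [:- x i, 1:]) = n"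
        by (subst degree_prod_eq_sum_degree) auto
      moreover have "lead_coeff (\<Prod>i<n. [:- x i, 1:]) = 1"
        by (simp add: lead_coeff_prod)
      ultimately show "coeff (\<Prod>i<n. [:- x i, 1:]) n = 1" by simp
    qed
    \<comment> \<open>The coefficients at degree \<open>n\<close> cancel, so a nonzero difference
      would have degree below \<open>n\<close> and yet \<open>n\<close> distinct roots.\<close>
    have "f - g = 0"
    proof (rule ccontr)
      assume ne: "f - g \<noteq> 0"
      have "degree f \<le> n"
        unfolding f_def by (rule degree_sum_le) (auto intro: order_trans[OF degree_monom_le])
      moreover have "degree g \<le> n" unfolding g_def using degree_smult_le[of "c n" "\<Prod>i<n. [:- x i, 1:]"] degp by simp
      ultimately have d: "degree (f - g) \<le> n" by (rule degree_diff_le)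
      have "coeff f n = c n"
        by (simp add: f_def coeff_sum)
      hence "coeff (f - g) n = 0" by (simp add: g_def lead)
      hence dn: "degree (f - g) < n"
        using d ne by (metis le_neq_implies_less leading_coeff_0_iff)
      have "x ` {..<n} \<subseteq> {z. poly (f - g) z = 0}"
        using root by (auto simp: g_def poly_prod intro!: bexI)
      hence "card (x ` {..<n}) \<le> card {z. poly (f - g) z = 0}"
        by (intro card_mono poly_roots_finite ne)
      also have "\<dots> \<le> degree (f - g)" by (rule card_poly_roots_bound[OF ne])
      finally show False using dn card_image[OF True] by simp
    qed
    hence "poly f (x n) = c n * (\<Prod>i<n. x n - x i)"
      by (auto simp: g_def poly_prod intro!: prod.cong)
    thus ?thesis using goal cn by simp
  qed
qed simp

lemma vandermonde_expansion:
  fixes x :: "nat \<Rightarrow> complex"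
  shows "(\<Prod>j<n. \<Prod>i<j. x j - x i) = (\<Sum>p | p permutes {..<n}. of_int (sign p) * (\<Prod>i<n. x i ^ p i))"
proof -
  have "(\<Prod>j<n. \<Prod>i<j. x j - x i) = Determinant.det (Matrix.mat n n (\<lambda>(i, j). x i ^ j))"
    by (rule det_vandermonde[symmetric])
  also have "\<dots> = (\<Sum>p | p permutes {0..<n}. signof p * (\<Prod>i = 0..<n. x i ^ p i))"
    unfolding Determinant.det_def by (auto intro!: sum.cong prod.cong simp: permutes_in_image)
  finally show ?thesis by (simp add: atLeast0LessThan sign_def)
qed


section \<open>Orthogonality of monomials under radial weights\<close>

lemma distr_lborel_rotation:
  fixes c :: complex
  assumes "norm c = 1"
  shows "distr lborel borel ((*) c) = lborel"
proof (rule measure_eqI)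
  fix X assume "X \<in> sets (distr lborel borel ((*) c))"
  hence X[measurable]: "X \<in> sets borel" by simp
  have "c \<noteq> 0" using assms by auto
  have "emeasure (distr lborel borel ((*) c)) X = (\<integral>\<^sup>+z. indicator X z \<partial>distr lborel borel ((*) c))"
    by (subst nn_integral_indicator) auto
  also have "\<dots> = (\<integral>\<^sup>+z. indicator X (c * z) \<partial>lborel)"
    by (rule nn_integral_distr) auto
  also have "\<dots> = emeasure lborel X"
    using nn_integral_lborel_complex_mult[of "indicator X" c] assms \<open>c \<noteq> 0\<close> by simp
  finally show "emeasure (distr lborel borel ((*) c)) X = emeasure lborel X" .
qed simp

text \<open>A rotation that changes the sign of the integrand preserves Lebesgue measure, so the
  integral equals its own negative. This replaces polar coordinates.\<close>

lemma integral_angular_orthogonal: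
  fixes \<phi> :: "complex \<Rightarrow> real"
  assumes [measurable]: "\<phi> \<in> borel_measurable borel"
    and rot: "\<And>c z. norm c = 1 \<Longrightarrow> \<phi> (c * z) = \<phi> z" and ab: "a \<noteq> b"
  shows "(\<integral>z. z ^ a * cnj z ^ b * of_real (\<phi> z) \<partial>lborel) = 0"
proof -
  define F where "F z = z ^ a * cnj z ^ b * of_real (\<phi> z)" for z
  have [measurable]: "F \<in> borel_measurable borel"
  proof -
    have [measurable]: "cnj \<in> borel_measurable borel"
      by (intro borel_measurable_continuous_onI continuous_intros)
    show ?thesis unfolding F_def[abs_def] by measurable
  qed
  \<comment> \<open>Rotation by \<theta> multiplies \<open>z ^ a * cnj z ^ b\<close> by
    \<open>cis ((a - b) * \<theta>)\<close>, which is -1 for this angle.\<close>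
  define \<theta> where "\<theta> = pi / (real a - real b)"
  define c where "c = cis \<theta>"
  have nc: "norm c = 1" by (simp add: c_def)
  have "c ^ a * cnj c ^ b = cis (real a * \<theta> - real b * \<theta>)"
  proof -
    have "c ^ a = cis (real a * \<theta>)" "cnj c ^ b = cis (real b * - \<theta>)"
      unfolding c_def cis_cnj by (rule Complex.DeMoivre)+
    thus ?thesis by (simp only: cis_mult mult_minus_right diff_conv_add_uminus)
  qed
  also have "real a * \<theta> - real b * \<theta> = (real a - real b) * \<theta>"
    by (simp only: left_diff_distrib)
  also have "\<dots> = pi"
    using ab by (simp add: \<theta>_def)
  finally have cc: "c ^ a * cnj c ^ b = - 1" by simp
  have "F (c * z) = - F z" for z
  proof -
    have "F (c * z) = (c ^ a * cnj c ^ b) * F z"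
      unfolding F_def rot[OF nc] by (simp add: power_mult_distrib mult_ac)
    thus ?thesis by (simp add: cc)
  qed
  hence "(\<integral>z. F z \<partial>lborel) = - (\<integral>z. F z \<partial>lborel)"
    using integral_distr[of "(*) c" lborel borel F] distr_lborel_rotation[OF nc] by simp
  thus ?thesis unfolding F_def by simp
qed

text \<open>The squared Vandermonde modulus is V times its conjugate, each a signed sum over
  permutations. In the term for \<open>p\<close> and \<open>q\<close> the integral over coordinate
  \<open>i\<close> vanishes unless \<open>p i = q i\<close>, so only \<open>p = q\<close> survives:
  \<open>fact n\<close> terms, each equal to the product of all the moments.\<close>

lemma nn_integral_vandermonde_radial:
  fixes \<phi> :: "complex \<Rightarrow> real"
  assumes \<phi>[measurable]: "\<phi> \<in> borel_measurable borel" and nonneg: "\<And>z. \<phi> z \<ge> 0"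
    and rot: "\<And>c z. norm c = 1 \<Longrightarrow> \<phi> (c * z) = \<phi> z"
    and int: "\<And>k. integrable lborel (\<lambda>z. norm z ^ k * \<phi> z)"
  shows "(\<integral>\<^sup>+x. ennreal ((\<Prod>j<n. \<Prod>i<j. (norm (x j - x i))\<^sup>2) * (\<Prod>i<n. \<phi> (x i))) \<partial>lborel_vec n)
    = ennreal (fact n * (\<Prod>k<n. \<integral>z. norm z ^ (2 * k) * \<phi> z \<partial>lborel))"
proof -
  let ?M = "lborel_vec n"
  let ?S = "{p. p permutes {..<n}}"
  have fS: "finite ?S" by (simp add: finite_permutations)
  have mcnj[measurable]: "cnj \<in> borel_measurable borel"
    by (intro borel_measurable_continuous_onI continuous_intros)
  define m where "m k = (\<integral>z. norm z ^ (2 * k) * \<phi> z \<partial>lborel)" for k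
  define h where "h a b = (\<lambda>z. z ^ a * cnj z ^ b * complex_of_real (\<phi> z))" for a b
  have mh[measurable]: "h a b \<in> borel_measurable borel" for a b
    unfolding h_def by measurable
  have ih: "integrable lborel (h a b)" for a b
    by (rule Bochner_Integration.integrable_bound[OF int[of "a + b"]])
      (auto simp: h_def norm_mult norm_power power_add nonneg abs_mult intro!: AE_I2)
  have hh: "(\<integral>z. h a b z \<partial>lborel) = (if a = b then of_real (m a) else 0)" for a b
  proof (cases "a = b")
    case True
    have "h a a z = of_real (norm z ^ (2 * a) * \<phi> z)" for z
    proof -
      have "z ^ a * cnj z ^ a = of_real (norm z ^ (2 * a))"
        by (simp only: power_mult_distrib[symmetric] power_mult of_real_power complex_norm_square[symmetric])
      thus ?thesis by (simp add: h_def)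
    qed
    thus ?thesis using True by (simp add: m_def del: of_real_mult of_real_power)
  next
    case False
    thus ?thesis using integral_angular_orthogonal[OF \<phi> rot False] by (simp add: h_def)
  qed
  define f where "f x = (\<Prod>j<n. \<Prod>i<j. (norm (x j - x i))\<^sup>2) * (\<Prod>i<n. \<phi> (x i))" for x :: "nat \<Rightarrow> complex"
  have f0: "f x \<ge> 0" for x
    unfolding f_def by (intro mult_nonneg_nonneg prod_nonneg) (auto simp: nonneg)
  let ?t = "\<lambda>p q x. of_int (sign p) * of_int (sign q) * (\<Prod>i<n. h (p i) (q i) (x i))"
  have fexp: "complex_of_real (f x) = (\<Sum>p\<in>?S. \<Sum>q\<in>?S. ?t p q x)" for x
  proof -
    define V where "V = (\<Prod>j<n. \<Prod>i<j. x j - x i)"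
    have "complex_of_real (\<Prod>j<n. \<Prod>i<j. (norm (x j - x i))\<^sup>2) = V * cnj V"
      by (simp add: V_def complex_norm_square prod.distrib del: of_real_power)
    also have "\<dots> = (\<Sum>p\<in>?S. of_int (sign p) * (\<Prod>i<n. x i ^ p i)) * (\<Sum>q\<in>?S. of_int (sign q) * (\<Prod>i<n. cnj (x i) ^ q i))"
      unfolding V_def vandermonde_expansion by simp
    finally have "complex_of_real (f x) = (\<Sum>p\<in>?S. of_int (sign p) * (\<Prod>i<n. x i ^ p i)) *
        (\<Sum>q\<in>?S. of_int (sign q) * (\<Prod>i<n. cnj (x i) ^ q i)) * (\<Prod>i<n. complex_of_real (\<phi> (x i)))"
      unfolding f_def of_real_mult by (simp only: of_real_prod)
    also have "\<dots> = (\<Sum>p\<in>?S. \<Sum>q\<in>?S. ?t p q x)"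
      unfolding sum_product unfolding sum_distrib_right
      by (intro sum.cong refl) (simp add: h_def prod.distrib mult_ac)
    finally show ?thesis .
  qed
  have it: "integrable ?M (\<lambda>x. \<Prod>i<n. h (p i) (q i) (x i))" for p q :: "nat \<Rightarrow> nat"
    by (intro lborel_PiM.product_integrable_prod ih) auto
  have ip: "(\<integral>x. (\<Prod>i<n. h (p i) (q i) (x i)) \<partial>?M) = (\<Prod>i<n. \<integral>z. h (p i) (q i) z \<partial>lborel)" for p q :: "nat \<Rightarrow> nat"
    by (intro lborel_PiM.product_integral_prod ih) auto
  have iif: "integrable ?M (\<lambda>x. complex_of_real (f x))"
    unfolding fexp by (intro Bochner_Integration.integrable_sum integrable_mult_right it)
  have "(\<integral>x. complex_of_real (f x) \<partial>?M) = (\<Sum>p\<in>?S. \<Sum>q\<in>?S. of_int (sign p) * of_int (sign q) * (\<Prod>i<n. \<integral>z. h (p i) (q i) z \<partial>lborel))"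
    unfolding fexp
    by (subst Bochner_Integration.integral_sum; (intro Bochner_Integration.integrable_sum integrable_mult_right it)?)
      (subst Bochner_Integration.integral_sum; (intro integrable_mult_right it)?;
       simp add: ip)
  also have "\<dots> = (\<Sum>p\<in>?S. \<Sum>q\<in>?S. if q = p then of_real (\<Prod>k<n. m k) else 0)"
  proof (intro sum.cong refl)
    fix p q assume p: "p \<in> ?S" and q: "q \<in> ?S"
    show "of_int (sign p) * of_int (sign q) * (\<Prod>i<n. \<integral>z. h (p i) (q i) z \<partial>lborel) = (if q = p then complex_of_real (\<Prod>k<n. m k) else 0)"
    proof (cases "q = p")
      case True
      have "of_int (sign p) * of_int (sign p) = (1 :: complex)"
        by (simp add: sign_def)
      moreover have "(\<Prod>i<n. m (p i)) = (\<Prod>k<n. m k)"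
        using prod.permute[of p "{..<n}" m] p by (simp add: comp_def)
      ultimately show ?thesis using True by (simp add: hh of_real_prod[symmetric] del: of_real_prod)
    next
      case False
      then obtain i where i: "p i \<noteq> q i" by (metis ext)
      hence "i < n" using p q by (metis lessThan_iff mem_Collect_eq permutes_not_in)
      hence "(\<Prod>i<n. \<integral>z. h (p i) (q i) z \<partial>lborel) = 0"
        using i by (intro prod_zero) (auto simp: hh intro!: bexI[of _ i])
      thus ?thesis using False by simp
    qed
  qed
  also have "\<dots> = of_real (fact n * (\<Prod>k<n. m k))"
    using fS by (simp add: card_permutations[of "{..<n}" n])
  finally have I: "complex_of_real (\<integral>x. f x \<partial>?M) = of_real (fact n * (\<Prod>k<n. m k))"
    by simp
  have "integrable ?M f" using iif by (simp only: complex_of_real_integrable_eq)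
  hence "(\<integral>\<^sup>+x. ennreal (f x) \<partial>?M) = ennreal (\<integral>x. f x \<partial>?M)"
    by (rule nn_integral_eq_integral) (simp add: f0)
  also have "(\<integral>x. f x \<partial>?M) = fact n * (\<Prod>k<n. m k)"
    using I by (simp only: of_real_eq_iff)
  finally show ?thesis unfolding f_def m_def .
qed

lemma integrable_gaussian_moment:
  "integrable lborel (\<lambda>z::complex. norm z ^ k * exp (- (norm z)\<^sup>2))"
proof -
  have even: "integrable lborel (\<lambda>z::complex. norm z ^ (2 * j) * exp (- (norm z)\<^sup>2))" for j
    by (rule integrableI_nonneg) (auto simp: nn_integral_gaussian_moment)
  have bnd: "norm z ^ k \<le> 1 + norm z ^ (2 * k)" for z :: complex
  proof (cases "norm z \<le> 1")
    case True
    have "norm z ^ k \<le> 1" using True by (intro power_le_one) auto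
    thus ?thesis by (intro order_trans[OF _ add_increasing2]) auto
  next
    case False
    hence "norm z ^ k \<le> norm z ^ (2 * k)" by (intro power_increasing) auto
    thus ?thesis by simp
  qed
  have "norm z ^ k * exp (- (norm z)\<^sup>2) \<le> norm z ^ (2 * 0) * exp (- (norm z)\<^sup>2) + norm z ^ (2 * k) * exp (- (norm z)\<^sup>2)" for z :: complex
    using mult_right_mono[OF bnd[of z], of "exp (- (norm z)\<^sup>2)"] by (simp add: distrib_right)
  thus ?thesis
    by (intro Bochner_Integration.integrable_bound[OF Bochner_Integration.integrable_add[OF even[of 0] even[of k]]] AE_I2)
      auto
qed

lemma integral_gaussian_moment:
  "(\<integral>z. norm (z :: complex) ^ (2 * k) * exp (- (norm z)\<^sup>2) \<partial>lborel) = pi * fact k"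
  using integral_eq_nn_integral[of "\<lambda>z::complex. norm z ^ (2 * k) * exp (- (norm z)\<^sup>2)" lborel]
  by (simp add: nn_integral_gaussian_moment)

section \<open>Equality of the two functionals from equal total mass\<close>

lemma ginibre_integral_one: "ginibre_integral n (\<lambda>_. 1) = ennreal (pi ^ (n * n))"
proof -
  have "frob_square n x = (\<Sum>ij\<in>{..<n} \<times> {..<n}. (norm (x ij))\<^sup>2)" for x
    by (simp add: frob_square_def sum.cartesian_product case_prod_unfold)
  thus ?thesis
    using nn_integral_PiM_gaussian[of 1 "{..<n} \<times> {..<n}"] by (simp add: ginibre_integral_def)
qed

text \<open>The two total masses agree, which forces equality in \<open>eigenvalue_integral_le\<close>.\<close>

lemma eigenvalue_integral_one:
  "ennreal (ginibre_constant n) * eigenvalue_integral n (\<lambda>_. 1) = ennreal (pi ^ (n * n))"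
proof -
  have "eigenvalue_integral n (\<lambda>_. 1) = ennreal (fact n * (\<Prod>k<n. pi * fact k))"
  proof -
    have "exp (- (\<Sum>i<n. (norm (x i))\<^sup>2)) = (\<Prod>i<n. exp (- (norm (x i))\<^sup>2))" for x :: "nat \<Rightarrow> complex"
      by (simp add: exp_sum sum_negf[symmetric])
    hence "eigenvalue_integral n (\<lambda>_. 1) = (\<integral>\<^sup>+x. ennreal ((\<Prod>j<n. \<Prod>i<j. (norm (x j - x i))\<^sup>2) *
        (\<Prod>i<n. exp (- (norm (x i))\<^sup>2))) \<partial>lborel_vec n)"
      by (simp add: eigenvalue_integral_def vandermonde_square_def)
    also have "\<dots> = ennreal (fact n * (\<Prod>k<n. \<integral>z. norm (z :: complex) ^ (2 * k) * exp (- (norm z)\<^sup>2) \<partial>lborel))"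
      by (rule nn_integral_vandermonde_radial) (auto simp: norm_mult integrable_gaussian_moment)
    finally show ?thesis by (simp add: integral_gaussian_moment)
  qed
  moreover have "ginibre_constant n * (fact n * (\<Prod>k<n. pi * fact k)) = pi ^ (n * n)"
  proof (induction n)
    case (Suc n)
    have "ginibre_constant (Suc n) * (fact (Suc n) * (\<Prod>k<Suc n. pi * fact k))
      = ginibre_constant n * (fact n * (\<Prod>k<n. pi * fact k)) * (pi ^ (2 * n) * pi)"
    proof -
      have "ginibre_constant (Suc n) = ginibre_constant n * (pi ^ (2 * n) / fact (Suc n))"
        by (simp only: ginibre_constant_def prod.lessThan_Suc)
      thus ?thesis by (simp only: prod.lessThan_Suc) (simp del: fact_Suc)
    qed
    also have "\<dots> = pi ^ (Suc n * Suc n)"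
      unfolding Suc.IH by (simp add: power_add mult_2)
    finally show ?case .
  qed (simp add: ginibre_constant_def)
  ultimately show ?thesis
    using ginibre_constant_pos[of n] by (simp add: ennreal_mult[symmetric] prod_nonneg)
qed

text \<open>The inequality for the complement of \<open>A\<close> is the reverse inequality for
  \<open>A\<close>, because the total masses agree and are finite.\<close>

lemma measure_eqI_le_total:
  assumes sets: "sets M = sets N" and le: "\<And>A. A \<in> sets M \<Longrightarrow> emeasure N A \<le> emeasure M A"
    and total: "emeasure M (space M) = emeasure N (space N)" and fin: "emeasure M (space M) \<noteq> \<infinity>"
  shows "M = N"
proof (rule measure_eqI[OF sets])
  fix A assume A: "A \<in> sets M"
  have sp: "space M = space N" using sets by (rule sets_eq_imp_space_eq)
  have A': "A \<in> sets N" using A sets by simp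
  have "A \<subseteq> space M" using A by (rule sets.sets_into_space)
  have finA: "emeasure M X \<noteq> \<infinity>" "emeasure N X \<noteq> \<infinity>" if "X \<in> sets M" for X
    using fin emeasure_space[of M X] emeasure_space[of N X] total by (auto simp: top_unique)
  have c: "space M - A \<in> sets M" using A by auto
  have "emeasure M A = emeasure M (space M) - emeasure M (space M - A)"
    using A c finA \<open>A \<subseteq> space M\<close> emeasure_Diff[of M "space M - A" "space M"] by (simp add: double_diff)
  also have "\<dots> \<le> emeasure N (space N) - emeasure N (space N - A)"
    unfolding total using le[OF c] by (intro ennreal_minus_mono) (auto simp: sp)
  also have "\<dots> = emeasure N A"
    using A A' c finA sets \<open>A \<subseteq> space M\<close> emeasure_Diff[of N "space N - A" "space N"] by (simp add: double_diff sp)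
  finally show "emeasure M A = emeasure N A" using le[OF A] by (rule antisym)
qed

text \<open>Each side integrates \<open>H\<close> against a finite measure on polynomials: \<mu> is
  the image of the Gaussian matrix measure, \<nu> the scaled image of the eigenvalue density. The
  inequality on indicator functions together with equal mass gives \<open>\<mu> = \<nu>\<close>,
  hence the identity for every \<open>H\<close>.\<close>

lemma ginibre_integral_eq:
  assumes H: "H \<in> borel_measurable poly_space"
  shows "ginibre_integral n H = ennreal (ginibre_constant n) * eigenvalue_integral n H"
proof -
  let ?I = "{..<n} \<times> {..<n}"
  have m1[measurable]: "(\<lambda>x. char_poly (fmat n x)) \<in> lborel_PiM ?I \<rightarrow>\<^sub>M poly_space"
    by (intro measurable_char_poly measurable_lborel_PiM_coord) auto
  have w1[measurable]: "(\<lambda>x. ennreal (exp (- frob_square n x))) \<in> borel_measurable (lborel_PiM ?I)"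
    using measurable_frob_square[measurable] by measurable
  have m2[measurable]: "(\<lambda>x. \<Prod>i<n. [:- x i, 1:]) \<in> lborel_vec n \<rightarrow>\<^sub>M poly_space"
    by (intro measurable_prod_linear measurable_lborel_PiM_coord) auto
  let ?w2 = "\<lambda>x. ennreal (vandermonde_square n x * exp (- (\<Sum>i<n. (norm (x i))\<^sup>2)))"
  have w2[measurable]: "?w2 \<in> borel_measurable (lborel_vec n)"
    by (intro measurable_eigenvalue_weight measurable_lborel_PiM_coord) auto
  define \<mu> where "\<mu> = distr (density (lborel_PiM ?I) (\<lambda>x. ennreal (exp (- frob_square n x)))) poly_space (\<lambda>x. char_poly (fmat n x))"
  define \<nu> where "\<nu> = distr (density (lborel_vec n) (\<lambda>x. ennreal (ginibre_constant n) * ?w2 x)) poly_space (\<lambda>x. \<Prod>i<n. [:- x i, 1:])"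
  have \<mu>: "(\<integral>\<^sup>+p. K p \<partial>\<mu>) = ginibre_integral n K" if [measurable]: "K \<in> borel_measurable poly_space" for K
  proof -
    have "(\<lambda>x. K (char_poly (fmat n x))) \<in> borel_measurable (lborel_PiM ?I)"
      using measurable_compose[OF m1 that] .
    from nn_integral_density[OF w1 this] show ?thesis
      unfolding \<mu>_def ginibre_integral_def
      by (subst nn_integral_distr) (simp_all add: mult.commute)
  qed
  have \<nu>: "(\<integral>\<^sup>+p. K p \<partial>\<nu>) = ennreal (ginibre_constant n) * eigenvalue_integral n K"
    if [measurable]: "K \<in> borel_measurable poly_space" for K
  proof -
    have "(\<lambda>x. K (\<Prod>i<n. [:- x i, 1:])) \<in> borel_measurable (lborel_vec n)"
      using measurable_compose[OF m2 that] .
    from nn_integral_density[OF _ this, of "\<lambda>x. ennreal (ginibre_constant n) * ?w2 x"]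
    have "(\<integral>\<^sup>+p. K p \<partial>\<nu>) = (\<integral>\<^sup>+x. ennreal (ginibre_constant n) * (K (\<Prod>i<n. [:- x i, 1:]) * ?w2 x) \<partial>lborel_vec n)"
      unfolding \<nu>_def by (subst nn_integral_distr) (simp_all add: mult_ac)
    also have "\<dots> = ennreal (ginibre_constant n) * eigenvalue_integral n K"
      unfolding eigenvalue_integral_def by (rule nn_integral_cmult) measurable
    finally show ?thesis .
  qed
  have "\<mu> = \<nu>"
  proof (rule measure_eqI_le_total)
    show s: "sets \<mu> = sets \<nu>" by (simp add: \<mu>_def \<nu>_def)
    fix A assume "A \<in> sets \<mu>"
    hence A: "A \<in> sets poly_space" by (simp add: \<mu>_def)
    hence "emeasure \<nu> A = (\<integral>\<^sup>+p. indicator A p \<partial>\<nu>)" "emeasure \<mu> A = (\<integral>\<^sup>+p. indicator A p \<partial>\<mu>)"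
      by (simp_all add: \<mu>_def \<nu>_def)
    thus "emeasure \<nu> A \<le> emeasure \<mu> A"
      using A by (simp add: \<mu> \<nu> eigenvalue_integral_le)
  next
    have "emeasure \<nu> (space \<nu>) = (\<integral>\<^sup>+p. 1 \<partial>\<nu>)" "emeasure \<mu> (space \<mu>) = (\<integral>\<^sup>+p. 1 \<partial>\<mu>)" by simp_all
    thus "emeasure \<mu> (space \<mu>) = emeasure \<nu> (space \<nu>)" "emeasure \<mu> (space \<mu>) \<noteq> \<infinity>"
      by (simp_all only: \<mu>[OF borel_measurable_const] \<nu>[OF borel_measurable_const] ginibre_integral_one eigenvalue_integral_one) simp
  qed
  thus ?thesis using \<mu>[OF H] \<nu>[OF H] by simp
qed

section \<open>Events on the eigenvalue moduli\<close>

text \<open>By compactness, a polynomial has a root in \<open>K\<close> iff its modulus takes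
  arbitrarily small values there. By continuity a countable dense subset \<open>T\<close> detects
  this, which leaves countably many evaluations.\<close>

lemma poly_space_root_in_compact:
  assumes K: "compact K"
  shows "{p. \<exists>z\<in>K. poly p z = 0} \<in> sets poly_space"
proof -
  obtain T where T: "countable T" "T \<subseteq> K" "K \<subseteq> closure T"
    using separable[of K] by blast
  have "{p. \<exists>z\<in>K. poly p z = 0} = (\<Inter>n. \<Union>t\<in>T. {p. norm (poly p t) < 1 / real (Suc n)})"
  proof (intro equalityI subsetI)
    fix p assume "p \<in> {p. \<exists>z\<in>K. poly p z = 0}"
    then obtain z where z: "z \<in> K" "poly p z = 0" by blast
    have "\<exists>t\<in>T. norm (poly p t) < e" if "e > 0" for e
    proof -
      have "isCont (poly p) z" by (intro continuous_intros)
      then obtain d where d: "d > 0" and dd: "\<And>t. dist t z < d \<Longrightarrow> dist (poly p t) (poly p z) < e"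
        using \<open>e > 0\<close> unfolding continuous_at_eps_delta by (metis dist_commute)
      have "z \<in> closure T" using T(3) z(1) by blast
      then obtain t where t: "t \<in> T" "dist t z < d"
        using d unfolding closure_approachable by blast
      thus ?thesis using dd[OF t(2)] z(2) by (auto simp: dist_norm intro!: bexI[of _ t])
    qed
    thus "p \<in> (\<Inter>n. \<Union>t\<in>T. {p. norm (poly p t) < 1 / real (Suc n)})" by auto
  next
    fix p assume p: "p \<in> (\<Inter>n. \<Union>t\<in>T. {p. norm (poly p t) < 1 / real (Suc n)})"
    hence "T \<noteq> {}" by auto
    hence "K \<noteq> {}" using T by auto
    moreover have "continuous_on K (\<lambda>z. norm (poly p z))" by (intro continuous_intros)
    ultimately obtain z where z: "z \<in> K" "\<And>y. y \<in> K \<Longrightarrow> norm (poly p z) \<le> norm (poly p y)"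
      using continuous_attains_inf[OF K] by blast
    have "norm (poly p z) < 1 / real (Suc n)" for n
    proof -
      obtain t where "t \<in> T" "norm (poly p t) < 1 / real (Suc n)" using p by blast
      thus ?thesis using z(2)[of t] T(2) by auto
    qed
    hence "\<not> norm (poly p z) > 0"
      using reals_Archimedean[of "norm (poly p z)"] by (metis inverse_eq_divide less_asym)
    thus "p \<in> {p. \<exists>z\<in>K. poly p z = 0}" using z(1) by auto
  qed
  also have "\<dots> \<in> sets poly_space"
  proof (intro sets.countable_INT'' sets.countable_UN'' T)
    fix n t
    have "(\<lambda>p. norm (poly p t)) -` {..<1 / real (Suc n)} \<inter> space poly_space \<in> sets poly_space"
      by (rule measurable_sets[OF measurable_compose[OF poly_space_eval borel_measurable_norm]]) simp
    moreover have "(\<lambda>p. norm (poly p t)) -` {..<1 / real (Suc n)} \<inter> space poly_space = {p. norm (poly p t) < 1 / real (Suc n)}"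
      by auto
    ultimately show "{p. norm (poly p t) < 1 / real (Suc n)} \<in> sets poly_space" by simp
  qed (use sets.top[of poly_space] in auto)
  finally show ?thesis .
qed

definition roots_in :: "real set \<Rightarrow> complex poly set" where
  "roots_in S = {p. \<forall>z. poly p z = 0 \<longrightarrow> norm z \<in> S}"

text \<open>For closed \<open>S\<close> the forbidden points form an open set, which is a countable
  union of compact sets; the event is the complement of countably many root events.\<close>

lemma roots_in_sets:
  assumes "closed S"
  shows "roots_in S \<in> sets poly_space"
proof -
  have "open (norm -` (- S) :: complex set)"
    using assms by (intro open_vimage continuous_intros) auto
  then obtain C where C: "\<And>n. compact (C n)" "(\<Union>n::nat. C n) = (norm -` (- S) :: complex set)"
    using open_Union_compact_subsets by metis
  have "roots_in S = UNIV - (\<Union>n. {p. \<exists>z\<in>C n. poly p z = 0})"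
    using C(2) by (auto simp: roots_in_def)
  also have "\<dots> \<in> sets poly_space"
    using poly_space_root_in_compact[OF C(1)]
    by (intro sets.Diff sets.countable_UN) (use sets.top[of poly_space] in auto)
  finally show ?thesis .
qed

text \<open>Written with \<open>powr\<close> on the squared modulus to match
  \<open>ginibre_weight\<close>. By \<open>0 powr L = 0\<close> the product of these powers over all
  roots is the power of the product at every point, also when a root is 0.\<close>

definition radial_weight :: "real \<Rightarrow> real set \<Rightarrow> complex \<Rightarrow> real" where
  "radial_weight L S z = ((norm z)\<^sup>2) powr L * exp (- (norm z)\<^sup>2) * indicator S (norm z)"

lemma radial_weight_nonneg: "radial_weight L S z \<ge> 0"
  by (simp add: radial_weight_def)

lemma measurable_radial_weight[measurable]:
  assumes [measurable]: "S \<in> sets borel"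
  shows "radial_weight L S \<in> borel_measurable borel"
  unfolding radial_weight_def[abs_def] by measurable

lemma integrable_radial_weight:
  assumes L: "L \<ge> 0" and S: "S \<in> sets borel"
  shows "integrable lborel (\<lambda>z. norm z ^ k * radial_weight L S z)"
proof -
  obtain j :: nat where j: "L \<le> real j" using real_arch_simple by blast
  have bnd: "((norm z)\<^sup>2) powr L \<le> 1 + norm z ^ (2 * j)" for z :: complex
  proof (cases "norm z \<le> 1")
    case True
    hence "((norm z)\<^sup>2) powr L \<le> 1 powr L" using L by (intro powr_mono2) (auto simp: power_le_one)
    thus ?thesis by (simp add: add_increasing2)
  next
    case False
    hence n: "(norm z)\<^sup>2 \<ge> 1" by (simp add: one_le_power)
    hence "((norm z)\<^sup>2) powr L \<le> ((norm z)\<^sup>2) powr real j" using j by (intro powr_mono) auto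
    also have "\<dots> = norm z ^ (2 * j)" using False by (subst powr_realpow) (auto simp: power_mult)
    finally show ?thesis by simp
  qed
  have le: "norm z ^ k * radial_weight L S z \<le> norm z ^ k * exp (- (norm z)\<^sup>2) + norm z ^ (k + 2 * j) * exp (- (norm z)\<^sup>2)" for z
  proof -
    have "((norm z)\<^sup>2) powr L * indicator S (norm z) \<le> (1 + norm z ^ (2 * j)) * 1"
      by (intro mult_mono bnd) (auto simp: indicator_def)
    hence "norm z ^ k * exp (- (norm z)\<^sup>2) * (((norm z)\<^sup>2) powr L * indicator S (norm z)) \<le>
      norm z ^ k * exp (- (norm z)\<^sup>2) * (1 + norm z ^ (2 * j))"
      by (intro mult_left_mono) auto
    thus ?thesis by (simp add: radial_weight_def power_add algebra_simps)
  qed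
  show ?thesis
    by (rule Bochner_Integration.integrable_bound[OF Bochner_Integration.integrable_add[OF
          integrable_gaussian_moment[of k] integrable_gaussian_moment[of "k + 2 * j"]]])
      (use le S in \<open>auto simp: radial_weight_nonneg intro!: AE_I2\<close>)
qed

definition radial_moment :: "real \<Rightarrow> nat \<Rightarrow> real set \<Rightarrow> real" where
  "radial_moment L k S = (\<integral>z. norm z ^ (2 * k) * radial_weight L S z \<partial>lborel)"

text \<open>The chosen class function is multiplicative over the roots, both in the power of
  |p(0)|^2 and in the indicator. The eigenvalue density thus becomes the Vandermonde square times a
  product of radial weights, which the orthogonality formula integrates.\<close>

lemma ginibre_integral_roots_in:
  assumes L: "L \<ge> 0" and S: "closed S"
  shows "ginibre_integral n (\<lambda>p. ennreal (((norm (poly p 0))\<^sup>2) powr L) * indicator (roots_in S) p)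
    = ennreal (ginibre_constant n * fact n * (\<Prod>k<n. radial_moment L k S))"
proof -
  have Sb: "S \<in> sets borel" using S by simp
  let ?H = "\<lambda>p. ennreal (((norm (poly p 0))\<^sup>2) powr L) * indicator (roots_in S) p"
  have H: "?H \<in> borel_measurable poly_space"
    using roots_in_sets[OF S] by measurable
  have "?H (\<Prod>i<n. [:- x i, 1:]) * ennreal (vandermonde_square n x * exp (- (\<Sum>i<n. (norm (x i))\<^sup>2)))
     = ennreal ((\<Prod>j<n. \<Prod>i<j. (norm (x j - x i))\<^sup>2) * (\<Prod>i<n. radial_weight L S (x i)))" for x
  proof -
    have 1: "((norm (poly (\<Prod>i<n. [:- x i, 1:]) 0))\<^sup>2) powr L = (\<Prod>i<n. ((norm (x i))\<^sup>2) powr L)"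
    proof -
      have "(norm (poly (\<Prod>i<n. [:- x i, 1:]) 0))\<^sup>2 = (\<Prod>i<n. (norm (x i))\<^sup>2)"
        unfolding poly_prod_linear by (simp add: prod_norm[symmetric] prod_power_distrib)
      thus ?thesis by (simp add: prod_powr_distrib)
    qed
    have 2: "(indicator (roots_in S) (\<Prod>i<n. [:- x i, 1:]) :: ennreal) = ennreal (\<Prod>i<n. indicator S (norm (x i)))"
    proof (cases "\<forall>i<n. norm (x i) \<in> S")
      case True
      hence "(\<Prod>i<n. [:- x i, 1:]) \<in> roots_in S"
        by (auto simp: roots_in_def poly_prod_linear)
      thus ?thesis using True by simp
    next
      case False
      then obtain i where i: "i < n" "norm (x i) \<notin> S" by blast
      hence notin: "(\<Prod>i<n. [:- x i, 1:]) \<notin> roots_in S"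
        by (auto simp: roots_in_def poly_prod_linear intro!: exI[of _ "x i"])
      have "(\<Prod>i<n. indicator S (norm (x i)) :: real) = 0"
        using i by (intro prod_zero) (auto intro!: bexI[of _ i])
      thus ?thesis using notin by (simp only: indicator_simps ennreal_0 not_False_eq_True)
    qed
    have 3: "exp (- (\<Sum>i<n. (norm (x i))\<^sup>2)) = (\<Prod>i<n. exp (- (norm (x i))\<^sup>2))"
      by (simp add: exp_sum sum_negf[symmetric])
    show ?thesis
      unfolding 1 2 3 vandermonde_square_def radial_weight_def
      by (simp add: prod.distrib ennreal_mult'[symmetric] prod_nonneg mult_ac)
  qed
  hence "eigenvalue_integral n ?H = (\<integral>\<^sup>+x. ennreal ((\<Prod>j<n. \<Prod>i<j. (norm (x j - x i))\<^sup>2) *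
      (\<Prod>i<n. radial_weight L S (x i))) \<partial>lborel_vec n)"
    unfolding eigenvalue_integral_def by simp
  also have "\<dots> = ennreal (fact n * (\<Prod>k<n. radial_moment L k S))"
    unfolding radial_moment_def
    by (rule nn_integral_vandermonde_radial)
      (use Sb integrable_radial_weight[OF L Sb] in \<open>auto simp: radial_weight_nonneg radial_weight_def norm_mult\<close>)
  finally show ?thesis
    unfolding ginibre_integral_eq[OF H] using ginibre_constant_pos[of n]
    by (simp add: ennreal_mult'[symmetric] mult.assoc)
qed

text \<open>The determinant of \<open>A\<^sup>\<dagger> A\<close> is |det A|^2, and the
  characteristic polynomial at 0 is the determinant up to sign. The induced density is therefore a
  class function times the Gaussian weight.\<close>

lemma ginibre_weight_fmat:
  "ginibre_weight L (fmat n x) = ((norm (poly (char_poly (fmat n x)) 0))\<^sup>2) powr L * exp (- frob_square n x)"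
proof -
  have A: "fmat n x \<in> carrier_mat n n" by simp
  have "fmat n (\<lambda>(i, j). (if i = j then 0 else 0) - x (i, j)) = (- 1) \<cdot>\<^sub>m fmat n x"
    by (rule eq_matI) auto
  hence "norm (poly (char_poly (fmat n x)) 0) = norm (Determinant.det (fmat n x))"
    unfolding poly_char_poly_fmat by (simp add: norm_mult norm_power)
  moreover have "Determinant.det (mat_adjoint (fmat n x) * fmat n x) = of_real ((norm (Determinant.det (fmat n x)))\<^sup>2)"
    unfolding det_mult[OF mat_adjoint_carrier[OF A] A] det_mat_adjoint[OF A] complex_norm_square by (rule mult.commute)
  ultimately show ?thesis
    by (simp add: ginibre_weight_def mat_trace_adjoint_mult[OF A] frob_square_fmat del: of_real_power)
qed

text \<open>The probability is a product of moments up to a factor \<open>d\<close> that does not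
  depend on \<open>S\<close>; the factor gathers the unknown normalisation of the density and the
  constants of the integral identity. Taking \<open>S = UNIV\<close>, where the event is certain,
  determines it.\<close>

lemma induced_ginibre_prob_roots_in:
  assumes G: "induced_ginibre L n M G" and L: "L \<ge> 0" and S: "closed S"
  shows "measure M {\<omega> \<in> space M. char_poly (G \<omega>) \<in> roots_in S} =
    (\<Prod>k<n. radial_moment L k S) / (\<Prod>k<n. radial_moment L k UNIV)"
    and "{\<omega> \<in> space M. char_poly (G \<omega>) \<in> roots_in S} \<in> sets M"
proof -
  let ?I = "{..<n} \<times> {..<n}"
  interpret prob_space M using G by (simp add: induced_ginibre_def)
  from G obtain c where c: "c > 0"
    and dist: "distributed M (lborel_PiM ?I) (\<lambda>\<omega>. mat_entries n (G \<omega>)) (\<lambda>x. ennreal (c * ginibre_weight L (fmat n x)))"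
    and carr: "\<And>\<omega>. \<omega> \<in> space M \<Longrightarrow> G \<omega> \<in> carrier_mat n n"
    unfolding induced_ginibre_def lborel_entries_def by auto
  have X: "(\<lambda>\<omega>. mat_entries n (G \<omega>)) \<in> M \<rightarrow>\<^sub>M lborel_PiM ?I"
    using dist by (simp add: distributed_def)
  have char: "char_poly (fmat n (mat_entries n (G \<omega>))) = char_poly (G \<omega>)" if "\<omega> \<in> space M" for \<omega>
  proof -
    have "fmat n (mat_entries n (G \<omega>)) = G \<omega>"
      using carr[OF that] by (intro eq_matI) (auto simp: mat_entries_def)
    thus ?thesis by simp
  qed
  have mchar: "(\<lambda>x. char_poly (fmat n x)) \<in> lborel_PiM ?I \<rightarrow>\<^sub>M poly_space"
    by (intro measurable_char_poly measurable_lborel_PiM_coord) auto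
  have main: "{\<omega> \<in> space M. char_poly (G \<omega>) \<in> roots_in S} \<in> sets M"
     "emeasure M {\<omega> \<in> space M. char_poly (G \<omega>) \<in> roots_in S} =
       ennreal (c * (ginibre_constant n * fact n * (\<Prod>k<n. radial_moment L k S)))" if S: "closed S" for S
  proof -
    define E where "E = {x \<in> space (lborel_PiM ?I). char_poly (fmat n x) \<in> roots_in S}"
    have E: "E \<in> sets (lborel_PiM ?I)"
      using measurable_sets[OF mchar roots_in_sets[OF S]] by (simp add: E_def vimage_def Int_def conj_commute)
    have eq: "{\<omega> \<in> space M. char_poly (G \<omega>) \<in> roots_in S} = (\<lambda>\<omega>. mat_entries n (G \<omega>)) -` E \<inter> space M"
      using char measurable_space[OF X] by (auto simp: E_def)
    show "{\<omega> \<in> space M. char_poly (G \<omega>) \<in> roots_in S} \<in> sets M"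
      unfolding eq by (rule measurable_sets[OF X E])
    have "emeasure M {\<omega> \<in> space M. char_poly (G \<omega>) \<in> roots_in S} =
      (\<integral>\<^sup>+x. ennreal (c * ginibre_weight L (fmat n x)) * indicator E x \<partial>lborel_PiM ?I)"
      unfolding eq by (rule distributed_emeasure[OF dist E])
    also have "\<dots> = (\<integral>\<^sup>+x. ennreal c * (ennreal (((norm (poly (char_poly (fmat n x)) 0))\<^sup>2) powr L) *
       indicator (roots_in S) (char_poly (fmat n x)) * ennreal (exp (- frob_square n x))) \<partial>lborel_PiM ?I)"
      using c by (intro nn_integral_cong)
        (auto simp: ginibre_weight_fmat ennreal_mult' ennreal_mult E_def indicator_def mult_ac)
    also have "\<dots> = ennreal c * ginibre_integral n (\<lambda>p. ennreal (((norm (poly p 0))\<^sup>2) powr L) * indicator (roots_in S) p)"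
      unfolding ginibre_integral_def
    proof (rule nn_integral_cmult)
      have "(\<lambda>p. ennreal (((norm (poly p 0))\<^sup>2) powr L) * indicator (roots_in S) p) \<in> borel_measurable poly_space"
        using roots_in_sets[OF S] by measurable
      from measurable_ginibre_weight[OF this]
      show "(\<lambda>x. ennreal (((norm (poly (char_poly (fmat n x)) 0))\<^sup>2) powr L) *
         indicator (roots_in S) (char_poly (fmat n x)) * ennreal (exp (- frob_square n x))) \<in> borel_measurable (lborel_PiM ?I)" .
    qed
    also have "\<dots> = ennreal (c * (ginibre_constant n * fact n * (\<Prod>k<n. radial_moment L k S)))"
      using c by (simp add: ginibre_integral_roots_in[OF L S] ennreal_mult'[symmetric])
    finally show "emeasure M {\<omega> \<in> space M. char_poly (G \<omega>) \<in> roots_in S} =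
       ennreal (c * (ginibre_constant n * fact n * (\<Prod>k<n. radial_moment L k S)))" .
  qed
  show "{\<omega> \<in> space M. char_poly (G \<omega>) \<in> roots_in S} \<in> sets M" by (rule main(1)[OF S])
  have nn: "radial_moment L k S \<ge> 0" for k S
    unfolding radial_moment_def by (intro integral_nonneg_AE AE_I2) (auto simp: radial_weight_nonneg)
  define d where "d = c * (ginibre_constant n * fact n)"
  have d: "d > 0" using c ginibre_constant_pos[of n] by (simp add: d_def)
  have meas: "measure M {\<omega> \<in> space M. char_poly (G \<omega>) \<in> roots_in S} = d * (\<Prod>k<n. radial_moment L k S)" if "closed S" for S
  proof -
    have "c * (ginibre_constant n * fact n * (\<Prod>k<n. radial_moment L k S)) = d * (\<Prod>k<n. radial_moment L k S)"
      by (simp add: d_def mult.assoc)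
    hence "measure M {\<omega> \<in> space M. char_poly (G \<omega>) \<in> roots_in S} = enn2real (ennreal (d * (\<Prod>k<n. radial_moment L k S)))"
      unfolding measure_def main(2)[OF that] by (rule arg_cong)
    also have "\<dots> = d * (\<Prod>k<n. radial_moment L k S)"
      using d nn by (intro enn2real_ennreal mult_nonneg_nonneg prod_nonneg) auto
    finally show ?thesis .
  qed
  have D: "d * (\<Prod>k<n. radial_moment L k UNIV) = 1"
    using meas[of UNIV] prob_space by (simp add: roots_in_def)
  hence "(\<Prod>k<n. radial_moment L k UNIV) \<noteq> 0" by (metis mult_zero_right zero_neq_one)
  hence "d = 1 / (\<Prod>k<n. radial_moment L k UNIV)" using D by (simp add: eq_divide_eq)
  thus "measure M {\<omega> \<in> space M. char_poly (G \<omega>) \<in> roots_in S} =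
    (\<Prod>k<n. radial_moment L k S) / (\<Prod>k<n. radial_moment L k UNIV)"
    unfolding meas[OF S] by simp
qed

section \<open>Asymptotics\<close>

lemma radial_moment_nonneg: "radial_moment L k S \<ge> 0"
  unfolding radial_moment_def by (intro integral_nonneg_AE AE_I2) (auto simp: radial_weight_nonneg)

lemma radial_moment_pos:
  assumes L: "L \<ge> 0"
  shows "radial_moment L k {a..} > 0"
proof -
  let ?f = "\<lambda>z. norm z ^ (2 * k) * radial_weight L {a..} z"
  have int: "integrable lborel ?f" using L by (intro integrable_radial_weight) auto
  define b where "b = max 0 a"
  have "radial_moment L k {a..} \<noteq> 0"
  proof
    assume "radial_moment L k {a..} = 0"
    hence "AE z in lborel. ?f z = 0"
      using integral_nonneg_eq_0_iff_AE[OF int] by (simp add: radial_moment_def radial_weight_nonneg)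
    \<comment> \<open>A unit ball around \<open>b + 1\<close> with \<open>b = max 0 a\<close> stays
      where the modulus exceeds both 0 and \<open>a\<close>, so the weight is positive on
      it.\<close>
    hence "AE z in lborel. \<not> z \<in> ball (of_real (b + 1) :: complex) 1"
    proof (rule AE_mp, intro AE_I2 impI notI)
      fix z :: complex assume z: "?f z = 0" "z \<in> ball (of_real (b + 1)) 1"
      have "norm (of_real (b + 1) :: complex) = b + 1" by (simp only: norm_of_real) (simp add: b_def)
      hence "b < norm z"
        using z(2) norm_triangle_sub[of "of_real (b + 1)" z] by (simp add: dist_norm)
      hence "norm z > 0" "norm z \<ge> a" by (auto simp: b_def)
      thus False using z(1) by (simp add: radial_weight_def)
    qed
    hence "emeasure lborel (ball (of_real (b + 1) :: complex) 1) = 0"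
      by (subst (asm) AE_iff_measurable[OF _ refl]) (auto simp: ball_def)
    thus False by (simp add: emeasure_ball unit_ball_vol_2)
  qed
  thus ?thesis using radial_moment_nonneg[of L k "{a..}"] by simp
qed

lemma radial_moment_UNIV_pos: "L \<ge> 0 \<Longrightarrow> radial_moment L k UNIV > 0"
proof -
  assume "L \<ge> 0"
  have "radial_weight L {0..} z = radial_weight L UNIV z" for z
    by (simp add: radial_weight_def)
  thus ?thesis using radial_moment_pos[OF \<open>L \<ge> 0\<close>, of k 0] by (simp add: radial_moment_def)
qed

lemma radial_moment_mono:
  assumes "L \<ge> 0" "S \<subseteq> T" "S \<in> sets borel" "T \<in> sets borel"
  shows "radial_moment L k S \<le> radial_moment L k T"
  unfolding radial_moment_def using assms
  by (intro integral_mono integrable_radial_weight mult_left_mono)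
    (auto simp: radial_weight_def indicator_def)

lemma radial_moment_Un_Int:
  assumes L: "L \<ge> 0" and S: "S \<in> sets borel" and T: "T \<in> sets borel"
  shows "radial_moment L k (S \<union> T) + radial_moment L k (S \<inter> T) = radial_moment L k S + radial_moment L k T"
proof -
  note int = integrable_radial_weight[OF L]
  have "radial_moment L k (S \<union> T) + radial_moment L k (S \<inter> T) =
    (\<integral>z. norm z ^ (2 * k) * radial_weight L (S \<union> T) z + norm z ^ (2 * k) * radial_weight L (S \<inter> T) z \<partial>lborel)"
    unfolding radial_moment_def
    by (rule Bochner_Integration.integral_add[symmetric]; rule int; use S T in simp)
  also have "\<dots> = (\<integral>z. norm z ^ (2 * k) * radial_weight L S z + norm z ^ (2 * k) * radial_weight L T z \<partial>lborel)"
    by (intro Bochner_Integration.integral_cong) (auto simp: radial_weight_def indicator_def)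
  also have "\<dots> = radial_moment L k S + radial_moment L k T"
    unfolding radial_moment_def
    by (rule Bochner_Integration.integral_add; rule int; use S T in simp)
  finally show ?thesis .
qed

text \<open>The factor |z|^(2k) is at most r^(2k) on the disc of radius \<open>r\<close> and at
  least (2r)^(2k) outside the disc of radius \<open>2 * r\<close>. The ratio of these bounds is the
  factor 4^k, and the remaining moments have index 0.\<close>

lemma radial_moment_atMost_le:
  assumes L: "L \<ge> 0" and r: "r > 0"
  shows "radial_moment L k {..r} * (4 ^ k * radial_moment L 0 {2 * r..}) \<le> radial_moment L 0 UNIV * radial_moment L k UNIV"
proof -
  have "radial_moment L k {..r} \<le> (\<integral>z. r ^ (2 * k) * (norm z ^ (2 * 0) * radial_weight L UNIV z) \<partial>lborel)"
    unfolding radial_moment_def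
  proof (intro integral_mono integrable_mult_right integrable_radial_weight L)
    fix z :: complex
    show "norm z ^ (2 * k) * radial_weight L {..r} z \<le> r ^ (2 * k) * (norm z ^ (2 * 0) * radial_weight L UNIV z)"
    proof (cases "norm z \<le> r")
      case True
      have "norm z ^ (2 * k) \<le> r ^ (2 * k)" using True by (intro power_mono) auto
      thus ?thesis using True by (simp add: radial_weight_def mult_right_mono)
    next
      case False
      thus ?thesis using r radial_weight_nonneg[of L UNIV z] by (simp add: radial_weight_def)
    qed
  qed auto
  hence 1: "radial_moment L k {..r} \<le> r ^ (2 * k) * radial_moment L 0 UNIV"
    by (simp add: radial_moment_def)
  have "(\<integral>z. (2 * r) ^ (2 * k) * (norm z ^ (2 * 0) * radial_weight L {2 * r..} z) \<partial>lborel) \<le> radial_moment L k UNIV"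
    unfolding radial_moment_def
  proof (intro integral_mono integrable_mult_right integrable_radial_weight L)
    fix z :: complex
    show "(2 * r) ^ (2 * k) * (norm z ^ (2 * 0) * radial_weight L {2 * r..} z) \<le> norm z ^ (2 * k) * radial_weight L UNIV z"
    proof (cases "2 * r \<le> norm z")
      case True
      have "(2 * r) ^ (2 * k) \<le> norm z ^ (2 * k)" using True r by (intro power_mono) auto
      thus ?thesis using True by (simp add: radial_weight_def mult_right_mono)
    next
      case False
      thus ?thesis using radial_weight_nonneg[of L UNIV z] by (simp add: radial_weight_def)
    qed
  qed auto
  hence 2: "(2 * r) ^ (2 * k) * radial_moment L 0 {2 * r..} \<le> radial_moment L k UNIV"
    by (simp add: radial_moment_def)
  have "radial_moment L k {..r} * (4 ^ k * radial_moment L 0 {2 * r..})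
    \<le> r ^ (2 * k) * radial_moment L 0 UNIV * (4 ^ k * radial_moment L 0 {2 * r..})"
    using 1 radial_moment_nonneg by (intro mult_right_mono) auto
  also have "\<dots> = radial_moment L 0 UNIV * ((2 * r) ^ (2 * k) * radial_moment L 0 {2 * r..})"
    by (simp add: power_mult_distrib power_mult)
  also have "\<dots> \<le> radial_moment L 0 UNIV * radial_moment L k UNIV"
    using 2 radial_moment_nonneg by (intro mult_left_mono) auto
  finally show ?thesis .
qed

text \<open>Markov's inequality with |z|^2, which raises the index of the moment by one.\<close>

lemma radial_moment_atLeast_le:
  assumes L: "L \<ge> 0" and R: "R > 0"
  shows "radial_moment L k {R<..} * R\<^sup>2 \<le> radial_moment L (Suc k) UNIV"
proof -
  have "(\<integral>z. (norm z ^ (2 * k) * radial_weight L {R<..} z) * R\<^sup>2 \<partial>lborel) \<le> radial_moment L (Suc k) UNIV"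
    unfolding radial_moment_def
  proof (intro integral_mono integrable_mult_left integrable_radial_weight L)
    fix z :: complex
    show "(norm z ^ (2 * k) * radial_weight L {R<..} z) * R\<^sup>2 \<le> norm z ^ (2 * Suc k) * radial_weight L UNIV z"
    proof (cases "R < norm z")
      case True
      have "R\<^sup>2 \<le> (norm z)\<^sup>2" using True R by (intro power_mono) auto
      hence "norm z ^ (2 * k) * radial_weight L UNIV z * R\<^sup>2 \<le> norm z ^ (2 * k) * radial_weight L UNIV z * (norm z)\<^sup>2"
        by (intro mult_left_mono) (auto simp: radial_weight_nonneg)
      thus ?thesis using True by (simp add: radial_weight_def power_add power2_eq_square mult_ac)
    next
      case False
      thus ?thesis using radial_weight_nonneg[of L UNIV z] by (simp add: radial_weight_def)
    qed
  qed auto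
  thus ?thesis by (simp add: radial_moment_def)
qed

text \<open>The probability that the overview denotes by \<rho> with index \<open>k\<close>.\<close>

definition radial_prob :: "real \<Rightarrow> nat \<Rightarrow> real set \<Rightarrow> real" where
  "radial_prob L k S = radial_moment L k S / radial_moment L k UNIV"

lemma radial_prob_bounds:
  assumes "L \<ge> 0" "S \<in> sets borel"
  shows "0 \<le> radial_prob L k S" "radial_prob L k S \<le> 1"
  using radial_moment_mono[OF assms(1) subset_UNIV assms(2), of k] radial_moment_UNIV_pos[OF assms(1), of k]
    radial_moment_nonneg[of L k S] by (auto simp: radial_prob_def)

lemma radial_prob_mono:
  assumes "L \<ge> 0" "S \<subseteq> T" "S \<in> sets borel" "T \<in> sets borel"
  shows "radial_prob L k S \<le> radial_prob L k T"
  using radial_moment_mono[OF assms, of k] radial_moment_UNIV_pos[OF assms(1), of k]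
  by (simp add: radial_prob_def divide_right_mono)

lemma radial_prob_Un_Int:
  assumes "L \<ge> 0" "S \<in> sets borel" "T \<in> sets borel"
  shows "radial_prob L k (S \<union> T) + radial_prob L k (S \<inter> T) = radial_prob L k S + radial_prob L k T"
  using radial_moment_Un_Int[OF assms, of k] by (simp add: radial_prob_def add_divide_distrib[symmetric])

lemma radial_prob_compl:
  assumes L: "L \<ge> 0" and S: "S \<in> sets borel"
  shows "radial_prob L k (- S) = 1 - radial_prob L k S"
proof -
  have "radial_moment L k {} = 0" by (simp add: radial_moment_def radial_weight_def)
  moreover have "radial_prob L k UNIV = 1" using radial_moment_UNIV_pos[OF L, of k] by (simp add: radial_prob_def)
  ultimately show ?thesis
    using radial_prob_Un_Int[OF L S, of "- S" k] S by (simp add: radial_prob_def)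
qed

lemma radial_prob_atMost_geometric:
  assumes L: "L \<ge> 0"
  obtains C where "\<And>k. radial_prob L k {..r} \<le> C * (1 / 4) ^ k"
proof
  \<comment> \<open>The geometric bound requires a positive radius, whereas \<open>r\<close> is
    arbitrary.\<close>
  define s where "s = max r 1"
  have s: "s > 0" "{..r} \<subseteq> {..s}" by (auto simp: s_def)
  fix k
  have p: "radial_moment L 0 {2 * s..} > 0" "radial_moment L k UNIV > 0"
    using radial_moment_pos[OF L] radial_moment_UNIV_pos[OF L] by auto
  have "radial_prob L k {..r} \<le> radial_prob L k {..s}"
    using s(2) by (intro radial_prob_mono[OF L]) auto
  also have "\<dots> \<le> radial_moment L 0 UNIV / radial_moment L 0 {2 * s..} * (1 / 4) ^ k"
    using radial_moment_atMost_le[OF L s(1), of k] p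
    by (simp add: radial_prob_def field_simps power_divide)
  finally show "radial_prob L k {..r} \<le> radial_moment L 0 UNIV / radial_moment L 0 {2 * s..} * (1 / 4) ^ k" .
qed

lemma radial_prob_tail_tendsto:
  assumes L: "L \<ge> 0"
  shows "((\<lambda>R. radial_prob L k {R<..}) \<longlongrightarrow> 0) at_top"
proof (rule tendsto_sandwich)
  let ?c = "radial_moment L (Suc k) UNIV / radial_moment L k UNIV"
  show "eventually (\<lambda>R. 0 \<le> radial_prob L k {R<..}) at_top"
    using radial_prob_bounds(1)[OF L] by (intro always_eventually) auto
  show "eventually (\<lambda>R. radial_prob L k {R<..} \<le> ?c * inverse (R\<^sup>2)) at_top"
    using eventually_gt_at_top[of 0]
  proof eventually_elim
    case (elim R)
    thus ?case
      using radial_moment_atLeast_le[OF L elim, of k] radial_moment_UNIV_pos[OF L, of k]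
      by (simp add: radial_prob_def field_simps)
  qed
  have "((\<lambda>R::real. inverse (R\<^sup>2)) \<longlongrightarrow> 0) at_top"
    by (intro tendsto_inverse_0_at_top filterlim_pow_at_top filterlim_ident) auto
  from tendsto_mult_left[OF this, of ?c] show "((\<lambda>R. ?c * inverse (R\<^sup>2)) \<longlongrightarrow> 0) at_top" by simp
qed auto

text \<open>All factors are at most 1 and the last one is already geometrically small; passing to
  \<open>Suc n\<close> brings this last factor into view.\<close>

lemma prod_radial_prob_atMost_tendsto:
  assumes L: "L \<ge> 0"
  shows "(\<lambda>n. \<Prod>k<n. radial_prob L k {..R}) \<longlonglongrightarrow> 0"
proof -
  obtain C where C: "\<And>k. radial_prob L k {..R} \<le> C * (1 / 4) ^ k"
    using radial_prob_atMost_geometric[OF L] by blast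
  have "(\<lambda>n. \<Prod>k<Suc n. radial_prob L k {..R}) \<longlonglongrightarrow> 0"
  proof (rule tendsto_sandwich)
    show "\<forall>\<^sub>F n in sequentially. 0 \<le> (\<Prod>k<Suc n. radial_prob L k {..R})"
      using radial_prob_bounds(1)[OF L] by (intro always_eventually allI prod_nonneg) auto
    show "\<forall>\<^sub>F n in sequentially. (\<Prod>k<Suc n. radial_prob L k {..R}) \<le> C * (1 / 4) ^ n"
    proof (intro always_eventually allI)
      fix n
      have "(\<Prod>k<n. radial_prob L k {..R}) * radial_prob L n {..R} \<le> 1 * radial_prob L n {..R}"
        using radial_prob_bounds[OF L] by (intro mult_right_mono prod_le_1) auto
      thus "(\<Prod>k<Suc n. radial_prob L k {..R}) \<le> C * (1 / 4) ^ n" using C[of n] by simp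
    qed
    show "(\<lambda>n. C * (1 / 4) ^ n) \<longlonglongrightarrow> 0"
      by (intro tendsto_mult_right_zero LIMSEQ_realpow_zero) auto
  qed auto
  thus ?thesis by (rule LIMSEQ_imp_Suc)
qed

text \<open>The sequence \<open>R\<close> is arbitrary and may alternate between small and large
  values, so the two regimes are separated for each \<open>n\<close> individually, at a threshold
  \<open>R0\<close> that does not depend on \<open>n\<close>.\<close>

lemma asymptotic_independence:
  fixes R :: "nat \<Rightarrow> real"
  assumes L: "L \<ge> 0"
  shows "(\<lambda>n. (\<Prod>k<n. radial_prob L k {r..R n}) -
     (\<Prod>k<n. radial_prob L k {r..}) * (\<Prod>k<n. radial_prob L k {..R n})) \<longlonglongrightarrow> 0"
proof (rule LIMSEQ_I)
  fix e :: real assume e: "e > 0"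
  define a where "a k = radial_prob L k {..r}" for k
  define b where "b k x = radial_prob L k {x<..}" for k x
  have a0: "0 \<le> a k" "a k \<le> 1" for k unfolding a_def by (intro radial_prob_bounds[OF L]; simp)+
  have b0: "0 \<le> b k x" "b k x \<le> 1" for k x unfolding b_def by (intro radial_prob_bounds[OF L]; simp)+
  obtain C where C: "\<And>k. a k \<le> C * (1 / 4) ^ k"
    using radial_prob_atMost_geometric[OF L] unfolding a_def by blast
  have "summable a"
    by (rule summable_comparison_test'[of "\<lambda>k. C * (1 / 4) ^ k" 0]) (use C a0 in \<open>auto intro: summable_mult summable_geometric\<close>)
  then obtain K where K: "\<And>m n. m \<ge> K \<Longrightarrow> norm (sum a {m..<n}) < e / 2"
    using e unfolding summable_Cauchy by (meson half_gt_zero)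
  have "((\<lambda>x. \<Sum>k<K. b k x) \<longlongrightarrow> (\<Sum>k<K. 0)) at_top"
    unfolding b_def by (intro tendsto_sum radial_prob_tail_tendsto L)
  hence "eventually (\<lambda>x. (\<Sum>k<K. b k x) < e / 2) at_top"
    using e by (intro order_tendstoD) auto
  then obtain x0 where x0: "\<And>x. x \<ge> x0 \<Longrightarrow> (\<Sum>k<K. b k x) < e / 2"
    unfolding eventually_at_top_linorder by blast
  \<comment> \<open>Including \<open>r\<close> guarantees \<open>r \<le> R n\<close> in the regime
    of large radii, so that the two half-lines cover the real line there.\<close>
  define R0 where "R0 = max x0 r"
  from LIMSEQ_D[OF prod_radial_prob_atMost_tendsto[OF L, of R0] e]
  obtain N where N: "\<And>n. n \<ge> N \<Longrightarrow> norm (\<Prod>k<n. radial_prob L k {..R0}) < e" by auto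
  show "\<exists>no. \<forall>n\<ge>no. norm ((\<Prod>k<n. radial_prob L k {r..R n}) -
     (\<Prod>k<n. radial_prob L k {r..}) * (\<Prod>k<n. radial_prob L k {..R n}) - 0) < e"
  proof (intro exI[of _ N] allI impI)
    fix n assume n: "n \<ge> N"
    define P where "P S = (\<Prod>k<n. radial_prob L k S)" for S
    have P0: "0 \<le> P S" "P S \<le> 1" if "S \<in> sets borel" for S
      unfolding P_def using radial_prob_bounds[OF L that] by (auto intro!: prod_nonneg prod_le_1)
    have "\<bar>P {r..R n} - P {r..} * P {..R n}\<bar> < e"
    proof (cases "R n \<ge> R0")
      case False
      have "P {..R n} \<le> P {..R0}" unfolding P_def
        using False radial_prob_bounds[OF L] by (intro prod_mono conjI radial_prob_mono[OF L]) auto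
      also have "P {..R0} < e" using N[OF n] unfolding P_def by simp
      finally have lt: "P {..R n} < e" .
      have "P {r..R n} \<le> P {..R n}" unfolding P_def
        using radial_prob_bounds[OF L] by (intro prod_mono conjI radial_prob_mono[OF L]) auto
      moreover have "P {r..} * P {..R n} \<le> 1 * P {..R n}" by (intro mult_right_mono P0) auto
      moreover have "0 \<le> P {r..R n}" "0 \<le> P {r..} * P {..R n}" by (intro P0 mult_nonneg_nonneg; simp)+
      ultimately show ?thesis using lt by linarith
    next
      case True
      have rR: "r \<le> R n" "x0 \<le> R n" using True by (auto simp: R0_def)
      \<comment> \<open>Telescoping: for factors in the unit interval, a difference of products is
        bounded by the sum of the differences of the factors.\<close>
      have "\<bar>P {r..R n} - P {r..} * P {..R n}\<bar> \<le> (\<Sum>k<n. \<bar>radial_prob L k {r..R n} - radial_prob L k {r..} * radial_prob L k {..R n}\<bar>)"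
        unfolding P_def prod.distrib[symmetric]
        using norm_prod_diff[of "{..<n}" "\<lambda>k. radial_prob L k {r..R n}" "\<lambda>k. radial_prob L k {r..} * radial_prob L k {..R n}"]
          radial_prob_bounds[OF L]
        by (simp add: abs_mult mult_le_one)
      also have "\<dots> \<le> (\<Sum>k<n. a k * b k (R n))"
      proof (rule sum_mono)
        fix k
        have "{r..} \<union> {..R n} = UNIV" "{r..} \<inter> {..R n} = {r..R n}" using rR by auto
        hence "1 + radial_prob L k {r..R n} = radial_prob L k {r..} + radial_prob L k {..R n}"
          using radial_prob_Un_Int[OF L, of "{r..}" "{..R n}" k] radial_moment_UNIV_pos[OF L, of k]
          by (simp add: radial_prob_def)
        \<comment> \<open>With \<alpha> and \<beta> the masses below \<open>r\<close> and above
          \<open>R n\<close>, the two terms are \<open>1 - \<alpha> - \<beta>\<close> and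
          \<open>(1 - \<alpha>) * (1 - \<beta>)\<close>, which differ by
          \<open>\<alpha> * \<beta>\<close>.\<close>
        hence "radial_prob L k {r..R n} - radial_prob L k {r..} * radial_prob L k {..R n}
          = - ((1 - radial_prob L k {r..}) * (1 - radial_prob L k {..R n}))"
          by (simp add: algebra_simps)
        also have "1 - radial_prob L k {r..} = radial_prob L k {..<r}"
          using radial_prob_compl[OF L, of "{r..}" k] by (simp add: Compl_atLeast)
        also have "1 - radial_prob L k {..R n} = b k (R n)"
          using radial_prob_compl[OF L, of "{..R n}" k] by (simp add: Compl_atMost b_def)
        finally have "\<bar>radial_prob L k {r..R n} - radial_prob L k {r..} * radial_prob L k {..R n}\<bar> = radial_prob L k {..<r} * b k (R n)"
          using b0[of k "R n"] radial_prob_bounds(1)[OF L, of "{..<r}" k] by (simp add: abs_mult)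
        also have "\<dots> \<le> a k * b k (R n)"
          unfolding a_def by (intro mult_right_mono b0 radial_prob_mono[OF L]) auto
        finally show "\<bar>radial_prob L k {r..R n} - radial_prob L k {r..} * radial_prob L k {..R n}\<bar> \<le> a k * b k (R n)" .
      qed
      \<comment> \<open>\<open>K\<close> may exceed \<open>n\<close>; enlarging the index set by
        nonnegative terms allows the same split in either case.\<close>
      also have "\<dots> \<le> (\<Sum>k\<in>{..<K} \<union> {K..<n}. a k * b k (R n))"
        by (intro sum_mono2) (auto intro!: mult_nonneg_nonneg a0 b0)
      also have "\<dots> = (\<Sum>k<K. a k * b k (R n)) + (\<Sum>k\<in>{K..<n}. a k * b k (R n))"
        by (intro sum.union_disjoint) auto
      \<comment> \<open>Below \<open>K\<close> the upper tails are small since \<open>R n\<close> is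
        at least \<open>x0\<close>; from \<open>K\<close> on the summability of \<open>a\<close>
        suffices, uniformly in the radius.\<close>
      also have "\<dots> \<le> (\<Sum>k<K. 1 * b k (R n)) + (\<Sum>k\<in>{K..<n}. a k * 1)"
        by (intro add_mono sum_mono mult_mono a0 b0) auto
      also have "\<dots> < e"
        using x0[OF rR(2)] K[of K n] by simp
      finally show ?thesis .
    qed
    thus "norm ((\<Prod>k<n. radial_prob L k {r..R n}) -
      (\<Prod>k<n. radial_prob L k {r..}) * (\<Prod>k<n. radial_prob L k {..R n}) - 0) < e"
      unfolding P_def by simp
  qed
qed

text \<open>The spectrum is the root set of the characteristic polynomial. For
  \<open>n \<ge> 1\<close> it is nonempty, so the minimum and the maximum over it are genuine and
  can be compared elementwise.\<close>

lemma eigenvalue_moduli_iff: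
  assumes A: "A \<in> carrier_mat n n" and n: "n \<ge> 1"
  shows "min_eigenvalue_modulus A \<ge> r \<longleftrightarrow> char_poly A \<in> roots_in {r..}"
    and "spectral_radius A \<le> R \<longleftrightarrow> char_poly A \<in> roots_in {..R}"
proof -
  have fin: "finite (norm ` spectrum A)" and ne: "norm ` spectrum A \<noteq> {}"
    using card_finite_spectrum(1)[OF A] spectrum_non_empty[OF A] n by auto
  have sp: "z \<in> spectrum A \<longleftrightarrow> poly (char_poly A) z = 0" for z
    unfolding spectrum_root_char_poly[OF A] by simp
  show "min_eigenvalue_modulus A \<ge> r \<longleftrightarrow> char_poly A \<in> roots_in {r..}"
    unfolding min_eigenvalue_modulus_def Min_ge_iff[OF fin ne] by (auto simp: roots_in_def sp)
  show "spectral_radius A \<le> R \<longleftrightarrow> char_poly A \<in> roots_in {..R}"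
    unfolding spectral_radius_def Max_le_iff[OF fin ne] by (auto simp: roots_in_def sp)
qed

theorem theorem8:
  fixes L r :: real
    and R :: "nat \<Rightarrow> real"
    and B_L :: "real set"
    and B_LN :: "nat \<Rightarrow> real set"
    and M :: "nat \<Rightarrow> 'a measure"
    and G :: "nat \<Rightarrow> 'a \<Rightarrow> complex mat"
  assumes "L \<ge> 0"
    and "\<And>N. N \<ge> 1 \<Longrightarrow> induced_ginibre L N (M N) (G N)"
    and "B_L \<in> sets borel" and "sqrt L \<in> interior B_L"
    and "\<And>N. N \<ge> 1 \<Longrightarrow> B_LN N \<in> sets borel"
    and "\<And>N. N \<ge> 1 \<Longrightarrow> sqrt (L + real N) \<in> interior (B_LN N)"
    and "r \<in> B_L"
    and "\<And>N. N \<ge> 1 \<Longrightarrow> R N \<in> B_LN N"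
  shows "(\<lambda>N.
      \<P>(\<omega> in M N. min_eigenvalue_modulus (G N \<omega>) \<ge> r \<and> spectral_radius (G N \<omega>) \<le> R N)
    - \<P>(\<omega> in M N. min_eigenvalue_modulus (G N \<omega>) \<ge> r)
      * \<P>(\<omega> in M N. spectral_radius (G N \<omega>) \<le> R N)) \<longlonglongrightarrow> 0"
proof (rule Lim_transform_eventually[OF asymptotic_independence[OF \<open>L \<ge> 0\<close>, of r R]])
  show "\<forall>\<^sub>F N in sequentially. (\<Prod>k<N. radial_prob L k {r..R N}) -
     (\<Prod>k<N. radial_prob L k {r..}) * (\<Prod>k<N. radial_prob L k {..R N}) =
      \<P>(\<omega> in M N. min_eigenvalue_modulus (G N \<omega>) \<ge> r \<and> spectral_radius (G N \<omega>) \<le> R N)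
    - \<P>(\<omega> in M N. min_eigenvalue_modulus (G N \<omega>) \<ge> r)
      * \<P>(\<omega> in M N. spectral_radius (G N \<omega>) \<le> R N)"
    using eventually_ge_at_top[of 1]
  proof eventually_elim
    case (elim N)
    note G = assms(2)[OF elim]
    have carr: "G N \<omega> \<in> carrier_mat N N" if "\<omega> \<in> space (M N)" for \<omega>
      using G that by (simp add: induced_ginibre_def)
    have prob: "\<P>(\<omega> in M N. char_poly (G N \<omega>) \<in> roots_in S) = (\<Prod>k<N. radial_prob L k S)" if "closed S" for S
      using induced_ginibre_prob_roots_in(1)[OF G \<open>L \<ge> 0\<close> that] by (simp add: radial_prob_def prod_dividef)
    have "\<P>(\<omega> in M N. min_eigenvalue_modulus (G N \<omega>) \<ge> r) = (\<Prod>k<N. radial_prob L k {r..})"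
      unfolding prob[OF closed_atLeast, symmetric]
      by (intro arg_cong[where f = "measure (M N)"] Collect_cong) (use eigenvalue_moduli_iff(1)[OF carr elim] in blast)
    moreover have "\<P>(\<omega> in M N. spectral_radius (G N \<omega>) \<le> R N) = (\<Prod>k<N. radial_prob L k {..R N})"
      unfolding prob[OF closed_atMost, symmetric]
      by (intro arg_cong[where f = "measure (M N)"] Collect_cong) (use eigenvalue_moduli_iff(2)[OF carr elim] in blast)
    moreover have "\<P>(\<omega> in M N. min_eigenvalue_modulus (G N \<omega>) \<ge> r \<and> spectral_radius (G N \<omega>) \<le> R N)
       = (\<Prod>k<N. radial_prob L k {r..R N})"
    proof -
      \<comment> \<open>The joint event is again one about a single closed set. If
        \<open>R N < r\<close> this set is empty, and the product formula still applies.\<close>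
      have "char_poly A \<in> roots_in {r..} \<and> char_poly A \<in> roots_in {..R N} \<longleftrightarrow> char_poly A \<in> roots_in {r..R N}" for A
        by (auto simp: roots_in_def)
      thus ?thesis
        unfolding prob[OF closed_atLeastAtMost, symmetric]
        by (intro arg_cong[where f = "measure (M N)"] Collect_cong) (use eigenvalue_moduli_iff[OF carr elim] in blast)
    qed
    ultimately show ?case by simp
  qed
qed

end
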